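(* For every integer $n\geq 3$, the affine Artin group ${\mathcal A}_{\widetilde B_n}$ of type $\widetilde B_n$ is virtually poly-free.
   Context: Let $K$ be a finite set and $m:K\times K\to\{1,2,\dots,\infty\}$ a map with $m(s,s)=1$ and $m(s,s')=m(s',s)\geq 2$ for $s\neq s'$. The Coxeter group of $(K,m)$ is $\langle K\mid (ss')^{m(s,s')}=1,\ s,s'\in K,\ m(s,s')<\infty\rangle$. The Artin group associated with this Coxeter group is the group with generating set $K$ and, for each pair $s\neq s'$ with $m(s,s')<\infty$, the relation $ss'ss'\cdots=s'ss's\cdots$, where each side is an alternating word with exactly $m(s,s')$ factors. The affine Artin group ${\mathcal A}_{\widetilde B_n}$ ($n\ge 3$) is the Artin group associated with the affine Coxeter group of type $\widetilde B_n$. Explicitly, $K=\{s_0,s_1,\dots,s_n\}$ with $m(s_0,s_2)=3$, $m(s_i,s_{i+1})=3$ for $1\le i\le n-2$, $m(s_{n-1},s_n)=4$, and $m(s_i,s_j)=2$ for all other pairs $i\neq j$. A group $G$ is poly-free if it admits a finite series of subgroups $1=G_0\trianglelefteq G_1\trianglelefteq\cdots\trianglelefteq G_k=G$, each normal in the next, such that $G_{i+1}/G_i$ is a free group (not necessarily of finite rank) for $i=0,1,\dots,k-1$. A group is virtually poly-free if it contains a poly-free subgroup of finite index. *)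

theory Defs
  imports "HOL-Algebra.Algebra" "HOL-Library.Extended_Nat"
begin

section \<open>Groups given by generators and relations\<close>

text \<open>A letter \<open>(s, True)\<close> stands for the generator \<open>s\<close>, and \<open>(s, False)\<close> for its inverse.\<close>

type_synonym 'a gword = "('a \<times> bool) list"

definition gwords :: "'a set \<Rightarrow> 'a gword set"
  where "gwords S = lists (S \<times> UNIV)"

text \<open>
  The congruence on the words over \<open>S\<close> presenting the group with generating set \<open>S\<close> and
  relations \<open>u = v\<close> for \<open>(u, v) \<in> R\<close>. Pairs in \<open>R\<close> that are not words over \<open>S\<close> play no role.
\<close>

inductive_set pres_rel :: "'a set \<Rightarrow> ('a gword \<times> 'a gword) set \<Rightarrow> ('a gword \<times> 'a gword) set"
  for S :: "'a set" and R :: "('a gword \<times> 'a gword) set"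
where
  refl: "w \<in> gwords S \<Longrightarrow> (w, w) \<in> pres_rel S R"
| sym: "(u, v) \<in> pres_rel S R \<Longrightarrow> (v, u) \<in> pres_rel S R"
| trans: "(u, v) \<in> pres_rel S R \<Longrightarrow> (v, w) \<in> pres_rel S R \<Longrightarrow> (u, w) \<in> pres_rel S R"
| cancel: "s \<in> S \<Longrightarrow> ([(s, b), (s, \<not> b)], []) \<in> pres_rel S R"
| relation: "(u, v) \<in> R \<Longrightarrow> u \<in> gwords S \<Longrightarrow> v \<in> gwords S \<Longrightarrow> (u, v) \<in> pres_rel S R"
| append: "(u, u') \<in> pres_rel S R \<Longrightarrow> (v, v') \<in> pres_rel S R \<Longrightarrow> (u @ v, u' @ v') \<in> pres_rel S R"

definition presented_group :: "'a set \<Rightarrow> ('a gword \<times> 'a gword) set \<Rightarrow> 'a gword set monoid"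
  where "presented_group S R =
    \<lparr>carrier = gwords S // pres_rel S R,
     monoid.mult = (\<lambda>A B. \<Union>u\<in>A. \<Union>v\<in>B. pres_rel S R `` {u @ v}),
     one = pres_rel S R `` {[]}\<rparr>"

lemma pres_rel_gwords: "(u, v) \<in> pres_rel S R \<Longrightarrow> u \<in> gwords S \<and> v \<in> gwords S"
  by (induction rule: pres_rel.induct) (auto simp: gwords_def)

lemma equiv_pres_rel: "equiv (gwords S) (pres_rel S R)"
proof (rule equivI)
  show "pres_rel S R \<subseteq> gwords S \<times> gwords S"
    using pres_rel_gwords by fastforce
  show "refl_on (gwords S) (pres_rel S R)"
    by (simp add: refl_on_def pres_rel.refl)
  show "Relation.sym (pres_rel S R)"
    by (rule symI) (rule pres_rel.sym)
  show "Relation.trans (pres_rel S R)"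
    by (rule transI) (rule pres_rel.trans)
qed

lemma presented_group_mult_class:
  assumes "u \<in> gwords S" "v \<in> gwords S"
  shows "pres_rel S R `` {u} \<otimes>\<^bsub>presented_group S R\<^esub> pres_rel S R `` {v}
    = pres_rel S R `` {u @ v}"
proof -
  have eq: "pres_rel S R `` {u' @ v'} = pres_rel S R `` {u @ v}"
    if "(u, u') \<in> pres_rel S R" "(v, v') \<in> pres_rel S R" for u' v'
    using equiv_class_eq[OF equiv_pres_rel pres_rel.append[OF that]] by simp
  have mem: "u \<in> pres_rel S R `` {u}" "v \<in> pres_rel S R `` {v}"
    using assms by (simp_all add: pres_rel.refl)
  have "(\<Union>u'\<in>pres_rel S R `` {u}. \<Union>v'\<in>pres_rel S R `` {v}. pres_rel S R `` {u' @ v'})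
      = (\<Union>u'\<in>pres_rel S R `` {u}. \<Union>v'\<in>pres_rel S R `` {v}. pres_rel S R `` {u @ v})"
    by (intro SUP_cong eq) simp_all
  also have "\<dots> = pres_rel S R `` {u @ v}"
    using mem by blast
  finally show ?thesis
    by (simp add: presented_group_def)
qed

definition inv_gword :: "'a gword \<Rightarrow> 'a gword"
  where "inv_gword w = rev (map (\<lambda>(s, b). (s, \<not> b)) w)"

lemma inv_gword_closed: "w \<in> gwords S \<Longrightarrow> inv_gword w \<in> gwords S"
  by (auto simp: inv_gword_def gwords_def)

lemma inv_gword_cancel: "w \<in> gwords S \<Longrightarrow> (inv_gword w @ w, []) \<in> pres_rel S R"
proof (induction w)
  case Nil
  then show ?case by (simp add: inv_gword_def pres_rel.refl)
next
  case (Cons x w)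
  obtain s b where x: "x = (s, b)" by (cases x)
  have s: "s \<in> S" and w: "w \<in> gwords S" using Cons.prems by (auto simp: gwords_def x)
  have "([(s, \<not> b), (s, \<not> \<not> b)], []) \<in> pres_rel S R" by (rule pres_rel.cancel[OF s])
  from pres_rel.append[OF this pres_rel.refl[OF w]]
  have "([(s, \<not> b), (s, b)] @ w, w) \<in> pres_rel S R" by simp
  from pres_rel.append[OF pres_rel.refl[OF inv_gword_closed[OF w]] this]
  have "(inv_gword w @ ([(s, \<not> b), (s, b)] @ w), inv_gword w @ w) \<in> pres_rel S R" .
  from pres_rel.trans[OF this Cons.IH[OF w]] show ?case
    by (simp add: inv_gword_def x)
qed

lemma group_presented_group: "group (presented_group S R)"
proof (rule groupI)
  let ?G = "presented_group S R"
  have cls: "\<exists>w\<in>gwords S. x = pres_rel S R `` {w}" if "x \<in> carrier ?G" for x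
    using that by (auto simp: presented_group_def quotient_def)
  have carrier: "pres_rel S R `` {w} \<in> carrier ?G" if "w \<in> gwords S" for w
    using that by (auto simp: presented_group_def quotient_def)
  have nil: "[] \<in> gwords S" by (simp add: gwords_def)
  have app: "u @ v \<in> gwords S" if "u \<in> gwords S" "v \<in> gwords S" for u v :: "'a gword"
    using that by (simp add: gwords_def)
  have one: "\<one>\<^bsub>?G\<^esub> = pres_rel S R `` {[]}" by (simp add: presented_group_def)
  show "\<one>\<^bsub>?G\<^esub> \<in> carrier ?G" using carrier[OF nil] one by simp
  show "x \<otimes>\<^bsub>?G\<^esub> y \<in> carrier ?G" if "x \<in> carrier ?G" "y \<in> carrier ?G" for x y
    using cls[OF that(1)] cls[OF that(2)]
    by (auto simp: presented_group_mult_class intro!: carrier app)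
  show "x \<otimes>\<^bsub>?G\<^esub> y \<otimes>\<^bsub>?G\<^esub> z = x \<otimes>\<^bsub>?G\<^esub> (y \<otimes>\<^bsub>?G\<^esub> z)"
    if "x \<in> carrier ?G" "y \<in> carrier ?G" "z \<in> carrier ?G" for x y z
    using cls[OF that(1)] cls[OF that(2)] cls[OF that(3)]
    by (auto simp: presented_group_mult_class app)
  show "\<one>\<^bsub>?G\<^esub> \<otimes>\<^bsub>?G\<^esub> x = x" if "x \<in> carrier ?G" for x
    using cls[OF that] by (auto simp: one presented_group_mult_class nil)
  show "\<exists>y\<in>carrier ?G. y \<otimes>\<^bsub>?G\<^esub> x = \<one>\<^bsub>?G\<^esub>" if x: "x \<in> carrier ?G" for x
  proof -
    obtain w where w: "w \<in> gwords S" "x = pres_rel S R `` {w}" using cls[OF x] by blast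
    have "pres_rel S R `` {inv_gword w} \<otimes>\<^bsub>?G\<^esub> x = \<one>\<^bsub>?G\<^esub>"
      using equiv_class_eq[OF equiv_pres_rel inv_gword_cancel[OF w(1)]]
      by (simp add: one w presented_group_mult_class inv_gword_closed)
    then show ?thesis using carrier[OF inv_gword_closed[OF w(1)]] by blast
  qed
qed


section \<open>Free, poly-free and virtually poly-free groups\<close>

definition free_group :: "'a set \<Rightarrow> 'a gword set monoid"
  where "free_group S = presented_group S {}"

text \<open>
  Taking the basis in the type of the elements of \<open>G\<close> is no restriction, since a basis of a free
  group is a subset of the group. The rank is arbitrary.
\<close>

definition is_free_group :: "('a, 'b) monoid_scheme \<Rightarrow> bool"
  where "is_free_group G \<longleftrightarrow> group G \<and> (\<exists>S :: 'a set. G \<cong> free_group S)"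

definition poly_free :: "('a, 'b) monoid_scheme \<Rightarrow> bool"
  where "poly_free G \<longleftrightarrow> group G \<and>
    (\<exists>(k :: nat) (N :: nat \<Rightarrow> 'a set).
       N 0 = {\<one>\<^bsub>G\<^esub>} \<and> N k = carrier G \<and>
       (\<forall>i\<le>k. subgroup (N i) G) \<and>
       (\<forall>i<k. N i \<lhd> G\<lparr>carrier := N (Suc i)\<rparr> \<and>
              is_free_group (G\<lparr>carrier := N (Suc i)\<rparr> Mod N i)))"

definition virtually_poly_free :: "('a, 'b) monoid_scheme \<Rightarrow> bool"
  where "virtually_poly_free G \<longleftrightarrow> group G \<and>
    (\<exists>H. subgroup H G \<and> finite (rcosets\<^bsub>G\<^esub> H) \<and> poly_free (G\<lparr>carrier := H\<rparr>))"


section \<open>Artin groups\<close>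

definition coxeter_matrix :: "'a set \<Rightarrow> ('a \<Rightarrow> 'a \<Rightarrow> enat) \<Rightarrow> bool"
  where "coxeter_matrix K m \<longleftrightarrow> finite K \<and> (\<forall>s\<in>K. m s s = 1) \<and>
    (\<forall>s\<in>K. \<forall>t\<in>K. s \<noteq> t \<longrightarrow> m s t = m t s \<and> m s t \<ge> 2)"

text \<open>The word \<open>s t s t \<dots>\<close> with exactly \<open>k\<close> factors.\<close>

fun alternating :: "nat \<Rightarrow> 'a \<Rightarrow> 'a \<Rightarrow> 'a gword"
  where
    "alternating 0 s t = []"
  | "alternating (Suc k) s t = (s, True) # alternating k t s"

definition artin_group :: "'a set \<Rightarrow> ('a \<Rightarrow> 'a \<Rightarrow> enat) \<Rightarrow> 'a gword set monoid"
  where "artin_group K m = presented_group K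
    {(alternating k s t, alternating k t s) | k s t. s \<in> K \<and> t \<in> K \<and> s \<noteq> t \<and> m s t = enat k}"

text \<open>The affine type \<open>B\<close> diagram on the vertices \<open>0, \<dots>, n\<close>, meaningful for \<open>n \<ge> 3\<close>.\<close>

definition affine_B_matrix :: "nat \<Rightarrow> nat \<Rightarrow> nat \<Rightarrow> enat"
  where "affine_B_matrix n i j =
    (if i = j then 1
     else if {i, j} = {0, 2} then 3
     else if \<exists>k. 1 \<le> k \<and> k \<le> n - 2 \<and> {i, j} = {k, k + 1} then 3
     else if {i, j} = {n - 1, n} then 4
     else 2)"

lemma coxeter_matrix_affine_B: "coxeter_matrix {0..n} (affine_B_matrix n)"
  by (auto simp: coxeter_matrix_def affine_B_matrix_def insert_commute)

definition affine_B_artin_group :: "nat \<Rightarrow> nat gword set monoid"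
  where "affine_B_artin_group n = artin_group {0..n} (affine_B_matrix n)"

end

theory Submission
  imports Defs
begin

text \<open>The proof builds a tower of groups in which each step is either a split extension with free
  kernel or an inclusion of finite index. Write \<open>A(B)\<close> for the Artin group of type \<open>B\<close> on the
  generators \<open>s\<^sub>1, \<dots>, s\<^sub>n\<close>.

  \<^item> Sending \<open>s\<^sub>0\<close> and \<open>s\<^sub>1\<close> to the first generator, and every other generator to itself,
    maps the affine group onto \<open>A(B)\<close>, and the remaining generators provide a section. To see the
    kernel, adjoin an involution \<open>e\<close> with \<open>s\<^sub>0 = e s\<^sub>1 e\<close>. The kernel of the enlarged
    group is generated by conjugates \<open>e\<^sub>j\<close> of \<open>e\<close>, one for each integer \<open>j\<close>, which correspond to
    the points over \<open>n\<close> marked points in the infinite cyclic cover of an annulus. They generate a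
    free product of groups of order two, and the elements of even length in it form the kernel for
    the affine group, which is free on \<open>b\<^sub>j = e\<^sub>j e\<^sub>j\<^sub>+\<^sub>1\<close>. In the
    affine group itself \<open>b\<^sub>0 = s\<^sub>0 s\<^sub>1\<^sup>-\<^sup>1\<close>, and \<open>b\<^sub>j\<close> is its conjugate by the \<open>j\<close>-th power of
    \<open>\<tau> = s\<^sub>1 \<dots> s\<^sub>n\<close>. The rank is infinite.
  \<^item> \<open>A(B)\<close> is the group of braids on \<open>n\<close> strands in a punctured plane. Forgetting the puncture
    maps it onto the braid group on \<open>n\<close> strands, with kernel free on the loops of the strands
    around the puncture.
  \<^item> Regarding the puncture as a fixed strand, \<open>A(B)\<close> is also the subgroup of index \<open>n + 1\<close>
    in the braid group on \<open>n + 1\<close> strands in which one strand returns to its place.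

  The last two steps give, by induction on the number of strands, that all braid groups and all
  groups \<open>A(B)\<close> are virtually poly-free; the first step then gives the affine group. The lemmas
  \<open>virtually_poly_free_extension\<close> and \<open>virtually_poly_free_finite_index\<close> carry the property along
  the tower.

  Everything is done with presentations, and no normal forms are used. That the kernels are free on
  the asserted elements is decided by \<open>free_kernel_criterion\<close>: generation is a matter of
  conjugation formulas, and freeness follows once the whole group acts on the set of elements
  of a free group in such a way that the asserted basis acts by left translations. Such an action
  need only be given on the generators of the presented group, so that the work consists in checking
  the braid relations for permutations of a free group. The inclusion of finite index is handled in
  the same way, by letting the braid group act on what should become its set of cosets.\<close>

section \<open>Generators, relations and homomorphisms\<close>

definition gen_class :: "'a set \<Rightarrow> ('a gword \<times> 'a gword) set \<Rightarrow> 'a \<Rightarrow> 'a gword set"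
  where "gen_class S R s = pres_rel S R `` {[(s, True)]}"

fun word_val :: "('g, 'x) monoid_scheme \<Rightarrow> ('a \<Rightarrow> 'g) \<Rightarrow> 'a gword \<Rightarrow> 'g"
  where
    "word_val G f [] = \<one>\<^bsub>G\<^esub>"
  | "word_val G f ((s, b) # w) = (if b then f s else inv\<^bsub>G\<^esub> f s) \<otimes>\<^bsub>G\<^esub> word_val G f w"

lemma gwords_Cons: "(s, b) # w \<in> gwords S \<longleftrightarrow> s \<in> S \<and> w \<in> gwords S"
  by (auto simp: gwords_def)

lemma gwords_Nil: "[] \<in> gwords S"
  by (simp add: gwords_def)

lemma gwords_append: "u @ v \<in> gwords S \<longleftrightarrow> u \<in> gwords S \<and> v \<in> gwords S"
  by (simp add: gwords_def)

lemma (in group) word_val_closed: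
  assumes "f \<in> S \<rightarrow> carrier G" "w \<in> gwords S"
  shows "word_val G f w \<in> carrier G"
  using assms(2)
proof (induction w)
  case (Cons a w)
  then show ?case using assms(1) by (cases a) (auto simp: gwords_Cons Pi_iff)
qed simp

lemma (in group) word_val_append:
  assumes "f \<in> S \<rightarrow> carrier G" "u \<in> gwords S" "v \<in> gwords S"
  shows "word_val G f (u @ v) = word_val G f u \<otimes> word_val G f v"
  using assms(2)
proof (induction u)
  case Nil
  then show ?case using word_val_closed[OF assms(1,3)] by simp
next
  case (Cons a u)
  obtain s b where a: "a = (s, b)" by (cases a)
  then have "s \<in> S" "u \<in> gwords S" using Cons.prems by (auto simp: gwords_Cons)
  then show ?case
    using Cons.IH word_val_closed[OF assms(1)] assms(1,3) by (auto simp: a m_assoc Pi_iff)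
qed

text \<open>The congruence defining a presented group is the smallest one containing the relations, so any
  evaluation that respects the relations respects all of it.\<close>

lemma (in group) word_val_cong:
  assumes f: "f \<in> S \<rightarrow> carrier G"
    and rel: "\<And>u v. (u, v) \<in> R \<Longrightarrow> u \<in> gwords S \<Longrightarrow> v \<in> gwords S \<Longrightarrow> word_val G f u = word_val G f v"
    and uv: "(u, v) \<in> pres_rel S R"
  shows "word_val G f u = word_val G f v"
  using uv
proof induction
  case (cancel s b)
  then show ?case using f by (auto simp: Pi_iff)
next
  case (append u u' v v')
  have "u \<in> gwords S" "u' \<in> gwords S" "v \<in> gwords S" "v' \<in> gwords S"
    using append.hyps pres_rel_gwords by blast+
  then show ?case using append.IH by (simp add: word_val_append[OF f])
qed (use rel in auto)

lemma carrier_presented_groupE: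
  assumes "x \<in> carrier (presented_group S R)"
  obtains w where "w \<in> gwords S" "x = pres_rel S R `` {w}"
  using assms by (auto simp: presented_group_def quotient_def)

lemma class_in_carrier:
  "w \<in> gwords S \<Longrightarrow> pres_rel S R `` {w} \<in> carrier (presented_group S R)"
  by (auto simp: presented_group_def quotient_def)

lemma gen_class_closed: "s \<in> S \<Longrightarrow> gen_class S R s \<in> carrier (presented_group S R)"
  unfolding gen_class_def by (rule class_in_carrier) (simp add: gwords_def)

text \<open>The universal property of a presentation; the homomorphism evaluates any representative word.\<close>

lemma presented_group_hom:
  assumes "group H" and f: "f \<in> S \<rightarrow> carrier H"
    and rel: "\<And>u v. (u, v) \<in> R \<Longrightarrow> u \<in> gwords S \<Longrightarrow> v \<in> gwords S \<Longrightarrow> word_val H f u = word_val H f v"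
  shows "\<exists>h. h \<in> hom (presented_group S R) H \<and> (\<forall>s\<in>S. h (gen_class S R s) = f s)"
proof -
  interpret H: group H by fact
  define h where "h A = the_elem (word_val H f ` A)" for A
  have h: "h (pres_rel S R `` {w}) = word_val H f w" if w: "w \<in> gwords S" for w
  proof -
    have "word_val H f v = word_val H f w" if "v \<in> pres_rel S R `` {w}" for v
      using H.word_val_cong[OF f rel, of R w v] that by simp
    moreover have "w \<in> pres_rel S R `` {w}" using pres_rel.refl[OF w] by simp
    ultimately have "word_val H f ` (pres_rel S R `` {w}) = {word_val H f w}" by blast
    then show ?thesis by (simp add: h_def)
  qed
  show ?thesis
  proof (intro exI[of _ h] conjI ballI)
    show "h \<in> hom (presented_group S R) H"
    proof (rule homI)
      fix x y assume "x \<in> carrier (presented_group S R)" "y \<in> carrier (presented_group S R)"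
      then obtain u v where u: "u \<in> gwords S" "x = pres_rel S R `` {u}"
        and v: "v \<in> gwords S" "y = pres_rel S R `` {v}" by (metis carrier_presented_groupE)
      then show "h (x \<otimes>\<^bsub>presented_group S R\<^esub> y) = h x \<otimes>\<^bsub>H\<^esub> h y"
        by (simp add: presented_group_mult_class h gwords_append H.word_val_append[OF f])
      show "h x \<in> carrier H" using u by (simp add: h H.word_val_closed[OF f])
    qed
    show "h (gen_class S R s) = f s" if "s \<in> S" for s
      using that f by (simp add: gen_class_def h gwords_def Pi_iff)
  qed
qed

text \<open>Evaluating a word at the generators themselves gives its class. Through this lemma relations
  between words become equations between group elements.\<close>

lemma word_val_gen_class:
  assumes "w \<in> gwords S"
  shows "word_val (presented_group S R) (gen_class S R) w = pres_rel S R `` {w}"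
proof -
  let ?G = "presented_group S R"
  interpret G: group ?G by (rule group_presented_group)
  have g: "gen_class S R \<in> S \<rightarrow> carrier ?G" by (simp add: gen_class_closed)
  have letter: "word_val ?G (gen_class S R) [(s, b)] = pres_rel S R `` {[(s, b)]}" if s: "s \<in> S" for s b
  proof (cases b)
    case True
    then show ?thesis using gen_class_closed[OF s] by (simp add: gen_class_def)
  next
    case False
    have gw: "[(s, c)] \<in> gwords S" for c using s by (simp add: gwords_def)
    have "pres_rel S R `` {[(s, False)]} \<otimes>\<^bsub>?G\<^esub> gen_class S R s = \<one>\<^bsub>?G\<^esub>"
    proof -
      have "([(s, False), (s, \<not> False)], []) \<in> pres_rel S R" by (rule pres_rel.cancel[OF s])
      from equiv_class_eq[OF equiv_pres_rel this] show ?thesis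
        by (simp add: gen_class_def presented_group_mult_class gw) (simp add: presented_group_def)
    qed
    then have "inv\<^bsub>?G\<^esub> gen_class S R s = pres_rel S R `` {[(s, False)]}"
      using G.inv_equality gen_class_closed[OF s] class_in_carrier[OF gw] by metis
    then show ?thesis using False class_in_carrier[OF gw[of False], of R] by simp
  qed
  show ?thesis using assms
  proof (induction w)
    case Nil
    then show ?case by (simp add: presented_group_def)
  next
    case (Cons a w)
    obtain s b where a: "a = (s, b)" by (cases a)
    then have s: "s \<in> S" and w: "w \<in> gwords S" using Cons.prems by (auto simp: gwords_Cons)
    have "[(s, b)] \<in> gwords S" using s by (simp add: gwords_def)
    moreover from this have "word_val ?G (gen_class S R) ([(s, b)] @ w) =
        pres_rel S R `` {[(s, b)]} \<otimes>\<^bsub>?G\<^esub> pres_rel S R `` {w}"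
      using G.word_val_append[OF g _ w] letter[OF s] Cons.IH[OF w] by metis
    ultimately show ?case using w by (simp add: presented_group_mult_class a)
  qed
qed

lemma presented_group_relation:
  assumes "(u, v) \<in> R" "u \<in> gwords S" "v \<in> gwords S"
  shows "word_val (presented_group S R) (gen_class S R) u = word_val (presented_group S R) (gen_class S R) v"
  using assms pres_rel.relation[OF assms] equiv_class_eq[OF equiv_pres_rel]
  by (simp add: word_val_gen_class)

lemma (in group) word_val_in_subgroup:
  assumes "subgroup H G" "f \<in> S \<rightarrow> H" "w \<in> gwords S"
  shows "word_val G f w \<in> H"
proof -
  interpret H: subgroup H G by fact
  show ?thesis using assms(3)
  proof (induction w)
    case (Cons a w)
    obtain s b where a: "a = (s, b)" by (cases a)
    then have "f s \<in> H" "word_val G f w \<in> H" using Cons assms(2) by (auto simp: gwords_Cons)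
    then show ?case by (simp add: a)
  qed simp
qed

lemma generate_gen_class:
  "generate (presented_group S R) (gen_class S R ` S) = carrier (presented_group S R)"
proof
  interpret G: group "presented_group S R" by (rule group_presented_group)
  have sub: "gen_class S R ` S \<subseteq> carrier (presented_group S R)" by (rule image_subsetI) (rule gen_class_closed)
  show "generate (presented_group S R) (gen_class S R ` S) \<subseteq> carrier (presented_group S R)"
    by (rule G.generate_incl[OF sub])
  have g: "gen_class S R \<in> S \<rightarrow> generate (presented_group S R) (gen_class S R ` S)"
    by (auto intro: generate.incl)
  show "carrier (presented_group S R) \<subseteq> generate (presented_group S R) (gen_class S R ` S)"
  proof
    fix x assume "x \<in> carrier (presented_group S R)"
    then obtain w where w: "w \<in> gwords S" "x = pres_rel S R `` {w}" by (rule carrier_presented_groupE)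
    then show "x \<in> generate (presented_group S R) (gen_class S R ` S)"
      using G.word_val_in_subgroup[OF G.generate_is_subgroup[OF sub] g w(1)] by (simp add: word_val_gen_class)
  qed
qed

lemma hom_eq_on_generate:
  assumes "group G" "group H" "h \<in> hom G H" "h' \<in> hom G H" "A \<subseteq> carrier G"
    and eq: "\<And>a. a \<in> A \<Longrightarrow> h a = h' a" and x: "x \<in> generate G A"
  shows "h x = h' x"
proof -
  interpret h: group_hom G H h using assms by (simp add: group_hom_def group_hom_axioms_def)
  interpret h': group_hom G H h' using assms by (simp add: group_hom_def group_hom_axioms_def)
  show ?thesis using x
  proof induction
    case (eng y z)
    then have "y \<in> carrier G" "z \<in> carrier G" using h.G.generate_in_carrier[OF assms(5)] by blast+
    then show ?case using eng by simp
  qed (use assms(5) eq in auto)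
qed

lemma (in group_hom) hom_generate_subset:
  assumes "subgroup K H" "A \<subseteq> carrier G" "\<And>a. a \<in> A \<Longrightarrow> h a \<in> K" "x \<in> generate G A"
  shows "h x \<in> K"
proof -
  interpret K: subgroup K H by fact
  show ?thesis using assms(4)
  proof induction
    case (inv a)
    then have "a \<in> carrier G" "h a \<in> K" using assms(2,3) by blast+
    then show ?case by simp
  next
    case (eng y z)
    then have "y \<in> carrier G" "z \<in> carrier G" using G.generate_in_carrier[OF assms(2)] by blast+
    then show ?case using eng by simp
  qed (use assms(3) in auto)
qed

section \<open>Free groups\<close>

abbreviation free_gen :: "'a set \<Rightarrow> 'a \<Rightarrow> 'a gword set"
  where "free_gen S \<equiv> gen_class S {}"

lemma group_free_group: "group (free_group S)"
  by (simp add: free_group_def group_presented_group)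

lemma free_gen_closed: "s \<in> S \<Longrightarrow> free_gen S s \<in> carrier (free_group S)"
  by (simp add: free_group_def gen_class_closed)

lemma generate_free_gen: "generate (free_group S) (free_gen S ` S) = carrier (free_group S)"
  by (simp add: free_group_def generate_gen_class)

lemma free_group_hom:
  assumes "group H" "f \<in> S \<rightarrow> carrier H"
  obtains h where "h \<in> hom (free_group S) H" "\<And>s. s \<in> S \<Longrightarrow> h (free_gen S s) = f s"
proof -
  obtain h where h: "h \<in> hom (presented_group S {}) H" "\<forall>s\<in>S. h (gen_class S {} s) = f s"
    using presented_group_hom[OF assms, of "{}"] by auto
  then show ?thesis by (intro that[of h]) (simp_all add: free_group_def)
qed

lemma free_group_hom_eq:
  assumes "group H" "h \<in> hom (free_group S) H" "h' \<in> hom (free_group S) H"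
    and "\<And>s. s \<in> S \<Longrightarrow> h (free_gen S s) = h' (free_gen S s)" and "x \<in> carrier (free_group S)"
  shows "h x = h' x"
proof (rule hom_eq_on_generate[OF group_free_group assms(1-3), of "free_gen S ` S"])
  show "free_gen S ` S \<subseteq> carrier (free_group S)" by (rule image_subsetI) (rule free_gen_closed)
  show "h a = h' a" if "a \<in> free_gen S ` S" for a using that assms(4) by auto
  show "x \<in> generate (free_group S) (free_gen S ` S)" using assms(5) by (simp add: generate_free_gen)
qed

text \<open>The exponent sum of one generator, a homomorphism to the integers, tells it apart from the others.\<close>

lemma inj_on_free_gen: "inj_on (free_gen S) S"
proof (rule inj_onI)
  fix s t assume s: "s \<in> S" and t: "t \<in> S" and eq: "free_gen S s = free_gen S t"
  interpret Z: group integer_group by (rule group_integer_group)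
  define e :: "'a \<Rightarrow> int" where "e u = (if u = s then 1 else 0)" for u
  have "e \<in> S \<rightarrow> carrier integer_group" by simp
  then obtain h :: "'a gword set \<Rightarrow> int" where "h \<in> hom (free_group S) integer_group"
    and h: "\<And>u. u \<in> S \<Longrightarrow> h (free_gen S u) = e u"
    by (rule free_group_hom[OF Z.is_group, where f = e]) (rule that)
  have "e s = h (free_gen S s)" by (rule h[OF s, symmetric])
  also have "\<dots> = h (free_gen S t)" by (rule arg_cong[OF eq])
  also have "\<dots> = e t" by (rule h[OF t])
  finally show "s = t" by (simp add: e_def split: if_splits)
qed

lemma hom_id: "(\<lambda>x. x) \<in> hom G G"
  by (simp add: hom_def)

lemma hom_fixing_generators:
  assumes "group G" "h \<in> hom G G" "A \<subseteq> carrier G" "generate G A = carrier G"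
    and "\<And>a. a \<in> A \<Longrightarrow> h a = a" and "x \<in> carrier G"
  shows "h x = x"
  using hom_eq_on_generate[OF assms(1,1,2) hom_id assms(3,5)] assms(4,6) by simp

lemma free_group_bij_iso:
  assumes "bij_betw f S T"
  shows "free_group S \<cong> free_group T"
proof -
  define g where "g = the_inv_into S f"
  have f: "f s \<in> T" "g (f s) = s" if "s \<in> S" for s
    using assms that by (auto simp: g_def bij_betw_def the_inv_into_f_f)
  have g: "g t \<in> S" "f (g t) = t" if "t \<in> T" for t
    using assms that bij_betwE[OF bij_betw_the_inv_into[OF assms]]
    by (auto simp: g_def bij_betw_def f_the_inv_into_f)
  obtain h where h: "h \<in> hom (free_group S) (free_group T)"
    "\<And>s. s \<in> S \<Longrightarrow> h (free_gen S s) = free_gen T (f s)"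
    by (rule free_group_hom[OF group_free_group, of "\<lambda>s. free_gen T (f s)" S T]) (auto simp: f free_gen_closed)
  obtain k where k: "k \<in> hom (free_group T) (free_group S)"
    "\<And>t. t \<in> T \<Longrightarrow> k (free_gen T t) = free_gen S (g t)"
    by (rule free_group_hom[OF group_free_group, of "\<lambda>t. free_gen S (g t)" T S]) (auto simp: g free_gen_closed)
  have "k (h x) = x" if "x \<in> carrier (free_group S)" for x
    using free_group_hom_eq[OF group_free_group hom_compose[OF h(1) k(1)] hom_id _ that] h k f by simp
  moreover have "h (k x) = x" if "x \<in> carrier (free_group T)" for x
    using free_group_hom_eq[OF group_free_group hom_compose[OF k(1) h(1)] hom_id _ that] h k g by simp
  ultimately have "bij_betw h (carrier (free_group S)) (carrier (free_group T))"
    using h(1) k(1) by (intro bij_betw_byWitness[where f' = k]) (auto simp: hom_def)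
  then have "h \<in> iso (free_group S) (free_group T)" using h(1) by (simp add: iso_def)
  then show ?thesis by (auto simp: is_iso_def)
qed

text \<open>
  \<open>is_free_group\<close> asks for a basis inside the type of the group. A free group on an index set of
  another type qualifies because its generators are distinct and can be carried over as elements.
\<close>

lemma is_free_groupI:
  fixes G :: "('g, 'x) monoid_scheme"
  assumes G: "group G" and h: "h \<in> iso (free_group I) G"
  shows "is_free_group G"
proof -
  define b where "b i = h (free_gen I i)" for i
  have inj: "inj_on h (carrier (free_group I))" using h by (simp add: iso_def bij_betw_def)
  have "inj_on b I"
    using inj inj_on_free_gen[of I] free_gen_closed[of _ I] by (auto simp: inj_on_def b_def)
  then have "free_group I \<cong> free_group (b ` I)" by (intro free_group_bij_iso) (rule inj_on_imp_bij_betw)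
  moreover have "G \<cong> free_group I"
    using h group.iso_sym[OF group_free_group] by (auto simp: is_iso_def)
  ultimately have "G \<cong> free_group (b ` I)" using G iso_trans by blast
  then show ?thesis using G by (auto simp: is_free_group_def)
qed

lemma is_free_group_iso:
  fixes G :: "('a, 'x) monoid_scheme"
  assumes "is_free_group G" "G \<cong> H" "group H"
  shows "is_free_group H"
proof -
  have G: "group G" using assms(1) by (simp add: is_free_group_def)
  obtain S :: "'a set" where S: "G \<cong> free_group S" using assms(1) unfolding is_free_group_def by blast
  have "free_group S \<cong> H" using S assms(2) G group.iso_sym iso_trans by blast
  then show ?thesis using is_free_groupI[OF assms(3)] by (auto simp: is_iso_def)
qed

lemma is_free_group_trivial:
  assumes "group G" "carrier G = {\<one>\<^bsub>G\<^esub>}"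
  shows "is_free_group G"
proof -
  interpret G: group G by fact
  have c: "carrier (free_group {} :: 'b gword set monoid) = {\<one>\<^bsub>free_group {}\<^esub>}"
    by (auto simp: free_group_def presented_group_def quotient_def gwords_def)
  then have "(\<lambda>_. \<one>\<^bsub>G\<^esub>) \<in> iso (free_group ({} :: 'b set)) G"
    using assms by (auto simp: iso_def hom_def bij_betw_def)
  then show ?thesis using is_free_groupI[OF assms(1)] by blast
qed

section \<open>Closure properties of virtually poly-free groups\<close>

lemma subgroup_preimage:
  assumes "group_hom G Q f" "subgroup L Q"
  shows "subgroup {g \<in> carrier G. f g \<in> L} G"
proof -
  interpret f: group_hom G Q f by fact
  interpret L: subgroup L Q by fact
  show ?thesis by (rule f.G.subgroupI) (auto intro!: exI[of _ "\<one>\<^bsub>G\<^esub>"])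
qed

text \<open>This is the form in which each step of a poly-free series is produced.\<close>

lemma free_quotient_by_kernel:
  assumes "group_hom G Q f" "f ` carrier G = carrier Q" "is_free_group Q"
  shows "kernel G Q f \<lhd> G" "is_free_group (G Mod kernel G Q f)"
proof -
  interpret f: group_hom G Q f by fact
  show n: "kernel G Q f \<lhd> G" by (rule f.normal_kernel)
  have g: "group (G Mod kernel G Q f)" by (rule normal.factorgroup_is_group[OF n])
  have "Q \<cong> G Mod kernel G Q f" using f.FactGroup_iso[OF assms(2)] group.iso_sym[OF g] by blast
  then show "is_free_group (G Mod kernel G Q f)" by (rule is_free_group_iso[OF assms(3) _ g])
qed

text \<open>A series for the quotient is pulled back along the homomorphism and prolonged at the bottom by the
  kernel. Pulling back does not change the factors, by the isomorphism theorem applied to the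
  composite with the next factor map.\<close>

lemma poly_free_extension:
  assumes f: "group_hom G Q f" and surj: "f ` carrier G = carrier Q"
    and ker: "is_free_group (G\<lparr>carrier := kernel G Q f\<rparr>)" and Q: "poly_free Q"
  shows "poly_free G"
proof -
  interpret f: group_hom G Q f by fact
  obtain k :: nat and N where N0: "N 0 = {\<one>\<^bsub>Q\<^esub>}" and Nk: "N k = carrier Q"
    and sub: "\<And>i. i \<le> k \<Longrightarrow> subgroup (N i) Q"
    and norm: "\<And>i. i < k \<Longrightarrow> N i \<lhd> Q\<lparr>carrier := N (Suc i)\<rparr>"
    and free: "\<And>i. i < k \<Longrightarrow> is_free_group (Q\<lparr>carrier := N (Suc i)\<rparr> Mod N i)"
    using Q unfolding poly_free_def by blast
  define pre where "pre L = {g \<in> carrier G. f g \<in> L}" for L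
  define M where "M i = (case i of 0 \<Rightarrow> {\<one>\<^bsub>G\<^esub>} | Suc j \<Rightarrow> pre (N j))" for i
  have preN: "subgroup (pre (N i)) G" if "i \<le> k" for i
    unfolding pre_def by (rule subgroup_preimage[OF f sub[OF that]])
  have M: "subgroup (M i) G" if "i \<le> Suc k" for i
    using that preN f.G.triv_subgroup by (auto simp: M_def split: nat.split)
  have step: "M i \<lhd> G\<lparr>carrier := M (Suc i)\<rparr> \<and> is_free_group (G\<lparr>carrier := M (Suc i)\<rparr> Mod M i)"
    if i: "i < Suc k" for i
  proof (cases i)
    case 0
    let ?K = "G\<lparr>carrier := kernel G Q f\<rparr>"
    have M1: "M (Suc 0) = kernel G Q f" by (auto simp: M_def pre_def N0 kernel_def)
    have gK: "group ?K" by (rule f.G.subgroup_imp_group[OF f.subgroup_kernel])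
    have idh: "group_hom ?K ?K (\<lambda>x. x)"
      using gK by (simp add: group_hom_def group_hom_axioms_def hom_id)
    have "kernel ?K ?K (\<lambda>x. x) = {\<one>\<^bsub>G\<^esub>}" by (auto simp: kernel_def)
    then show ?thesis using free_quotient_by_kernel[OF idh _ ker] 0 M1 by (simp add: M_def)
  next
    case (Suc j)
    then have j: "j < k" using i by simp
    let ?G = "G\<lparr>carrier := pre (N (Suc j))\<rparr>" and ?Q = "Q\<lparr>carrier := N (Suc j)\<rparr>"
    let ?h = "\<lambda>x. N j #>\<^bsub>?Q\<^esub> f x"
    have gG: "group ?G" using preN[of "Suc j"] j by (simp add: f.G.subgroup_imp_group)
    have gQ: "group ?Q" using sub[of "Suc j"] j by (simp add: f.H.subgroup_imp_group)
    have nj: "N j \<lhd> ?Q" by (rule norm[OF j])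
    interpret nj: normal "N j" ?Q by (rule nj)
    have fh: "f \<in> hom ?G ?Q" by (auto simp: hom_def pre_def)
    have hh: "?h \<in> hom ?G (?Q Mod N j)"
      using hom_compose[OF fh nj.r_coset_hom_Mod] by (simp add: comp_def)
    have gh: "group_hom ?G (?Q Mod N j) ?h"
      using gG nj.factorgroup_is_group hh by (simp add: group_hom_def group_hom_axioms_def)
    have img: "f ` pre (N (Suc j)) = N (Suc j)"
      using surj subgroup.subset[OF sub[of "Suc j"]] j by (fastforce simp: pre_def)
    have onto: "?h ` carrier ?G = carrier (?Q Mod N j)"
    proof -
      have "?h ` carrier ?G = (\<lambda>y. N j #>\<^bsub>?Q\<^esub> y) ` (f ` pre (N (Suc j)))" by auto
      then show ?thesis unfolding img by (auto simp: FactGroup_def RCOSETS_def)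
    qed
    have "kernel ?G (?Q Mod N j) ?h = pre (N j)"
    proof -
      have "?h x = N j \<longleftrightarrow> f x \<in> N j" if "x \<in> pre (N (Suc j))" for x
        using that nj.rcos_const[OF gQ] group.rcos_self[OF gQ _ nj.is_subgroup, of "f x"] by (auto simp: pre_def)
      moreover have "N j \<subseteq> N (Suc j)" using nj.subset by simp
      ultimately show ?thesis by (auto simp: kernel_def FactGroup_def pre_def)
    qed
    then show ?thesis using free_quotient_by_kernel[OF gh onto free[OF j]] Suc by (simp add: M_def)
  qed
  have "pre (N k) = carrier G" using f.hom_closed by (auto simp: pre_def Nk)
  then have "M (Suc k) = carrier G" by (simp add: M_def)
  moreover have "M 0 = {\<one>\<^bsub>G\<^esub>}" by (simp add: M_def)
  ultimately show ?thesis using M step f.G.is_group unfolding poly_free_def by blast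
qed

text \<open>An isomorphism is an extension by the trivial group, which is free of rank zero.\<close>

lemma poly_free_iso:
  assumes "group G" "group H" "h \<in> iso G H" "poly_free H"
  shows "poly_free G"
proof -
  have h: "group_hom G H h" using assms by (simp add: group_hom_def group_hom_axioms_def iso_def)
  interpret h: group_hom G H h by (rule h)
  have inj: "inj_on h (carrier G)" and onto: "h ` carrier G = carrier H"
    using assms(3) by (auto simp: iso_def bij_betw_def)
  have ker: "kernel G H h = {\<one>\<^bsub>G\<^esub>}"
    using inj h.inj_iff_trivial_ker by simp
  have "is_free_group (G\<lparr>carrier := kernel G H h\<rparr>)"
    by (rule is_free_group_trivial) (simp_all add: ker h.G.subgroup_imp_group h.G.triv_subgroup)
  then show ?thesis by (rule poly_free_extension[OF h onto _ assms(4)])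
qed

text \<open>Finite index is transferred between groups by moving finite sets of representatives, which is
  easier than moving the cosets.\<close>

lemma (in group) finite_rcosets_iff:
  assumes "subgroup H G"
  shows "finite (rcosets H) \<longleftrightarrow> (\<exists>R. finite R \<and> R \<subseteq> carrier G \<and> carrier G = (\<Union>r\<in>R. H #> r))"
proof
  assume fin: "finite (rcosets H)"
  define R where "R = (\<lambda>C. SOME r. r \<in> carrier G \<and> C = H #> r) ` (rcosets H)"
  have R: "(SOME r. r \<in> carrier G \<and> C = H #> r) \<in> carrier G \<and> C = H #> (SOME r. r \<in> carrier G \<and> C = H #> r)"
    if "C \<in> rcosets H" for C
  proof -
    have "\<exists>r. r \<in> carrier G \<and> C = H #> r" using that by (auto simp: RCOSETS_def)
    then show ?thesis by (rule someI_ex)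
  qed
  have "carrier G = (\<Union>r\<in>R. H #> r)"
  proof
    show "carrier G \<subseteq> (\<Union>r\<in>R. H #> r)"
    proof
      fix x assume x: "x \<in> carrier G"
      then have "H #> x \<in> rcosets H" by (auto simp: RCOSETS_def)
      then show "x \<in> (\<Union>r\<in>R. H #> r)" using R rcos_self[OF x assms] by (force simp: R_def)
    qed
    show "(\<Union>r\<in>R. H #> r) \<subseteq> carrier G"
      using R r_coset_subset_G[OF subgroup.subset[OF assms]] by (force simp: R_def)
  qed
  then show "\<exists>R. finite R \<and> R \<subseteq> carrier G \<and> carrier G = (\<Union>r\<in>R. H #> r)"
    using fin R by (intro exI[of _ R]) (auto simp: R_def)
next
  assume "\<exists>R. finite R \<and> R \<subseteq> carrier G \<and> carrier G = (\<Union>r\<in>R. H #> r)"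
  then obtain R where R: "finite R" "R \<subseteq> carrier G" "carrier G = (\<Union>r\<in>R. H #> r)" by blast
  have "rcosets H \<subseteq> (\<lambda>r. H #> r) ` R"
  proof
    fix C assume "C \<in> rcosets H"
    then obtain x where x: "x \<in> carrier G" "C = H #> x" by (auto simp: RCOSETS_def)
    then obtain r where "r \<in> R" "x \<in> H #> r" using R(3) by blast
    then show "C \<in> (\<lambda>r. H #> r) ` R" using repr_independence[OF _ _ assms] R(2) x by blast
  qed
  then show "finite (rcosets H)" using R(1) finite_surj by blast
qed

text \<open>If \<open>L\<close> is poly-free of finite index in the quotient, then its preimage is an extension of \<open>L\<close> by
  the same free kernel, and lifted coset representatives of \<open>L\<close> represent the cosets of the preimage.\<close>

lemma virtually_poly_free_extension:
  assumes f: "group_hom G Q f" and surj: "f ` carrier G = carrier Q"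
    and ker: "is_free_group (G\<lparr>carrier := kernel G Q f\<rparr>)" and Q: "virtually_poly_free Q"
  shows "virtually_poly_free G"
proof -
  interpret f: group_hom G Q f by fact
  obtain L where L: "subgroup L Q" "finite (rcosets\<^bsub>Q\<^esub> L)" "poly_free (Q\<lparr>carrier := L\<rparr>)"
    using Q unfolding virtually_poly_free_def by blast
  define H where "H = {g \<in> carrier G. f g \<in> L}"
  have H: "subgroup H G" unfolding H_def by (rule subgroup_preimage[OF f L(1)])
  have gh: "group_hom (G\<lparr>carrier := H\<rparr>) (Q\<lparr>carrier := L\<rparr>) f"
    using f.G.subgroup_imp_group[OF H] f.H.subgroup_imp_group[OF L(1)]
    by (auto simp: group_hom_def group_hom_axioms_def hom_def H_def)
  have onto: "f ` carrier (G\<lparr>carrier := H\<rparr>) = carrier (Q\<lparr>carrier := L\<rparr>)"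
    using surj subgroup.subset[OF L(1)] by (fastforce simp: H_def)
  have "kernel (G\<lparr>carrier := H\<rparr>) (Q\<lparr>carrier := L\<rparr>) f = kernel G Q f"
    using subgroup.one_closed[OF L(1)] by (auto simp: kernel_def H_def)
  then have pf: "poly_free (G\<lparr>carrier := H\<rparr>)"
    using poly_free_extension[OF gh onto _ L(3)] ker by simp
  obtain R where R: "finite R" "R \<subseteq> carrier Q" "carrier Q = (\<Union>r\<in>R. L #>\<^bsub>Q\<^esub> r)"
    using L(2) f.H.finite_rcosets_iff[OF L(1)] by blast
  have "\<forall>r\<in>R. \<exists>s\<in>carrier G. f s = r" using R(2) surj by (metis imageE subsetD)
  then obtain s where s: "\<And>r. r \<in> R \<Longrightarrow> s r \<in> carrier G \<and> f (s r) = r" by metis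
  have "carrier G = (\<Union>r\<in>s ` R. H #>\<^bsub>G\<^esub> r)"
  proof
    show "(\<Union>r\<in>s ` R. H #>\<^bsub>G\<^esub> r) \<subseteq> carrier G"
      using s f.G.r_coset_subset_G[OF subgroup.subset[OF H]] by blast
    show "carrier G \<subseteq> (\<Union>r\<in>s ` R. H #>\<^bsub>G\<^esub> r)"
    proof
      fix x assume x: "x \<in> carrier G"
      then have "f x \<in> (\<Union>r\<in>R. L #>\<^bsub>Q\<^esub> r)" using R(3) f.hom_closed by blast
      then obtain r l where r: "r \<in> R" "l \<in> L" "f x = l \<otimes>\<^bsub>Q\<^esub> r" by (auto simp: r_coset_def)
      have l: "l \<in> carrier Q" using r(2) L(1) subgroup.mem_carrier by metis
      let ?h = "x \<otimes>\<^bsub>G\<^esub> inv\<^bsub>G\<^esub> s r"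
      have "f ?h = l" using x s[OF r(1)] l r(1,3) R(2) by (auto simp: f.H.m_assoc subset_iff)
      then have "?h \<in> H" using x s[OF r(1)] r(2) by (simp add: H_def)
      moreover have "x = ?h \<otimes>\<^bsub>G\<^esub> s r" using x s[OF r(1)] by (simp add: f.G.m_assoc)
      ultimately show "x \<in> (\<Union>r\<in>s ` R. H #>\<^bsub>G\<^esub> r)" using r(1) by (auto simp: r_coset_def)
    qed
  qed
  then have "finite (rcosets\<^bsub>G\<^esub> H)"
    using f.G.finite_rcosets_iff[OF H] R(1) s by (metis finite_imageI image_subsetI)
  then show ?thesis using H pf f.G.is_group unfolding virtually_poly_free_def by blast
qed

text \<open>The set \<open>T\<close> contains representatives of the left cosets of the image of \<open>A\<close>; these are what the
  coset actions below produce, whereas finite index is defined by right cosets. Inversion exchanges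
  the two.\<close>

lemma virtually_poly_free_finite_index:
  assumes f: "group_hom A B f" and inj: "inj_on f (carrier A)"
    and T: "finite T" "T \<subseteq> carrier B" "\<And>x. x \<in> carrier B \<Longrightarrow> \<exists>t\<in>T. \<exists>a\<in>carrier A. x = t \<otimes>\<^bsub>B\<^esub> f a"
    and A: "virtually_poly_free A"
  shows "virtually_poly_free B"
proof -
  interpret f: group_hom A B f by fact
  obtain L where L: "subgroup L A" "finite (rcosets\<^bsub>A\<^esub> L)" "poly_free (A\<lparr>carrier := L\<rparr>)"
    using A unfolding virtually_poly_free_def by blast
  have LA: "L \<subseteq> carrier A" by (rule subgroup.subset[OF L(1)])
  have H: "subgroup (f ` L) B" by (rule f.subgroup_img_is_subgroup[OF L(1)])
  have gL: "group (A\<lparr>carrier := L\<rparr>)" by (rule f.G.subgroup_imp_group[OF L(1)])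
  have gH: "group (B\<lparr>carrier := f ` L\<rparr>)" by (rule f.H.subgroup_imp_group[OF H])
  have "f \<in> iso (A\<lparr>carrier := L\<rparr>) (B\<lparr>carrier := f ` L\<rparr>)"
    using inj LA by (auto simp: iso_def hom_def bij_betw_def inj_on_subset subset_iff)
  then have "A\<lparr>carrier := L\<rparr> \<cong> B\<lparr>carrier := f ` L\<rparr>" by (auto simp: is_iso_def)
  then obtain k where "k \<in> iso (B\<lparr>carrier := f ` L\<rparr>) (A\<lparr>carrier := L\<rparr>)"
    using group.iso_sym[OF gL] by (auto simp: is_iso_def)
  then have pf: "poly_free (B\<lparr>carrier := f ` L\<rparr>)" by (rule poly_free_iso[OF gH gL _ L(3)])
  obtain R where R: "finite R" "R \<subseteq> carrier A" "carrier A = (\<Union>r\<in>R. L #>\<^bsub>A\<^esub> r)"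
    using L(2) f.G.finite_rcosets_iff[OF L(1)] by blast
  define S where "S = (\<lambda>(r, t). f r \<otimes>\<^bsub>B\<^esub> inv\<^bsub>B\<^esub> t) ` (R \<times> T)"
  have S: "finite S" "S \<subseteq> carrier B" using R(1,2) T(1,2) by (auto simp: S_def subset_iff)
  have "carrier B = (\<Union>s\<in>S. f ` L #>\<^bsub>B\<^esub> s)"
  proof
    show "(\<Union>s\<in>S. f ` L #>\<^bsub>B\<^esub> s) \<subseteq> carrier B"
      using S(2) f.H.r_coset_subset_G[OF subgroup.subset[OF H]] by blast
    show "carrier B \<subseteq> (\<Union>s\<in>S. f ` L #>\<^bsub>B\<^esub> s)"
    proof
      fix x assume x: "x \<in> carrier B"
      then obtain t a where t: "t \<in> T" "a \<in> carrier A" "inv\<^bsub>B\<^esub> x = t \<otimes>\<^bsub>B\<^esub> f a"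
        using T(3)[of "inv\<^bsub>B\<^esub> x"] by auto
      have "inv\<^bsub>A\<^esub> a \<in> (\<Union>r\<in>R. L #>\<^bsub>A\<^esub> r)" by (subst R(3)[symmetric]) (use t(2) in simp)
      then obtain r l where r: "r \<in> R" "l \<in> L" "inv\<^bsub>A\<^esub> a = l \<otimes>\<^bsub>A\<^esub> r" by (auto simp: r_coset_def)
      have c: "t \<in> carrier B" "l \<in> carrier A" "r \<in> carrier A" using t(1) T(2) r R(2) LA by auto
      have "x = inv\<^bsub>B\<^esub> (t \<otimes>\<^bsub>B\<^esub> f a)" using t(3) x f.H.inv_inv by metis
      also have "\<dots> = f (inv\<^bsub>A\<^esub> a) \<otimes>\<^bsub>B\<^esub> inv\<^bsub>B\<^esub> t" using c t(2) by (simp add: f.H.inv_mult_group)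
      also have "\<dots> = f l \<otimes>\<^bsub>B\<^esub> (f r \<otimes>\<^bsub>B\<^esub> inv\<^bsub>B\<^esub> t)" using c by (simp add: r(3) f.H.m_assoc)
      finally show "x \<in> (\<Union>s\<in>S. f ` L #>\<^bsub>B\<^esub> s)" using r t(1) by (force simp: r_coset_def S_def)
    qed
  qed
  then have "finite (rcosets\<^bsub>B\<^esub> (f ` L))" using f.H.finite_rcosets_iff[OF H] S by blast
  then show ?thesis using H pf f.H.is_group unfolding virtually_poly_free_def by blast
qed

lemma virtually_poly_free_trivial:
  assumes "group G" "carrier G = {\<one>\<^bsub>G\<^esub>}"
  shows "virtually_poly_free G"
proof -
  interpret group G by fact
  have pf: "poly_free G" using assms triv_subgroup
    unfolding poly_free_def by (intro conjI exI[of _ 0] exI[of _ "\<lambda>_. {\<one>\<^bsub>G\<^esub>}"]) auto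
  have "finite (rcosets\<^bsub>G\<^esub> (carrier G))" using assms(2) by (auto simp: RCOSETS_def)
  then show ?thesis using subgroup_self pf assms(1)
    unfolding virtually_poly_free_def by (intro conjI exI[of _ "carrier G"]) auto
qed

section \<open>Split extensions with free kernel\<close>

lemma (in group) inv_cancel:
  assumes "x \<in> carrier G" "y \<in> carrier G"
  shows "inv x \<otimes> (x \<otimes> y) = y" "x \<otimes> (inv x \<otimes> y) = y"
  using assms by (simp_all add: m_assoc[symmetric])

lemma Bij_mult_apply:
  "g \<in> carrier (BijGroup E) \<Longrightarrow> f \<in> carrier (BijGroup E) \<Longrightarrow> x \<in> E \<Longrightarrow> (g \<otimes>\<^bsub>BijGroup E\<^esub> f) x = g (f x)"
  by (simp add: BijGroup_def compose_def)

lemma Bij_one_apply: "x \<in> E \<Longrightarrow> \<one>\<^bsub>BijGroup E\<^esub> x = x"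
  by (simp add: BijGroup_def)

lemma Bij_eqI:
  assumes "f \<in> carrier (BijGroup E)" "g \<in> carrier (BijGroup E)" "\<And>x. x \<in> E \<Longrightarrow> f x = g x"
  shows "f = g"
  using assms by (intro extensionalityI[of f E g]) (auto simp: BijGroup_def Bij_def)

lemma restrict_in_Bij:
  assumes "\<And>x. x \<in> E \<Longrightarrow> f x \<in> E" "\<And>x. x \<in> E \<Longrightarrow> g x \<in> E"
    and "\<And>x. x \<in> E \<Longrightarrow> g (f x) = x" "\<And>x. x \<in> E \<Longrightarrow> f (g x) = x"
  shows "restrict f E \<in> carrier (BijGroup E)"
proof -
  have "bij_betw f E E" by (rule bij_betw_byWitness[where f' = g]) (use assms in auto)
  then have "bij_betw (restrict f E) E E" by (simp add: bij_betw_def inj_on_def)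
  then show ?thesis by (simp add: BijGroup_def Bij_def)
qed

definition left_mult :: "('a, 'x) monoid_scheme \<Rightarrow> 'a \<Rightarrow> 'a \<Rightarrow> 'a"
  where "left_mult G g = (\<lambda>x\<in>carrier G. g \<otimes>\<^bsub>G\<^esub> x)"

lemma (in group) left_mult_Bij: "g \<in> carrier G \<Longrightarrow> left_mult G g \<in> carrier (BijGroup (carrier G))"
  unfolding left_mult_def
  by (rule restrict_in_Bij[where g = "\<lambda>x. inv g \<otimes> x"]) (simp_all add: m_assoc[symmetric])

text \<open>The left regular action is faithful; it is the action by which freeness will be recognised.\<close>

lemma (in group) left_mult_hom: "left_mult G \<in> hom G (BijGroup (carrier G))"
proof (rule homI)
  fix g h assume g: "g \<in> carrier G" and h: "h \<in> carrier G"
  show "left_mult G (g \<otimes> h) = left_mult G g \<otimes>\<^bsub>BijGroup (carrier G)\<^esub> left_mult G h"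
  proof (rule Bij_eqI)
    show "left_mult G g \<otimes>\<^bsub>BijGroup (carrier G)\<^esub> left_mult G h \<in> carrier (BijGroup (carrier G))"
      using group_BijGroup left_mult_Bij g h by (metis group.is_monoid monoid.m_closed)
    fix x assume x: "x \<in> carrier G"
    then show "left_mult G (g \<otimes> h) x = (left_mult G g \<otimes>\<^bsub>BijGroup (carrier G)\<^esub> left_mult G h) x"
      using g h by (simp add: Bij_mult_apply left_mult_Bij) (simp add: left_mult_def m_assoc)
  qed (use g h left_mult_Bij in simp)
  show "left_mult G g \<in> carrier (BijGroup (carrier G))" using g by (rule left_mult_Bij)
qed

lemma (in group_hom) surj_on_generate:
  assumes "A \<subseteq> carrier G" "generate G A = carrier G"
  shows "h ` carrier G = generate H (h ` A)"
  using generate_img[OF assms(1)] assms(2) by simp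

lemma (in group_hom) surj_of_section:
  assumes "group_hom H G s" "\<And>q. q \<in> carrier H \<Longrightarrow> h (s q) = q"
  shows "h ` carrier G = carrier H"
proof
  show "carrier H \<subseteq> h ` carrier G"
  proof
    fix q assume q: "q \<in> carrier H"
    show "q \<in> h ` carrier G" using assms(2)[OF q] group_hom.hom_closed[OF assms(1) q] by (metis imageI)
  qed
qed auto

lemma (in group) conjugate_generate:
  assumes A: "A \<subseteq> carrier G" and g: "g \<in> carrier G"
    and conj: "\<And>a. a \<in> A \<Longrightarrow> g \<otimes> a \<otimes> inv g \<in> generate G A" and x: "x \<in> generate G A"
  shows "g \<otimes> x \<otimes> inv g \<in> generate G A"
proof -
  have "(\<lambda>x. g \<otimes> x \<otimes> inv g) \<in> hom G G"
  proof (rule homI)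
    fix x y assume "x \<in> carrier G" "y \<in> carrier G"
    then show "g \<otimes> (x \<otimes> y) \<otimes> inv g = g \<otimes> x \<otimes> inv g \<otimes> (g \<otimes> y \<otimes> inv g)"
      using g by (simp add: m_assoc inv_cancel)
  qed (use g in simp)
  then have "group_hom G G (\<lambda>x. g \<otimes> x \<otimes> inv g)"
    by (simp add: group_hom_def group_hom_axioms_def is_group)
  from group_hom.hom_generate_subset[OF this generate_is_subgroup[OF A] A conj x] show ?thesis .
qed

text \<open>Let \<open>K\<close> be the subgroup generated by the elements \<open>b i\<close>. The conjugation hypotheses say that the
  section \<open>s\<close> normalises \<open>K\<close>, so the products of an element of \<open>K\<close> with an element of the section
  form a subgroup; by \<open>dec\<close> it contains the generators in \<open>A\<close>, so it is everything, and comparing with \<open>f\<close>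
  shows that \<open>K\<close> is the kernel. For freeness, let \<open>\<Phi>\<close> be the homomorphism from the free group on \<open>I\<close>
  onto \<open>K\<close>. The composite of \<open>\<Phi>\<close> with the action is the left regular action, because the two agree on
  generators. The left regular action is faithful, so \<open>\<Phi>\<close> is injective.\<close>

theorem free_kernel_criterion:
  fixes G :: "('g, 'x) monoid_scheme" and Q :: "('q, 'y) monoid_scheme" and b :: "'i \<Rightarrow> 'g"
  assumes f: "group_hom G Q f" and s: "group_hom Q G s" and fs: "\<And>q. q \<in> carrier Q \<Longrightarrow> f (s q) = q"
    and b: "\<And>i. i \<in> I \<Longrightarrow> b i \<in> carrier G" and fb: "\<And>i. i \<in> I \<Longrightarrow> f (b i) = \<one>\<^bsub>Q\<^esub>"
    and A: "A \<subseteq> carrier G" "generate G A = carrier G"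
    and dec: "\<And>a. a \<in> A \<Longrightarrow> \<exists>k\<in>generate G (b ` I). \<exists>q\<in>carrier Q. a = k \<otimes>\<^bsub>G\<^esub> s q"
    and B: "B \<subseteq> carrier Q" "generate Q B = carrier Q"
    and conj: "\<And>q i. q \<in> B \<Longrightarrow> i \<in> I \<Longrightarrow> s q \<otimes>\<^bsub>G\<^esub> b i \<otimes>\<^bsub>G\<^esub> inv\<^bsub>G\<^esub> s q \<in> generate G (b ` I)"
    and conj': "\<And>q i. q \<in> B \<Longrightarrow> i \<in> I \<Longrightarrow> inv\<^bsub>G\<^esub> s q \<otimes>\<^bsub>G\<^esub> b i \<otimes>\<^bsub>G\<^esub> s q \<in> generate G (b ` I)"
    and act: "\<alpha> \<in> hom G (BijGroup (carrier (free_group I)))"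
    and act_b: "\<And>i. i \<in> I \<Longrightarrow> \<alpha> (b i) = left_mult (free_group I) (free_gen I i)"
  shows "is_free_group (G\<lparr>carrier := kernel G Q f\<rparr>)"
proof -
  interpret f: group_hom G Q f by fact
  interpret s: group_hom Q G s by fact
  let ?F = "free_group I"
  interpret F: group ?F by (rule group_free_group)
  define K where "K = generate G (b ` I)"
  have bI: "b ` I \<subseteq> carrier G" using b by blast
  have sK: "subgroup K G" unfolding K_def by (rule f.G.generate_is_subgroup[OF bI])
  interpret K: subgroup K G by (rule sK)
  have KG: "x \<in> carrier G" if "x \<in> K" for x using that by (rule K.mem_carrier)
  have norm: "(\<forall>x\<in>K. s q \<otimes>\<^bsub>G\<^esub> x \<otimes>\<^bsub>G\<^esub> inv\<^bsub>G\<^esub> s q \<in> K) \<and> (\<forall>x\<in>K. inv\<^bsub>G\<^esub> s q \<otimes>\<^bsub>G\<^esub> x \<otimes>\<^bsub>G\<^esub> s q \<in> K)"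
    if "q \<in> generate Q B" for q
    using that
  proof induction
    case one
    then show ?case using KG by simp
  next
    case (incl q)
    then have q: "q \<in> carrier Q" using B by blast
    have "s q \<otimes>\<^bsub>G\<^esub> x \<otimes>\<^bsub>G\<^esub> inv\<^bsub>G\<^esub> s q \<in> K" if "x \<in> K" for x
      using f.G.conjugate_generate[OF bI, of "s q" x] conj[OF incl] q that by (auto simp: K_def)
    moreover have "inv\<^bsub>G\<^esub> s q \<otimes>\<^bsub>G\<^esub> x \<otimes>\<^bsub>G\<^esub> s q \<in> K" if "x \<in> K" for x
      using f.G.conjugate_generate[OF bI, of "inv\<^bsub>G\<^esub> s q" x] conj'[OF incl] q that by (auto simp: K_def)
    ultimately show ?case by blast
  next
    case (inv q)
    then have q: "q \<in> carrier Q" using B by blast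
    have "s q \<otimes>\<^bsub>G\<^esub> x \<otimes>\<^bsub>G\<^esub> inv\<^bsub>G\<^esub> s q \<in> K" if "x \<in> K" for x
      using f.G.conjugate_generate[OF bI, of "s q" x] conj[OF inv] q that by (auto simp: K_def)
    moreover have "inv\<^bsub>G\<^esub> s q \<otimes>\<^bsub>G\<^esub> x \<otimes>\<^bsub>G\<^esub> s q \<in> K" if "x \<in> K" for x
      using f.G.conjugate_generate[OF bI, of "inv\<^bsub>G\<^esub> s q" x] conj'[OF inv] q that by (auto simp: K_def)
    ultimately show ?case using q by simp
  next
    case (eng q r)
    then have q: "q \<in> carrier Q" "r \<in> carrier Q" using B by blast+
    have "s (q \<otimes>\<^bsub>Q\<^esub> r) \<otimes>\<^bsub>G\<^esub> x \<otimes>\<^bsub>G\<^esub> inv\<^bsub>G\<^esub> s (q \<otimes>\<^bsub>Q\<^esub> r) =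
        s q \<otimes>\<^bsub>G\<^esub> (s r \<otimes>\<^bsub>G\<^esub> x \<otimes>\<^bsub>G\<^esub> inv\<^bsub>G\<^esub> s r) \<otimes>\<^bsub>G\<^esub> inv\<^bsub>G\<^esub> s q"
      "inv\<^bsub>G\<^esub> s (q \<otimes>\<^bsub>Q\<^esub> r) \<otimes>\<^bsub>G\<^esub> x \<otimes>\<^bsub>G\<^esub> s (q \<otimes>\<^bsub>Q\<^esub> r) =
        inv\<^bsub>G\<^esub> s r \<otimes>\<^bsub>G\<^esub> (inv\<^bsub>G\<^esub> s q \<otimes>\<^bsub>G\<^esub> x \<otimes>\<^bsub>G\<^esub> s q) \<otimes>\<^bsub>G\<^esub> s r" if "x \<in> K" for x
      using q KG[OF that] by (simp_all add: f.G.m_assoc f.G.inv_mult_group)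
    then show ?case using eng.IH by simp
  qed
  have decK: "\<exists>k\<in>K. \<exists>q\<in>carrier Q. x = k \<otimes>\<^bsub>G\<^esub> s q" if "x \<in> generate G A" for x
    using that
  proof induction
    case one
    show ?case by (intro bexI[of _ "\<one>\<^bsub>G\<^esub>"] bexI[of _ "\<one>\<^bsub>Q\<^esub>"]) auto
  next
    case (incl a)
    then show ?case using dec by (simp add: K_def)
  next
    case (inv a)
    obtain k q where k: "k \<in> K" "q \<in> carrier Q" "a = k \<otimes>\<^bsub>G\<^esub> s q"
      using dec[OF inv] unfolding K_def by blast
    have "inv\<^bsub>G\<^esub> a = (inv\<^bsub>G\<^esub> s q \<otimes>\<^bsub>G\<^esub> inv\<^bsub>G\<^esub> k \<otimes>\<^bsub>G\<^esub> s q) \<otimes>\<^bsub>G\<^esub> s (inv\<^bsub>Q\<^esub> q)"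
      using k KG by (simp add: f.G.inv_mult_group f.G.m_assoc)
    moreover have "inv\<^bsub>G\<^esub> s q \<otimes>\<^bsub>G\<^esub> inv\<^bsub>G\<^esub> k \<otimes>\<^bsub>G\<^esub> s q \<in> K" using norm k B(2) by simp
    ultimately show ?case using k(2) f.H.inv_closed by blast
  next
    case (eng x y)
    then obtain k q l r where k: "k \<in> K" "q \<in> carrier Q" "x = k \<otimes>\<^bsub>G\<^esub> s q"
      and l: "l \<in> K" "r \<in> carrier Q" "y = l \<otimes>\<^bsub>G\<^esub> s r" by blast
    have "x \<otimes>\<^bsub>G\<^esub> y = (k \<otimes>\<^bsub>G\<^esub> (s q \<otimes>\<^bsub>G\<^esub> l \<otimes>\<^bsub>G\<^esub> inv\<^bsub>G\<^esub> s q)) \<otimes>\<^bsub>G\<^esub> s (q \<otimes>\<^bsub>Q\<^esub> r)"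
      using k l KG by (simp add: f.G.m_assoc f.G.inv_cancel)
    moreover have "k \<otimes>\<^bsub>G\<^esub> (s q \<otimes>\<^bsub>G\<^esub> l \<otimes>\<^bsub>G\<^esub> inv\<^bsub>G\<^esub> s q) \<in> K" using norm k l B(2) by simp
    ultimately show ?case using k(2) l(2) f.H.m_closed by blast
  qed
  have fK: "f k = \<one>\<^bsub>Q\<^esub>" if "k \<in> K" for k
    using f.hom_generate_subset[OF f.H.triv_subgroup bI, of k] fb that by (auto simp: K_def)
  have ker: "kernel G Q f = K"
  proof
    show "K \<subseteq> kernel G Q f" using fK KG by (auto simp: kernel_def)
    show "kernel G Q f \<subseteq> K"
    proof
      fix x assume x: "x \<in> kernel G Q f"
      then have "x \<in> generate G A" using A(2) by (simp add: kernel_def)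
      from decK[OF this] obtain k q where k: "k \<in> K" "q \<in> carrier Q" "x = k \<otimes>\<^bsub>G\<^esub> s q"
        by blast
      then have "f x = q" using fK KG fs by simp
      then show "x \<in> K" using x k KG by (simp add: kernel_def)
    qed
  qed
  obtain \<Phi> where \<Phi>: "\<Phi> \<in> hom ?F G" "\<And>i. i \<in> I \<Longrightarrow> \<Phi> (free_gen I i) = b i"
    by (rule free_group_hom[OF f.G.is_group, of b I]) (auto simp: b)
  interpret \<Phi>: group_hom ?F G \<Phi> using \<Phi>(1) by (simp add: group_hom_def group_hom_axioms_def f.G.is_group F.is_group)
  have "free_gen I ` I \<subseteq> carrier ?F" by (rule image_subsetI) (rule free_gen_closed)
  from \<Phi>.surj_on_generate[OF this generate_free_gen]
  have "\<Phi> ` carrier ?F = generate G (\<Phi> ` free_gen I ` I)" .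
  also have "\<Phi> ` free_gen I ` I = b ` I" unfolding image_image by (rule image_cong) (simp_all add: \<Phi>(2))
  finally have onto: "\<Phi> ` carrier ?F = K" by (simp add: K_def)
  have lm: "\<alpha> (\<Phi> u) = left_mult ?F u" if "u \<in> carrier ?F" for u
    using free_group_hom_eq[OF group_BijGroup hom_compose[OF \<Phi>(1) act] F.left_mult_hom _ that] \<Phi>(2) act_b
    by simp
  have "inj_on \<Phi> (carrier ?F)"
  proof (rule inj_onI)
    fix u v assume uv: "u \<in> carrier ?F" "v \<in> carrier ?F" "\<Phi> u = \<Phi> v"
    then have "left_mult ?F u \<one>\<^bsub>?F\<^esub> = left_mult ?F v \<one>\<^bsub>?F\<^esub>" using lm by metis
    then show "u = v" using uv by (simp add: left_mult_def)
  qed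
  then have "\<Phi> \<in> iso ?F (G\<lparr>carrier := K\<rparr>)"
    using onto by (auto simp: iso_def hom_def bij_betw_def)
  then show ?thesis unfolding ker by (rule is_free_groupI[OF f.G.subgroup_imp_group[OF sK]])
qed

text \<open>The endomorphism with prescribed values on the basis. Since it is needed for families of
  endomorphisms, it is chosen once and for all.\<close>

definition free_end :: "'a set \<Rightarrow> ('a \<Rightarrow> 'a gword set) \<Rightarrow> 'a gword set \<Rightarrow> 'a gword set"
  where "free_end I c = (SOME h. h \<in> hom (free_group I) (free_group I) \<and> (\<forall>i\<in>I. h (free_gen I i) = c i))"

lemma free_end:
  assumes "\<And>i. i \<in> I \<Longrightarrow> c i \<in> carrier (free_group I)"
  shows "free_end I c \<in> hom (free_group I) (free_group I)"
    and "\<And>i. i \<in> I \<Longrightarrow> free_end I c (free_gen I i) = c i"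
proof -
  obtain h where "h \<in> hom (free_group I) (free_group I)" "\<And>i. i \<in> I \<Longrightarrow> h (free_gen I i) = c i"
    by (rule free_group_hom[OF group_free_group, of c I I]) (auto simp: assms)
  then have "\<exists>h. h \<in> hom (free_group I) (free_group I) \<and> (\<forall>i\<in>I. h (free_gen I i) = c i)" by blast
  from someI_ex[OF this] show "free_end I c \<in> hom (free_group I) (free_group I)"
    "\<And>i. i \<in> I \<Longrightarrow> free_end I c (free_gen I i) = c i" by (simp_all add: free_end_def)
qed

section \<open>Artin groups\<close>

fun alt_prod :: "('g, 'x) monoid_scheme \<Rightarrow> nat \<Rightarrow> 'g \<Rightarrow> 'g \<Rightarrow> 'g"
  where
    "alt_prod G 0 x y = \<one>\<^bsub>G\<^esub>"
  | "alt_prod G (Suc k) x y = x \<otimes>\<^bsub>G\<^esub> alt_prod G k y x"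

lemma word_val_alternating: "word_val G f (alternating k s t) = alt_prod G k (f s) (f t)"
  by (induction k arbitrary: s t) simp_all

lemma alternating_gwords: "s \<in> S \<Longrightarrow> t \<in> S \<Longrightarrow> alternating k s t \<in> gwords S"
  by (induction k arbitrary: s t) (simp_all add: gwords_Nil gwords_Cons)

definition artin_gen :: "'a set \<Rightarrow> ('a \<Rightarrow> 'a \<Rightarrow> enat) \<Rightarrow> 'a \<Rightarrow> 'a gword set"
  where "artin_gen K m = gen_class K
    {(alternating k s t, alternating k t s) | k s t. s \<in> K \<and> t \<in> K \<and> s \<noteq> t \<and> m s t = enat k}"

lemma group_artin_group: "group (artin_group K m)"
  by (simp add: artin_group_def group_presented_group)

lemma artin_gen_closed: "s \<in> K \<Longrightarrow> artin_gen K m s \<in> carrier (artin_group K m)"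
  by (simp add: artin_gen_def artin_group_def gen_class_closed)

lemma generate_artin_gen: "generate (artin_group K m) (artin_gen K m ` K) = carrier (artin_group K m)"
  by (simp add: artin_gen_def artin_group_def generate_gen_class)

lemma artin_gen_relation:
  assumes "s \<in> K" "t \<in> K" "s \<noteq> t" "m s t = enat k"
  shows "alt_prod (artin_group K m) k (artin_gen K m s) (artin_gen K m t) =
         alt_prod (artin_group K m) k (artin_gen K m t) (artin_gen K m s)"
proof -
  let ?R = "{(alternating k s t, alternating k t s) | k s t. s \<in> K \<and> t \<in> K \<and> s \<noteq> t \<and> m s t = enat k}"
  have "(alternating k s t, alternating k t s) \<in> ?R" using assms by blast
  from presented_group_relation[OF this alternating_gwords alternating_gwords] assms(1,2)
  show ?thesis by (simp only: word_val_alternating artin_group_def artin_gen_def)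
qed

lemma artin_group_hom:
  assumes "group H" "\<And>s. s \<in> K \<Longrightarrow> f s \<in> carrier H"
    and rel: "\<And>s t k. s \<in> K \<Longrightarrow> t \<in> K \<Longrightarrow> s \<noteq> t \<Longrightarrow> m s t = enat k \<Longrightarrow>
      alt_prod H k (f s) (f t) = alt_prod H k (f t) (f s)"
  shows "\<exists>h. group_hom (artin_group K m) H h \<and> (\<forall>s\<in>K. h (artin_gen K m s) = f s)"
proof -
  let ?R = "{(alternating k s t, alternating k t s) | k s t. s \<in> K \<and> t \<in> K \<and> s \<noteq> t \<and> m s t = enat k}"
  have f: "f \<in> K \<rightarrow> carrier H" by (rule Pi_I) (rule assms(2))
  have r: "word_val H f u = word_val H f v" if "(u, v) \<in> ?R" for u v
    using that rel by (auto simp: word_val_alternating)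
  obtain h where h: "h \<in> hom (presented_group K ?R) H" "\<forall>s\<in>K. h (gen_class K ?R s) = f s"
    using presented_group_hom[OF assms(1) f r] by blast
  show ?thesis
  proof (intro exI[of _ h] conjI ballI)
    show "group_hom (artin_group K m) H h"
      using h(1) assms(1) group_presented_group by (simp add: group_hom_def group_hom_axioms_def artin_group_def)
    show "h (artin_gen K m s) = f s" if "s \<in> K" for s using h(2) that by (simp add: artin_gen_def)
  qed
qed

section \<open>Braid relations\<close>

context group begin

lemma comm_inv:
  assumes "x \<in> carrier G" "y \<in> carrier G" "x \<otimes> y = y \<otimes> x"
  shows "x \<otimes> inv y = inv y \<otimes> x"
  using assms by (metis inv_closed inv_solve_left' inv_solve_right' m_assoc m_closed)

text \<open>If \<open>g\<close> carries \<open>v\<close> to \<open>u\<close> by conjugation, then a relation between \<open>v\<close>, \<open>y\<close> and \<open>z\<close> turns into the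
  corresponding relation between \<open>u\<close> and the conjugates of \<open>y\<close> and \<open>z\<close>.\<close>

lemma conj_intertwine:
  assumes c: "u \<in> carrier G" "v \<in> carrier G" "g \<in> carrier G" "y \<in> carrier G" "z \<in> carrier G"
    and ug: "u \<otimes> g = g \<otimes> v" and vy: "v \<otimes> y = z \<otimes> v"
  shows "u \<otimes> (g \<otimes> y \<otimes> inv g) = g \<otimes> z \<otimes> inv g \<otimes> u"
proof -
  have "inv g \<otimes> u = v \<otimes> inv g" using ug c by (metis inv_closed inv_solve_left' inv_solve_right' m_assoc m_closed)
  then have "g \<otimes> z \<otimes> inv g \<otimes> u = g \<otimes> (z \<otimes> v) \<otimes> inv g" using c by (simp add: m_assoc)
  also have "\<dots> = (u \<otimes> g) \<otimes> y \<otimes> inv g" unfolding vy[symmetric] ug using c by (simp add: m_assoc)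
  finally show ?thesis using c by (simp add: m_assoc)
qed

lemma conj_eqI:
  assumes "u \<in> carrier G" "y \<in> carrier G" "z \<in> carrier G" "u \<otimes> y = z \<otimes> u"
  shows "u \<otimes> y \<otimes> inv u = z" "inv u \<otimes> z \<otimes> u = y"
proof -
  show "u \<otimes> y \<otimes> inv u = z" unfolding assms(4) using assms(1-3) by (simp add: m_assoc)
  have "inv u \<otimes> z \<otimes> u = inv u \<otimes> (u \<otimes> y)" unfolding assms(4) using assms(1-3) by (simp add: m_assoc)
  then show "inv u \<otimes> z \<otimes> u = y" using assms(1-3) by (simp add: inv_cancel)
qed

lemma conj_memI:
  assumes K: "subgroup K G" and u: "u \<in> carrier G" and y: "y \<in> carrier G" and c: "c \<in> K"
  shows "u \<otimes> y = c \<otimes> u \<Longrightarrow> u \<otimes> y \<otimes> inv u \<in> K" "u \<otimes> c = y \<otimes> u \<Longrightarrow> inv u \<otimes> y \<otimes> u \<in> K"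
  using conj_eqI(1)[OF u y subgroup.mem_carrier[OF K c]] conj_eqI(2)[OF u subgroup.mem_carrier[OF K c] y] c
  by simp_all

text \<open>Products are kept in right-associated form; this lemma applies an equation between two-letter words
  at the front of a longer word.\<close>

lemma slide:
  assumes "a \<otimes> b = c \<otimes> d"
    and "a \<in> carrier G" "b \<in> carrier G" "c \<in> carrier G" "d \<in> carrier G" "z \<in> carrier G"
  shows "a \<otimes> (b \<otimes> z) = c \<otimes> (d \<otimes> z)"
  using assms by (metis m_assoc)

end

text \<open>
  The product \<open>s j s (j + 1) \<dots>\<close> with \<open>k\<close> factors: the braid that moves one strand across \<open>k\<close> others.
\<close>

fun run :: "('g, 'x) monoid_scheme \<Rightarrow> (nat \<Rightarrow> 'g) \<Rightarrow> nat \<Rightarrow> nat \<Rightarrow> 'g"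
  where
    "run G s j 0 = \<one>\<^bsub>G\<^esub>"
  | "run G s j (Suc k) = s j \<otimes>\<^bsub>G\<^esub> run G s (Suc j) k"

lemma (in group) run_closed:
  "(\<And>l. j \<le> l \<Longrightarrow> l < j + k \<Longrightarrow> s l \<in> carrier G) \<Longrightarrow> run G s j k \<in> carrier G"
  by (induction k arbitrary: j) auto

lemma (in group) run_snoc:
  "(\<And>l. j \<le> l \<Longrightarrow> l \<le> j + k \<Longrightarrow> s l \<in> carrier G) \<Longrightarrow> run G s j (Suc k) = run G s j k \<otimes> s (j + k)"
proof (induction k arbitrary: j)
  case (Suc k)
  have "run G s (Suc j) k \<in> carrier G" using Suc.prems by (intro run_closed) auto
  moreover have "run G s (Suc j) (Suc k) = run G s (Suc j) k \<otimes> s (Suc j + k)"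
    using Suc.prems by (intro Suc.IH) auto
  ultimately show ?case using Suc.prems by (simp add: m_assoc)
qed simp

lemma (in group) run_commute:
  assumes "u \<in> carrier G" "\<And>l. j \<le> l \<Longrightarrow> l < j + k \<Longrightarrow> s l \<in> carrier G \<and> u \<otimes> s l = s l \<otimes> u"
  shows "u \<otimes> run G s j k = run G s j k \<otimes> u"
  using assms(2)
proof (induction k arbitrary: j)
  case 0
  then show ?case using assms(1) by simp
next
  case (Suc k)
  have c: "run G s (Suc j) k \<in> carrier G" using Suc.prems by (intro run_closed) auto
  have IH: "u \<otimes> run G s (Suc j) k = run G s (Suc j) k \<otimes> u" using Suc.prems by (intro Suc.IH) auto
  have s: "s j \<in> carrier G" "u \<otimes> s j = s j \<otimes> u" using Suc.prems[of j] by auto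
  have "u \<otimes> run G s j (Suc k) = s j \<otimes> (u \<otimes> run G s (Suc j) k)"
    using slide[OF s(2)] assms(1) s c by simp
  also have "\<dots> = s j \<otimes> (run G s (Suc j) k \<otimes> u)" by (rule arg_cong[OF IH])
  also have "\<dots> = run G s j (Suc k) \<otimes> u" using assms(1) s c by (simp add: m_assoc)
  finally show ?case .
qed

locale braid_family = group G for G (structure) +
  fixes m :: nat and s :: "nat \<Rightarrow> 'a"
  assumes s_closed: "i < m \<Longrightarrow> s i \<in> carrier G"
    and braid: "Suc i < m \<Longrightarrow> s i \<otimes> (s (Suc i) \<otimes> s i) = s (Suc i) \<otimes> (s i \<otimes> s (Suc i))"
    and far_commute: "Suc i < j \<Longrightarrow> j < m \<Longrightarrow> s i \<otimes> s j = s j \<otimes> s i"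
begin

lemma commute: "i < m \<Longrightarrow> j < m \<Longrightarrow> Suc i \<noteq> j \<Longrightarrow> Suc j \<noteq> i \<Longrightarrow> s i \<otimes> s j = s j \<otimes> s i"
  using far_commute[of i j] far_commute[of j i] by (cases i j rule: linorder_cases) auto

lemma run_closed': "j + k \<le> m \<Longrightarrow> run G s j k \<in> carrier G"
  using s_closed by (intro run_closed) auto

text \<open>Sliding a crossing along a strand that passes over it moves the crossing by one place.\<close>

lemma run_shift:
  assumes "j < i" "i < j + k" "j + k \<le> m"
  shows "s i \<otimes> run G s j k = run G s j k \<otimes> s (i - 1)"
  using assms
proof (induction k arbitrary: j)
  case (Suc k)
  have c: "s i \<in> carrier G" "s j \<in> carrier G" "s (i - 1) \<in> carrier G"
    using Suc.prems s_closed by auto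
  have r: "run G s (Suc j) k \<in> carrier G" using Suc.prems by (intro run_closed') auto
  show ?case
  proof (cases "i = Suc j")
    case True
    obtain k' where k: "k = Suc k'" using Suc.prems True by (cases k) auto
    let ?r = "run G s (Suc (Suc j)) k'"
    have r': "?r \<in> carrier G" using Suc.prems k by (intro run_closed') auto
    have com: "s j \<otimes> ?r = ?r \<otimes> s j"
      using Suc.prems k s_closed far_commute by (intro run_commute) auto
    have "s i \<otimes> run G s j (Suc k) = (s (Suc j) \<otimes> (s j \<otimes> s (Suc j))) \<otimes> ?r"
      using c r' True k by (simp add: m_assoc)
    also have "\<dots> = (s j \<otimes> (s (Suc j) \<otimes> s j)) \<otimes> ?r" using braid[of j] Suc.prems True by simp
    also have "\<dots> = s j \<otimes> (s (Suc j) \<otimes> (s j \<otimes> ?r))" using c r' True by (simp add: m_assoc)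
    also have "\<dots> = s j \<otimes> (s (Suc j) \<otimes> (?r \<otimes> s j))" by (simp only: com)
    also have "\<dots> = run G s j (Suc k) \<otimes> s (i - 1)" using c r' True k by (simp add: m_assoc)
    finally show ?thesis .
  next
    case False
    then have IH: "s i \<otimes> run G s (Suc j) k = run G s (Suc j) k \<otimes> s (i - 1)" using Suc by simp
    have com: "s i \<otimes> s j = s j \<otimes> s i" using far_commute[of j i] Suc.prems False by simp
    have "s i \<otimes> run G s j (Suc k) = s j \<otimes> (s i \<otimes> run G s (Suc j) k)"
      using slide[OF com] c r by simp
    also have "\<dots> = s j \<otimes> (run G s (Suc j) k \<otimes> s (i - 1))" by (rule arg_cong[OF IH])
    also have "\<dots> = run G s j (Suc k) \<otimes> s (i - 1)" using c r by (simp add: m_assoc)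
    finally show ?thesis .
  qed
qed simp

end

text \<open>The loop of the strand \<open>j\<close> around the puncture, that is
  \<open>s j \<dots> s (j + d - 1) s (j + d) (s j \<dots> s (j + d - 1))\<^sup>-\<^sup>1\<close>.\<close>

fun loop_at :: "('g, 'x) monoid_scheme \<Rightarrow> (nat \<Rightarrow> 'g) \<Rightarrow> nat \<Rightarrow> nat \<Rightarrow> 'g"
  where
    "loop_at G s j 0 = s j"
  | "loop_at G s j (Suc d) = s j \<otimes>\<^bsub>G\<^esub> loop_at G s (Suc j) d \<otimes>\<^bsub>G\<^esub> inv\<^bsub>G\<^esub> s j"

locale typeB_family = braid_family +
  assumes last_closed: "s m \<in> carrier G"
    and last_commute: "Suc i < m \<Longrightarrow> s i \<otimes> s m = s m \<otimes> s i"
    and last_four: "m = Suc k \<Longrightarrow> s k \<otimes> (s m \<otimes> (s k \<otimes> s m)) = s m \<otimes> (s k \<otimes> (s m \<otimes> s k))"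
begin

definition loop where "loop j = loop_at G s j (m - j)"

lemma loop_last: "loop m = s m"
  by (simp add: loop_def)

lemma loop_rec: "j < m \<Longrightarrow> loop j = s j \<otimes> loop (Suc j) \<otimes> inv s j"
  by (simp add: loop_def Suc_diff_Suc[symmetric])

lemma loop_closed: "j \<le> m \<Longrightarrow> loop j \<in> carrier G"
  by (induction rule: inc_induct) (auto simp: loop_last loop_rec last_closed s_closed)

lemma loop_up: "j < m \<Longrightarrow> s j \<otimes> loop (Suc j) = loop j \<otimes> s j"
  using s_closed[of j] loop_closed[of "Suc j"] by (simp add: loop_rec m_assoc)

lemma loop_commute_below: "j \<le> m \<Longrightarrow> Suc i < j \<Longrightarrow> s i \<otimes> loop j = loop j \<otimes> s i"
proof (induction rule: inc_induct)
  case base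
  then show ?case by (simp add: loop_last last_commute)
next
  case (step n)
  then have "s i \<otimes> loop (Suc n) = loop (Suc n) \<otimes> s i" by simp
  moreover have "s i \<otimes> s n = s n \<otimes> s i" using step by (intro far_commute) auto
  ultimately show ?case unfolding loop_rec[OF step(2)]
    using step s_closed loop_closed conj_intertwine[of "s i" "s i" "s n" "loop (Suc n)" "loop (Suc n)"] by simp
qed

text \<open>The crossing \<open>i\<close> lies between the strand \<open>j\<close> and the puncture. When it is next to the strand, it
  passes through the first two letters of the word for the loop by the braid relation, becoming the crossing
  \<open>j\<close>, which commutes with the rest.\<close>

lemma loop_commute_above: "j \<le> m \<Longrightarrow> j < i \<Longrightarrow> i < m \<Longrightarrow> s i \<otimes> loop j = loop j \<otimes> s i"
proof (induction rule: inc_induct)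
  case (step n)
  show ?case
  proof (cases "i = Suc n")
    case True
    let ?g = "s n \<otimes> s (Suc n)"
    have c: "s n \<in> carrier G" "s (Suc n) \<in> carrier G" "loop (Suc (Suc n)) \<in> carrier G"
      using step True s_closed loop_closed by auto
    have "loop n = ?g \<otimes> loop (Suc (Suc n)) \<otimes> inv ?g"
      using c step True loop_rec[of n] loop_rec[of "Suc n"] by (simp add: inv_mult_group m_assoc)
    moreover have "s (Suc n) \<otimes> ?g = ?g \<otimes> s n" using braid[of n] c step True by (simp add: m_assoc)
    moreover have "s n \<otimes> loop (Suc (Suc n)) = loop (Suc (Suc n)) \<otimes> s n"
      using step True by (intro loop_commute_below) auto
    ultimately show ?thesis using conj_intertwine[of "s (Suc n)" "s n" ?g "loop (Suc (Suc n))" "loop (Suc (Suc n))"] c True by simp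
  next
    case False
    then have "s i \<otimes> loop (Suc n) = loop (Suc n) \<otimes> s i" using step by simp
    moreover have "s i \<otimes> s n = s n \<otimes> s i" using far_commute[of n i] step False by simp
    ultimately show ?thesis unfolding loop_rec[OF step(2)]
      using step s_closed loop_closed conj_intertwine[of "s i" "s i" "s n" "loop (Suc n)" "loop (Suc n)"] by simp
  qed
qed simp

lemma loop_commute: "i < m \<Longrightarrow> j \<le> m \<Longrightarrow> i \<noteq> j \<Longrightarrow> Suc i \<noteq> j \<Longrightarrow> s i \<otimes> loop j = loop j \<otimes> s i"
  using loop_commute_below[of j i] loop_commute_above[of j i] by (cases i j rule: linorder_cases) auto

text \<open>Conjugation by \<open>s (j + 1) s j\<close> takes \<open>s (j + 1)\<close> to \<open>s j\<close> and the loops of the strands \<open>j + 1\<close> and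
  \<open>j + 2\<close> to those of \<open>j\<close> and \<open>j + 1\<close>. So the statement propagates from the strand next to the
  puncture, where it is the relation of length four, to all others. Together with \<open>loop_up\<close>
  and \<open>loop_commute\<close> it says that the crossings act on the loops by the braid automorphisms of Artin.\<close>

lemma loop_down: "j < m \<Longrightarrow> loop j \<otimes> (s j \<otimes> loop j) = loop (Suc j) \<otimes> (loop j \<otimes> s j)"
proof -
  have "Suc j \<le> m \<Longrightarrow> loop j \<otimes> (s j \<otimes> loop j) = loop (Suc j) \<otimes> (loop j \<otimes> s j)" for j
  proof (induction "m - Suc j" arbitrary: j)
    case 0
    then have m: "m = Suc j" by simp
    have c: "s j \<in> carrier G" "s m \<in> carrier G" using s_closed[of j] last_closed m by auto
    have xj: "loop j = s j \<otimes> s m \<otimes> inv s j" using loop_rec[of j] m loop_last by simp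
    have xs: "loop j \<otimes> s j = s j \<otimes> s m" using loop_up[of j] m loop_last by simp
    have "loop j \<otimes> (s j \<otimes> loop j) = (s j \<otimes> (s m \<otimes> (s j \<otimes> s m))) \<otimes> inv s j"
      using c xj xs by (simp add: m_assoc inv_cancel)
    also have "\<dots> = (s m \<otimes> (s j \<otimes> (s m \<otimes> s j))) \<otimes> inv s j" using last_four[OF m] by simp
    also have "\<dots> = loop (Suc j) \<otimes> (loop j \<otimes> s j)" unfolding xs using c m loop_last by (simp add: m_assoc)
    finally show ?case .
  next
    case (Suc d)
    let ?a = "s j" and ?b = "s (Suc j)" and ?p = "loop j" and ?q = "loop (Suc j)" and ?r = "loop (Suc (Suc j))"
    have j: "Suc (Suc j) \<le> m" using Suc by simp
    have c: "?a \<in> carrier G" "?b \<in> carrier G" "?p \<in> carrier G" "?q \<in> carrier G" "?r \<in> carrier G"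
      using j s_closed loop_closed by auto
    let ?h = "?b \<otimes> ?a"
    have hc: "?h \<in> carrier G" using c by simp
    have hb: "?h \<otimes> ?b = ?a \<otimes> ?h" using braid[of j] j c by (simp add: m_assoc)
    have hq: "?h \<otimes> ?q = ?p \<otimes> ?h"
    proof -
      have "?h \<otimes> ?q = ?b \<otimes> (?p \<otimes> ?a)" using loop_up[of j] j c by (simp add: m_assoc)
      also have "\<dots> = (?b \<otimes> ?p) \<otimes> ?a" using c by (simp add: m_assoc)
      also have "\<dots> = (?p \<otimes> ?b) \<otimes> ?a" using loop_commute[of "Suc j" j] j by simp
      finally show ?thesis using c by (simp add: m_assoc)
    qed
    have hr: "?h \<otimes> ?r = ?q \<otimes> ?h"
    proof -
      have "?h \<otimes> ?r = ?b \<otimes> (?r \<otimes> ?a)" using loop_commute[of j "Suc (Suc j)"] j c by (simp add: m_assoc)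
      also have "\<dots> = (?b \<otimes> ?r) \<otimes> ?a" using c by (simp add: m_assoc)
      also have "\<dots> = (?q \<otimes> ?b) \<otimes> ?a" using loop_up[of "Suc j"] j by simp
      finally show ?thesis using c by (simp add: m_assoc)
    qed
    have push: "?h \<otimes> (u \<otimes> (v \<otimes> w)) = (u' \<otimes> (v' \<otimes> w')) \<otimes> ?h"
      if "?h \<otimes> u = u' \<otimes> ?h" "?h \<otimes> v = v' \<otimes> ?h" "?h \<otimes> w = w' \<otimes> ?h"
        "u \<in> carrier G" "v \<in> carrier G" "w \<in> carrier G" "u' \<in> carrier G" "v' \<in> carrier G" "w' \<in> carrier G"
      for u v w u' v' w'
    proof -
      have "?h \<otimes> (u \<otimes> (v \<otimes> w)) = u' \<otimes> (?h \<otimes> (v \<otimes> w))" using slide[OF that(1)] that hc by blast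
      also have "\<dots> = u' \<otimes> (v' \<otimes> (?h \<otimes> w))"
        using slide[OF that(2), of w] that hc by simp
      also have "\<dots> = u' \<otimes> (v' \<otimes> (w' \<otimes> ?h))" by (simp only: that(3))
      also have "\<dots> = (u' \<otimes> (v' \<otimes> w')) \<otimes> ?h" using that hc by (simp only: m_assoc m_closed)
      finally show ?thesis .
    qed
    have "(?p \<otimes> (?a \<otimes> ?p)) \<otimes> ?h = ?h \<otimes> (?q \<otimes> (?b \<otimes> ?q))" using push[OF hq hb hq] c by simp
    also have "\<dots> = ?h \<otimes> (?r \<otimes> (?q \<otimes> ?b))" using Suc.hyps(1)[of "Suc j"] Suc.hyps(2) j by simp
    also have "\<dots> = (?q \<otimes> (?p \<otimes> ?a)) \<otimes> ?h" using push[OF hr hq hb] c by simp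
    finally show ?case using c hc by (meson m_closed right_cancel)
  qed
  then show "j < m \<Longrightarrow> ?thesis" by simp
qed

text \<open>Exchanging two strands does not disturb a loop that encloses both of them.\<close>

lemma loop_pair: "j < m \<Longrightarrow> s j \<otimes> (loop (Suc j) \<otimes> loop j) = loop (Suc j) \<otimes> (loop j \<otimes> s j)"
  using loop_down[of j] loop_up[of j] s_closed[of j] loop_closed[of j] loop_closed[of "Suc j"]
  by (metis Suc_leI less_imp_le_nat m_assoc)

lemma loop_conj_in_generate:
  assumes i: "i < m" and j: "j \<le> m"
  shows "s i \<otimes> loop j \<otimes> inv (s i) \<in> generate G (loop ` {..m})"
    and "inv (s i) \<otimes> loop j \<otimes> s i \<in> generate G (loop ` {..m})"
proof -
  let ?K = "generate G (loop ` {..m})"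
  have sub: "subgroup ?K G" using loop_closed by (intro generate_is_subgroup) auto
  interpret K: subgroup ?K G by (rule sub)
  have xK: "loop i \<in> ?K" "loop (Suc i) \<in> ?K" "loop j \<in> ?K" using i j by (auto intro: generate.incl)
  have c: "s i \<in> carrier G" "loop i \<in> carrier G" "loop (Suc i) \<in> carrier G" "loop j \<in> carrier G"
    using s_closed loop_closed i j by auto
  note conj = conj_memI[OF sub c(1,4)]
  consider "j = i" | "j = Suc i" | "j \<noteq> i" "j \<noteq> Suc i" by blast
  then have "s i \<otimes> loop j \<otimes> inv (s i) \<in> ?K \<and> inv (s i) \<otimes> loop j \<otimes> s i \<in> ?K"
  proof cases
    case 1
    have "s i \<otimes> loop i = inv (loop i) \<otimes> (loop i \<otimes> (s i \<otimes> loop i))" using c by (simp add: inv_cancel)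
    also have "\<dots> = inv (loop i) \<otimes> loop (Suc i) \<otimes> loop i \<otimes> s i" unfolding loop_down[OF i] using c by (simp add: m_assoc)
    finally show ?thesis using conj(1)[of "inv (loop i) \<otimes> loop (Suc i) \<otimes> loop i"] conj(2)[of "loop (Suc i)"] loop_up[OF i] xK 1
      by simp
  next
    case 2
    have "s i \<otimes> (loop (Suc i) \<otimes> loop i \<otimes> inv (loop (Suc i))) = (s i \<otimes> (loop (Suc i) \<otimes> loop i)) \<otimes> inv (loop (Suc i))"
      using c by (simp add: m_assoc)
    also have "\<dots> = loop (Suc i) \<otimes> (loop i \<otimes> s i) \<otimes> inv (loop (Suc i))" by (simp only: loop_pair[OF i])
    also have "\<dots> = loop (Suc i) \<otimes> (s i \<otimes> loop (Suc i)) \<otimes> inv (loop (Suc i))" by (simp only: loop_up[OF i])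
    also have "\<dots> = loop (Suc i) \<otimes> s i" using c by (simp add: m_assoc)
    finally show ?thesis using conj(1)[of "loop i"] conj(2)[of "loop (Suc i) \<otimes> loop i \<otimes> inv (loop (Suc i))"] loop_up[OF i] xK 2
      by simp
  next
    case 3
    then show ?thesis using conj[of "loop j"] loop_commute[OF i j] xK by simp
  qed
  then show "s i \<otimes> loop j \<otimes> inv (s i) \<in> ?K" "inv (s i) \<otimes> loop j \<otimes> s i \<in> ?K" by simp_all
qed

end

section \<open>The braid group and the Artin group of type B\<close>

text \<open>
  \<open>braid_group m\<close> has \<open>m\<close> generators, hence \<open>m + 1\<close> strands. \<open>typeB_group m\<close> has the further
  generator \<open>m\<close> at the end of the diagram with label 4, hence \<open>m + 1\<close> generators and again \<open>m + 1\<close>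
  strands besides the puncture.
\<close>

definition braid_matrix :: "nat \<Rightarrow> nat \<Rightarrow> enat"
  where "braid_matrix i j = (if i = j then 1 else if i = Suc j \<or> j = Suc i then 3 else 2)"

definition typeB_matrix :: "nat \<Rightarrow> nat \<Rightarrow> nat \<Rightarrow> enat"
  where "typeB_matrix m i j =
    (if i = j then 1 else if i = Suc j \<or> j = Suc i then if i = m \<or> j = m then 4 else 3 else 2)"

definition braid_group :: "nat \<Rightarrow> nat gword set monoid"
  where "braid_group m = artin_group {..<m} braid_matrix"

definition braid_gen :: "nat \<Rightarrow> nat \<Rightarrow> nat gword set"
  where "braid_gen m = artin_gen {..<m} braid_matrix"

definition typeB_group :: "nat \<Rightarrow> nat gword set monoid"
  where "typeB_group m = artin_group {..m} (typeB_matrix m)"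

definition typeB_gen :: "nat \<Rightarrow> nat \<Rightarrow> nat gword set"
  where "typeB_gen m = artin_gen {..m} (typeB_matrix m)"

lemma (in monoid) alt_prod_numeral:
  "x \<in> carrier G \<Longrightarrow> y \<in> carrier G \<Longrightarrow> alt_prod G 2 x y = x \<otimes> y"
  "x \<in> carrier G \<Longrightarrow> y \<in> carrier G \<Longrightarrow> alt_prod G 3 x y = x \<otimes> (y \<otimes> x)"
  "x \<in> carrier G \<Longrightarrow> y \<in> carrier G \<Longrightarrow> alt_prod G 4 x y = x \<otimes> (y \<otimes> (x \<otimes> y))"
  by (simp_all add: eval_nat_numeral)

lemma enat_numeral_eq: "(numeral w = enat k) \<longleftrightarrow> k = numeral w"
  by (metis enat.inject numeral_eq_enat)

lemma braid_family_gen: "braid_family (braid_group m) m (braid_gen m)"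
proof -
  interpret group "braid_group m" by (simp add: braid_group_def group_artin_group)
  have c: "braid_gen m i \<in> carrier (braid_group m)" if "i < m" for i
    using that by (simp add: braid_gen_def braid_group_def artin_gen_closed)
  have r: "alt_prod (braid_group m) k (braid_gen m i) (braid_gen m j) =
      alt_prod (braid_group m) k (braid_gen m j) (braid_gen m i)"
    if "i < m" "j < m" "i \<noteq> j" "braid_matrix i j = enat k" for i j k
    unfolding braid_gen_def braid_group_def using that by (intro artin_gen_relation) auto
  show ?thesis
  proof
    show "braid_gen m i \<otimes>\<^bsub>braid_group m\<^esub> (braid_gen m (Suc i) \<otimes>\<^bsub>braid_group m\<^esub> braid_gen m i) =
      braid_gen m (Suc i) \<otimes>\<^bsub>braid_group m\<^esub> (braid_gen m i \<otimes>\<^bsub>braid_group m\<^esub> braid_gen m (Suc i))"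
      if "Suc i < m" for i
      using r[of i "Suc i" 3] that c by (simp add: braid_matrix_def enat_numeral_eq alt_prod_numeral)
    show "braid_gen m i \<otimes>\<^bsub>braid_group m\<^esub> braid_gen m j = braid_gen m j \<otimes>\<^bsub>braid_group m\<^esub> braid_gen m i"
      if "Suc i < j" "j < m" for i j
      using r[of i j 2] that c by (simp add: braid_matrix_def enat_numeral_eq alt_prod_numeral)
  qed (rule c)
qed

lemma braid_group_hom:
  assumes "braid_family H m f"
  shows "\<exists>h. group_hom (braid_group m) H h \<and> (\<forall>i<m. h (braid_gen m i) = f i)"
proof -
  interpret f: braid_family H m f by fact
  have "alt_prod H k (f i) (f j) = alt_prod H k (f j) (f i)"
    if "i < m" "j < m" "i \<noteq> j" "braid_matrix i j = enat k" for i j k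
    using that f.s_closed[of i] f.s_closed[of j] f.braid[of i] f.braid[of j] f.commute[of i j]
    by (auto simp: braid_matrix_def enat_numeral_eq f.alt_prod_numeral split: if_splits)
  then have "\<exists>h. group_hom (artin_group {..<m} braid_matrix) H h \<and>
      (\<forall>i\<in>{..<m}. h (artin_gen {..<m} braid_matrix i) = f i)"
    using f.s_closed by (intro artin_group_hom f.is_group) auto
  then show ?thesis by (simp add: braid_group_def braid_gen_def Ball_def)
qed

lemma typeB_familyI:
  assumes "group H" and c: "\<And>i. i \<le> m \<Longrightarrow> f i \<in> carrier H"
    and r: "\<And>i j k. i \<le> m \<Longrightarrow> j \<le> m \<Longrightarrow> i \<noteq> j \<Longrightarrow> typeB_matrix m i j = enat k \<Longrightarrow>
      alt_prod H k (f i) (f j) = alt_prod H k (f j) (f i)"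
  shows "typeB_family H m f"
proof -
  interpret group H by fact
  show ?thesis
  proof
    show "f i \<otimes>\<^bsub>H\<^esub> (f (Suc i) \<otimes>\<^bsub>H\<^esub> f i) = f (Suc i) \<otimes>\<^bsub>H\<^esub> (f i \<otimes>\<^bsub>H\<^esub> f (Suc i))" if "Suc i < m" for i
      using r[of i "Suc i" 3] that c by (simp add: typeB_matrix_def enat_numeral_eq alt_prod_numeral)
    show "f i \<otimes>\<^bsub>H\<^esub> f j = f j \<otimes>\<^bsub>H\<^esub> f i" if "Suc i < j" "j < m" for i j
      using r[of i j 2] that c by (simp add: typeB_matrix_def enat_numeral_eq alt_prod_numeral)
    show "f i \<otimes>\<^bsub>H\<^esub> f m = f m \<otimes>\<^bsub>H\<^esub> f i" if "Suc i < m" for i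
      using r[of i m 2] that c by (simp add: typeB_matrix_def enat_numeral_eq alt_prod_numeral)
    show "f k \<otimes>\<^bsub>H\<^esub> (f m \<otimes>\<^bsub>H\<^esub> (f k \<otimes>\<^bsub>H\<^esub> f m)) = f m \<otimes>\<^bsub>H\<^esub> (f k \<otimes>\<^bsub>H\<^esub> (f m \<otimes>\<^bsub>H\<^esub> f k))"
      if "m = Suc k" for k
    proof -
      have k: "k \<le> m" "k \<noteq> m" "typeB_matrix m k m = enat 4"
        using that by (simp_all add: typeB_matrix_def numeral_eq_enat)
      show ?thesis using r[OF k(1) le_refl k(2,3)] k(1) by (simp only: c le_refl alt_prod_numeral)
    qed
  qed (simp_all add: c)
qed

lemma typeB_family_gen: "typeB_family (typeB_group m) m (typeB_gen m)"
  unfolding typeB_gen_def typeB_group_def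
  by (intro typeB_familyI group_artin_group artin_gen_closed artin_gen_relation) auto

lemma (in typeB_family) gen_closed: "i \<le> m \<Longrightarrow> s i \<in> carrier G"
  using s_closed[of i] last_closed by (cases "i = m") auto

lemma (in typeB_family) alt_prod_relation:
  assumes "i \<le> m" "j \<le> m" "i \<noteq> j" "typeB_matrix m i j = enat k"
  shows "alt_prod G k (s i) (s j) = alt_prod G k (s j) (s i)"
proof -
  have half: "alt_prod G k (s i) (s j) = alt_prod G k (s j) (s i)"
    if "i < j" "j \<le> m" "typeB_matrix m i j = enat k" for i j
    using that gen_closed[of i] gen_closed[of j] braid[of i] far_commute[of i j] last_commute[of i] last_four[of i]
    by (cases "j = m"; cases "j = Suc i")
      (auto simp: typeB_matrix_def enat_numeral_eq alt_prod_numeral split: if_splits)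
  have "typeB_matrix m j i = typeB_matrix m i j" by (auto simp: typeB_matrix_def)
  then show ?thesis using half[of i j] half[of j i] assms by (cases i j rule: linorder_cases) simp_all
qed

lemma typeB_group_hom:
  assumes "typeB_family H m f"
  shows "\<exists>h. group_hom (typeB_group m) H h \<and> (\<forall>i\<le>m. h (typeB_gen m i) = f i)"
proof -
  interpret f: typeB_family H m f by fact
  have "\<exists>h. group_hom (artin_group {..m} (typeB_matrix m)) H h \<and>
      (\<forall>i\<in>{..m}. h (artin_gen {..m} (typeB_matrix m) i) = f i)"
    using f.gen_closed f.alt_prod_relation by (intro artin_group_hom f.is_group) auto
  then show ?thesis by (simp add: typeB_group_def typeB_gen_def Ball_def)
qed

lemma braid_gen_closed: "i < m \<Longrightarrow> braid_gen m i \<in> carrier (braid_group m)"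
  by (simp add: braid_gen_def braid_group_def artin_gen_closed)

lemma typeB_gen_closed: "i \<le> m \<Longrightarrow> typeB_gen m i \<in> carrier (typeB_group m)"
  by (simp add: typeB_gen_def typeB_group_def artin_gen_closed)

lemma generate_braid_gen: "generate (braid_group m) (braid_gen m ` {..<m}) = carrier (braid_group m)"
  by (simp add: braid_gen_def braid_group_def generate_artin_gen)

lemma generate_typeB_gen: "generate (typeB_group m) (typeB_gen m ` {..m}) = carrier (typeB_group m)"
  by (simp add: typeB_gen_def typeB_group_def generate_artin_gen)

lemma group_braid_group: "group (braid_group m)"
  by (simp add: braid_group_def group_artin_group)

section \<open>Automorphisms of free groups as permutations\<close>

abbreviation free_perms :: "'a set \<Rightarrow> ('a gword set \<Rightarrow> 'a gword set) monoid"
  where "free_perms I \<equiv> BijGroup (carrier (free_group I))"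

definition as_perm :: "'a set \<Rightarrow> ('a gword set \<Rightarrow> 'a gword set) \<Rightarrow> 'a gword set \<Rightarrow> 'a gword set"
  where "as_perm I h = restrict h (carrier (free_group I))"

definition free_aut :: "'a set \<Rightarrow> ('a gword set \<Rightarrow> 'a gword set) \<Rightarrow> bool"
  where "free_aut I h \<longleftrightarrow> h \<in> hom (free_group I) (free_group I) \<and> as_perm I h \<in> carrier (free_perms I)"

text \<open>An endomorphism that has an inverse on the basis permutes the free group.\<close>

lemma free_autI:
  assumes "h \<in> hom (free_group I) (free_group I)" "k \<in> hom (free_group I) (free_group I)"
    and "\<And>i. i \<in> I \<Longrightarrow> k (h (free_gen I i)) = free_gen I i" "\<And>i. i \<in> I \<Longrightarrow> h (k (free_gen I i)) = free_gen I i"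
  shows "free_aut I h"
proof -
  have "k (h x) = x" if "x \<in> carrier (free_group I)" for x
    using free_group_hom_eq[OF group_free_group hom_compose[OF assms(1,2)] hom_id _ that] assms(3) by simp
  moreover have "h (k x) = x" if "x \<in> carrier (free_group I)" for x
    using free_group_hom_eq[OF group_free_group hom_compose[OF assms(2,1)] hom_id _ that] assms(4) by simp
  ultimately have "as_perm I h \<in> carrier (free_perms I)"
    unfolding as_perm_def using assms(1,2) by (intro restrict_in_Bij[where g = k]) (auto simp: hom_def)
  then show ?thesis using assms(1) by (simp add: free_aut_def)
qed

lemma free_aut_perm: "free_aut I h \<Longrightarrow> as_perm I h \<in> carrier (free_perms I)"
  by (simp add: free_aut_def)

lemma free_aut_hom: "free_aut I h \<Longrightarrow> group_hom (free_group I) (free_group I) h"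
  by (simp add: free_aut_def group_hom_def group_hom_axioms_def group_free_group)

lemma group_free_perms: "group (free_perms I)"
  by (rule group_BijGroup)

lemma as_perm_apply: "x \<in> carrier (free_group I) \<Longrightarrow> as_perm I h x = h x"
  by (simp add: as_perm_def)

lemma as_perm_comp:
  assumes "free_aut I h" "free_aut I k"
  shows "as_perm I h \<otimes>\<^bsub>free_perms I\<^esub> as_perm I k = as_perm I (h \<circ> k)" "free_aut I (h \<circ> k)"
proof -
  interpret P: group "free_perms I" by (rule group_free_perms)
  have hom: "h \<in> hom (free_group I) (free_group I)" "k \<in> hom (free_group I) (free_group I)"
    using assms by (simp_all add: free_aut_def)
  have hk: "h \<circ> k \<in> hom (free_group I) (free_group I)" by (rule hom_compose[OF hom(2,1)])
  note p = assms[THEN free_aut_perm]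
  have "as_perm I (h \<circ> k) x = (as_perm I h \<otimes>\<^bsub>free_perms I\<^esub> as_perm I k) x"
    if x: "x \<in> carrier (free_group I)" for x
  proof -
    have "k x \<in> carrier (free_group I)" using hom(2) x by (auto simp: hom_def)
    then show ?thesis using p x by (simp add: Bij_mult_apply as_perm_apply)
  qed
  moreover have "as_perm I h \<otimes>\<^bsub>free_perms I\<^esub> as_perm I k \<in> extensional (carrier (free_group I))"
    using P.m_closed[OF p] by (simp add: BijGroup_def Bij_def)
  ultimately show eq: "as_perm I h \<otimes>\<^bsub>free_perms I\<^esub> as_perm I k = as_perm I (h \<circ> k)"
    by (intro extensionalityI[where A = "carrier (free_group I)"]) (simp_all add: as_perm_def)
  show "free_aut I (h \<circ> k)" using hk P.m_closed[OF p] unfolding eq by (simp add: free_aut_def)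
qed

lemma as_perm_eqI:
  assumes "free_aut I h" "free_aut I k" "\<And>i. i \<in> I \<Longrightarrow> h (free_gen I i) = k (free_gen I i)"
  shows "as_perm I h = as_perm I k"
  unfolding as_perm_def
proof (rule restrict_ext)
  fix x assume "x \<in> carrier (free_group I)"
  then show "h x = k x"
    using free_group_hom_eq[OF group_free_group, of h I I k x] assms by (simp add: free_aut_def)
qed

text \<open>Relations between permutations that come from endomorphisms need only be checked on the basis.\<close>

lemma as_perm_mult2:
  assumes "free_aut I h" "free_aut I h'" "free_aut I k" "free_aut I k'"
    and "\<And>i. i \<in> I \<Longrightarrow> h (h' (free_gen I i)) = k (k' (free_gen I i))"
  shows "as_perm I h \<otimes>\<^bsub>free_perms I\<^esub> as_perm I h' = as_perm I k \<otimes>\<^bsub>free_perms I\<^esub> as_perm I k'"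
  using assms as_perm_eqI[OF as_perm_comp(2) as_perm_comp(2), of I h h' k k'] by (simp add: as_perm_comp(1))

lemma as_perm_mult3:
  assumes "free_aut I h" "free_aut I h'" "free_aut I h''" "free_aut I k" "free_aut I k'" "free_aut I k''"
    and "\<And>i. i \<in> I \<Longrightarrow> h (h' (h'' (free_gen I i))) = k (k' (k'' (free_gen I i)))"
  shows "as_perm I h \<otimes>\<^bsub>free_perms I\<^esub> (as_perm I h' \<otimes>\<^bsub>free_perms I\<^esub> as_perm I h'') =
    as_perm I k \<otimes>\<^bsub>free_perms I\<^esub> (as_perm I k' \<otimes>\<^bsub>free_perms I\<^esub> as_perm I k'')"
  using assms as_perm_mult2[OF assms(1) as_perm_comp(2) assms(4) as_perm_comp(2), of h' h'' k' k'']
  by (simp add: as_perm_comp(1))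

text \<open>Automorphisms normalise the left translations. This is how the semidirect product of the free
  group with its automorphism group appears inside the permutations of the free group.\<close>

lemma as_perm_left_mult:
  assumes "free_aut I h" "u \<in> carrier (free_group I)"
  shows "as_perm I h \<otimes>\<^bsub>free_perms I\<^esub> left_mult (free_group I) u =
    left_mult (free_group I) (h u) \<otimes>\<^bsub>free_perms I\<^esub> as_perm I h"
proof -
  interpret P: group "free_perms I" by (rule group_free_perms)
  interpret h: group_hom "free_group I" "free_group I" h by (rule free_aut_hom[OF assms(1)])
  have hu: "h u \<in> carrier (free_group I)" using assms(2) by simp
  note p = free_aut_perm[OF assms(1)] h.G.left_mult_Bij[OF assms(2)] h.G.left_mult_Bij[OF hu]
  show ?thesis
  proof (rule Bij_eqI)
    fix x assume "x \<in> carrier (free_group I)"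
    then show "(as_perm I h \<otimes>\<^bsub>free_perms I\<^esub> left_mult (free_group I) u) x =
        (left_mult (free_group I) (h u) \<otimes>\<^bsub>free_perms I\<^esub> as_perm I h) x"
      using p assms(2) by (simp add: Bij_mult_apply as_perm_apply left_mult_def)
  qed (use p in auto)
qed

section \<open>Forgetting the puncture: from type B to braids\<close>

lemma (in braid_family) extend_by_one: "typeB_family G m (\<lambda>i. if i < m then s i else \<one>)"
proof
  let ?s = "\<lambda>i. if i < m then s i else \<one>"
  show "?s k \<otimes> (?s m \<otimes> (?s k \<otimes> ?s m)) = ?s m \<otimes> (?s k \<otimes> (?s m \<otimes> ?s k))" if "m = Suc k" for k
  proof -
    have "s k \<in> carrier G" using s_closed that by simp
    then show ?thesis using that by simp
  qed
qed (use s_closed braid far_commute in auto)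

text \<open>The puncture is forgotten by killing the last generator. On the free group with basis \<open>g j\<close>,
  standing for the loop of the strand \<open>j\<close>, a crossing acts by its Artin automorphism and the last
  generator by left translation with \<open>g m\<close>. Then each loop acts by left translation with its basis
  element, because the automorphisms carry the translations into each other in the same way as the crossings
  conjugate the loops.\<close>

theorem virtually_poly_free_typeB:
  assumes "virtually_poly_free (braid_group m)"
  shows "virtually_poly_free (typeB_group m)"
proof -
  let ?B = "typeB_group m" and ?Q = "braid_group m"
  interpret B: typeB_family "typeB_group m" m "typeB_gen m" by (rule typeB_family_gen)
  interpret Q: braid_family "braid_group m" m "braid_gen m" by (rule braid_family_gen)
  let ?I = "{..m}"
  let ?F = "free_group ?I" and ?P = "free_perms ?I"
  interpret F: group ?F by (rule group_free_group)
  interpret P: group ?P by (rule group_free_perms)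
  define g where "g = free_gen ?I"
  have g: "g j \<in> carrier ?F" if "j \<le> m" for j using that by (simp add: g_def free_gen_closed)

  obtain f where f: "group_hom ?B ?Q f"
    and f_gen: "\<And>i. i \<le> m \<Longrightarrow> f (typeB_gen m i) = (if i < m then braid_gen m i else \<one>\<^bsub>?Q\<^esub>)"
    using typeB_group_hom[OF Q.extend_by_one] by blast
  interpret f: group_hom "typeB_group m" "braid_group m" f by (rule f)
  obtain s where s: "group_hom ?Q ?B s"
    and s_gen: "\<And>i. i < m \<Longrightarrow> s (braid_gen m i) = typeB_gen m i"
    using braid_group_hom[OF B.braid_family_axioms] by auto
  interpret s: group_hom "braid_group m" "typeB_group m" s by (rule s)
  have Qgen: "braid_gen m ` {..<m} \<subseteq> carrier ?Q" by (auto intro: braid_gen_closed)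
  have Bgen: "typeB_gen m ` {..m} \<subseteq> carrier ?B" by (auto intro: typeB_gen_closed)
  have fs: "f (s q) = q" if "q \<in> carrier ?Q" for q
  proof -
    have "(f \<circ> s) q = q"
    proof (rule hom_fixing_generators[OF Q.is_group hom_compose[OF s.homh f.homh] Qgen generate_braid_gen _ that])
      show "(f \<circ> s) a = a" if "a \<in> braid_gen m ` {..<m}" for a using that by (auto simp: s_gen f_gen)
    qed
    then show ?thesis by simp
  qed
  have onto: "f ` carrier ?B = carrier ?Q" by (rule f.surj_of_section[OF s fs])
  have fx: "f (B.loop j) = \<one>\<^bsub>?Q\<^esub>" if "j \<le> m" for j
    using that
  proof (induction rule: inc_induct)
    case base
    then show ?case by (simp add: B.loop_last f_gen)
  next
    case (step n)
    then show ?case using B.s_closed[of n] B.loop_closed[of "Suc n"] by (simp add: B.loop_rec)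
  qed

  \<comment> \<open>The automorphism of the crossing \<open>i\<close> and its inverse, on the basis element \<open>j\<close>: these are the
    formulas for conjugating the loop \<open>j\<close> by \<open>s i\<close>.\<close>
  define c where "c i j = (if j = Suc i then g i
      else if j = i then inv\<^bsub>?F\<^esub> g i \<otimes>\<^bsub>?F\<^esub> g (Suc i) \<otimes>\<^bsub>?F\<^esub> g i else g j)" for i j
  define d where "d i j = (if j = i then g (Suc i)
      else if j = Suc i then g (Suc i) \<otimes>\<^bsub>?F\<^esub> g i \<otimes>\<^bsub>?F\<^esub> inv\<^bsub>?F\<^esub> g (Suc i) else g j)" for i j
  define e where "e i = free_end ?I (c i)" for i
  have c: "c i j \<in> carrier ?F" "d i j \<in> carrier ?F" if "i < m" "j \<le> m" for i j
    using that g by (auto simp: c_def d_def)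
  have e: "e i \<in> hom ?F ?F" "j \<le> m \<Longrightarrow> e i (g j) = c i j" if "i < m" for i j
    using free_end[of ?I "c i"] c that by (auto simp: e_def g_def)
  have e': "free_end ?I (d i) \<in> hom ?F ?F" "j \<le> m \<Longrightarrow> free_end ?I (d i) (g j) = d i j" if "i < m" for i j
    using free_end[of ?I "d i"] c that by (auto simp: g_def)
  have homs: "h (x \<otimes>\<^bsub>?F\<^esub> y) = h x \<otimes>\<^bsub>?F\<^esub> h y" "h (inv\<^bsub>?F\<^esub> x) = inv\<^bsub>?F\<^esub> h x"
    if "h \<in> hom ?F ?F" "x \<in> carrier ?F" "y \<in> carrier ?F" for h x y
    using that group_hom.hom_inv[of ?F ?F h x] F.is_group
    by (auto simp: hom_mult group_hom_def group_hom_axioms_def)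
  have aut: "free_aut ?I (e i)" if i: "i < m" for i
  proof (rule free_autI[OF e(1)[OF i] e'(1)[OF i]])
    fix j assume "j \<in> ?I"
    then have j: "j \<le> m" by simp
    show "free_end ?I (d i) (e i (free_gen ?I j)) = free_gen ?I j"
      using i j g[of i] g[of "Suc i"] g[of j]
      by (fold g_def) (auto simp: e e' c_def d_def homs F.m_assoc F.inv_cancel F.inv_mult_group)
    show "e i (free_end ?I (d i) (free_gen ?I j)) = free_gen ?I j"
      using i j g[of i] g[of "Suc i"] g[of j]
      by (fold g_def) (auto simp: e e' c_def d_def homs F.m_assoc F.inv_cancel F.inv_mult_group)
  qed
  define T where "T i = (if i < m then as_perm ?I (e i) else left_mult ?F (g m))" for i
  have Tc: "T i \<in> carrier ?P" if "i \<le> m" for i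
    using that aut free_aut_perm F.left_mult_Bij g by (auto simp: T_def)
  have Tlm: "T i \<otimes>\<^bsub>?P\<^esub> left_mult ?F (g j) = left_mult ?F (c i j) \<otimes>\<^bsub>?P\<^esub> T i" if "i < m" "j \<le> m" for i j
    using as_perm_left_mult[OF aut[OF that(1)] g[OF that(2)]] that by (simp add: T_def e)
  have lm: "left_mult ?F (u \<otimes>\<^bsub>?F\<^esub> v) = left_mult ?F u \<otimes>\<^bsub>?P\<^esub> left_mult ?F v"
    if "u \<in> carrier ?F" "v \<in> carrier ?F" for u v
    using F.left_mult_hom that by (simp add: hom_def)
  have T: "typeB_family ?P m T"
  proof
    show "T i \<in> carrier ?P" if "i < m" for i using that Tc by simp
    show "T m \<in> carrier ?P" using Tc by simp
    show "T i \<otimes>\<^bsub>?P\<^esub> (T (Suc i) \<otimes>\<^bsub>?P\<^esub> T i) = T (Suc i) \<otimes>\<^bsub>?P\<^esub> (T i \<otimes>\<^bsub>?P\<^esub> T (Suc i))" if i: "Suc i < m" for i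
    proof -
      have "e i (e (Suc i) (e i (g j))) = e (Suc i) (e i (e (Suc i) (g j)))" if j: "j \<le> m" for j
      proof -
        consider "j = i" | "j = Suc i" | "j = Suc (Suc i)" | "j \<noteq> i" "j \<noteq> Suc i" "j \<noteq> Suc (Suc i)" by blast
        then show ?thesis
          by cases (use i j g[of i] g[of "Suc i"] g[of "Suc (Suc i)"] g[of j] in
            \<open>auto simp: e c_def homs F.m_assoc F.inv_cancel F.inv_mult_group\<close>)
      qed
      then show ?thesis using as_perm_mult3[OF aut aut aut aut aut aut] i by (simp add: T_def g_def)
    qed
    show "T i \<otimes>\<^bsub>?P\<^esub> T k = T k \<otimes>\<^bsub>?P\<^esub> T i" if i: "Suc i < k" "k < m" for i k
    proof -
      have "e i (e k (g j)) = e k (e i (g j))" if j: "j \<le> m" for j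
      proof -
        consider "j = i" | "j = Suc i" | "j = k" | "j = Suc k" | "j \<noteq> i" "j \<noteq> Suc i" "j \<noteq> k" "j \<noteq> Suc k" by blast
        then show ?thesis
          by cases (use i j g[of i] g[of "Suc i"] g[of k] g[of "Suc k"] g[of j] in
            \<open>auto simp: e c_def homs\<close>)
      qed
      then show ?thesis using as_perm_mult2[OF aut aut aut aut] i by (simp add: T_def g_def)
    qed
    show "T i \<otimes>\<^bsub>?P\<^esub> T m = T m \<otimes>\<^bsub>?P\<^esub> T i" if "Suc i < m" for i
      using Tlm[of i m] that by (simp add: T_def c_def)
    show "T k \<otimes>\<^bsub>?P\<^esub> (T m \<otimes>\<^bsub>?P\<^esub> (T k \<otimes>\<^bsub>?P\<^esub> T m)) = T m \<otimes>\<^bsub>?P\<^esub> (T k \<otimes>\<^bsub>?P\<^esub> (T m \<otimes>\<^bsub>?P\<^esub> T k))"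
      if m: "m = Suc k" for k
    proof -
      \<comment> \<open>Moving both translations to the left, the relation of length four becomes
        \<open>g k * e k (g k) = g m * g k\<close> in the free group, with \<open>e k\<close> the automorphism.\<close>
      let ?L = "left_mult ?F"
      have km: "k < m" "k \<le> m" using m by auto
      have gk: "g k \<in> carrier ?F" "g m \<in> carrier ?F" using g km by auto
      have Lc: "?L (g k) \<in> carrier ?P" "?L (g m) \<in> carrier ?P" "?L (c k k) \<in> carrier ?P"
        using F.left_mult_Bij gk c(1)[of k k] km by auto
      have Tk: "T k \<in> carrier ?P" using Tc km by simp
      have Tm: "T m = ?L (g m)" by (simp add: T_def)
      have ckm: "c k m = g k" and ckk: "c k k = inv\<^bsub>?F\<^esub> g k \<otimes>\<^bsub>?F\<^esub> g m \<otimes>\<^bsub>?F\<^esub> g k"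
        using m by (simp_all add: c_def)
      have 1: "T k \<otimes>\<^bsub>?P\<^esub> ?L (g m) = ?L (g k) \<otimes>\<^bsub>?P\<^esub> T k" using Tlm[of k m] km ckm by simp
      have 2: "T k \<otimes>\<^bsub>?P\<^esub> ?L (g k) = ?L (c k k) \<otimes>\<^bsub>?P\<^esub> T k" using Tlm[of k k] km by simp
      have "g k \<otimes>\<^bsub>?F\<^esub> c k k = g m \<otimes>\<^bsub>?F\<^esub> g k"
        unfolding ckk using gk by (simp add: F.m_assoc F.inv_cancel)
      then have 3: "?L (g k) \<otimes>\<^bsub>?P\<^esub> ?L (c k k) = ?L (g m) \<otimes>\<^bsub>?P\<^esub> ?L (g k)"
        using lm[of "g k" "c k k"] lm[of "g m" "g k"] gk c(1)[of k k] km by simp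
      have "T k \<otimes>\<^bsub>?P\<^esub> (T m \<otimes>\<^bsub>?P\<^esub> (T k \<otimes>\<^bsub>?P\<^esub> T m)) = T k \<otimes>\<^bsub>?P\<^esub> (?L (g m) \<otimes>\<^bsub>?P\<^esub> (?L (g k) \<otimes>\<^bsub>?P\<^esub> T k))"
        by (simp only: Tm 1)
      also have "\<dots> = ?L (g k) \<otimes>\<^bsub>?P\<^esub> (T k \<otimes>\<^bsub>?P\<^esub> (?L (g k) \<otimes>\<^bsub>?P\<^esub> T k))"
        using P.slide[OF 1] Tk Lc by simp
      also have "\<dots> = ?L (g k) \<otimes>\<^bsub>?P\<^esub> (?L (c k k) \<otimes>\<^bsub>?P\<^esub> (T k \<otimes>\<^bsub>?P\<^esub> T k))"
        using P.slide[OF 2] Tk Lc by simp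
      also have "\<dots> = ?L (g m) \<otimes>\<^bsub>?P\<^esub> (?L (g k) \<otimes>\<^bsub>?P\<^esub> (T k \<otimes>\<^bsub>?P\<^esub> T k))"
        using P.slide[OF 3] Tk Lc by simp
      also have "\<dots> = ?L (g m) \<otimes>\<^bsub>?P\<^esub> (T k \<otimes>\<^bsub>?P\<^esub> (?L (g m) \<otimes>\<^bsub>?P\<^esub> T k))"
        using P.slide[OF 1] Tk Lc by simp
      finally show ?thesis by (simp only: Tm)
    qed
  qed
  obtain \<alpha> where \<alpha>: "group_hom ?B ?P \<alpha>" and \<alpha>_gen: "\<And>i. i \<le> m \<Longrightarrow> \<alpha> (typeB_gen m i) = T i"
    using typeB_group_hom[OF T] by blast
  interpret \<alpha>: group_hom "typeB_group m" ?P \<alpha> by (rule \<alpha>)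
  have \<alpha>x: "\<alpha> (B.loop j) = left_mult ?F (g j)" if "j \<le> m" for j
    using that
  proof (induction rule: inc_induct)
    case base
    then show ?case by (simp add: B.loop_last \<alpha>_gen T_def)
  next
    case (step n)
    have Tn: "T n \<in> carrier ?P" and L: "left_mult ?F (g n) \<in> carrier ?P"
      using step Tc F.left_mult_Bij g by auto
    have "\<alpha> (B.loop n) = T n \<otimes>\<^bsub>?P\<^esub> left_mult ?F (g (Suc n)) \<otimes>\<^bsub>?P\<^esub> inv\<^bsub>?P\<^esub> T n"
      using step B.s_closed[of n] B.loop_closed[of "Suc n"] by (simp add: B.loop_rec \<alpha>_gen)
    also have "T n \<otimes>\<^bsub>?P\<^esub> left_mult ?F (g (Suc n)) = left_mult ?F (g n) \<otimes>\<^bsub>?P\<^esub> T n"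
      using Tlm[of n "Suc n"] step by (simp add: c_def)
    finally show ?case using Tn L by (simp add: P.m_assoc)
  qed

  let ?K = "generate ?B (B.loop ` ?I)"
  have xK: "B.loop j \<in> ?K" if "j \<le> m" for j using that by (auto intro: generate.incl)
  have "is_free_group (typeB_group m\<lparr>carrier := kernel ?B ?Q f\<rparr>)"
  proof (rule free_kernel_criterion[OF f s fs, where b = B.loop and I = ?I and \<alpha> = \<alpha> and
        A = "typeB_gen m ` {..m}" and B = "braid_gen m ` {..<m}"])
    show "B.loop i \<in> carrier ?B" if "i \<in> ?I" for i using that B.loop_closed by simp
    show "f (B.loop i) = \<one>\<^bsub>?Q\<^esub>" if "i \<in> ?I" for i using that fx by simp
    show "typeB_gen m ` {..m} \<subseteq> carrier ?B" by (rule Bgen)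
    show "generate ?B (typeB_gen m ` {..m}) = carrier ?B" by (rule generate_typeB_gen)
    show "braid_gen m ` {..<m} \<subseteq> carrier ?Q" by (rule Qgen)
    show "generate ?Q (braid_gen m ` {..<m}) = carrier ?Q" by (rule generate_braid_gen)
    show "\<alpha> \<in> hom ?B ?P" by (rule \<alpha>.homh)
    show "\<alpha> (B.loop i) = left_mult ?F (free_gen ?I i)" if "i \<in> ?I" for i using that \<alpha>x by (simp add: g_def)
    show "\<exists>k\<in>?K. \<exists>q\<in>carrier ?Q. a = k \<otimes>\<^bsub>?B\<^esub> s q" if a: "a \<in> typeB_gen m ` {..m}" for a
    proof -
      obtain i where i: "i \<le> m" "a = typeB_gen m i" using a by auto
      show ?thesis
      proof (cases "i = m")
        case True
        then show ?thesis using xK[of m] i B.last_closed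
          by (intro bexI[of _ "B.loop m"] bexI[of _ "\<one>\<^bsub>?Q\<^esub>"]) (simp_all add: B.loop_last)
      next
        case False
        then show ?thesis using i B.s_closed[of i] Q.s_closed[of i] s_gen[of i] generate.one
          by (intro bexI[of _ "\<one>\<^bsub>?B\<^esub>"] bexI[of _ "braid_gen m i"]) simp_all
      qed
    qed
    fix q j assume "q \<in> braid_gen m ` {..<m}" "j \<in> ?I"
    then obtain i where i: "i < m" "q = braid_gen m i" and j: "j \<le> m" by auto
    then show "s q \<otimes>\<^bsub>?B\<^esub> B.loop j \<otimes>\<^bsub>?B\<^esub> inv\<^bsub>?B\<^esub> s q \<in> ?K"
      "inv\<^bsub>?B\<^esub> s q \<otimes>\<^bsub>?B\<^esub> B.loop j \<otimes>\<^bsub>?B\<^esub> s q \<in> ?K"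
      using B.loop_conj_in_generate[of i j] by (simp_all add: s_gen)
  qed
  then show ?thesis by (rule virtually_poly_free_extension[OF f onto _ assms])
qed

section \<open>Fixing a strand: type B inside the braid group\<close>

definition strand_move :: "nat \<Rightarrow> nat \<Rightarrow> nat"
  where "strand_move i j = (if j = i then Suc i else if j = Suc i then i else j)"

lemma strand_move_involution: "strand_move i (strand_move i j) = j"
  by (simp add: strand_move_def)

lemma strand_move_le: "i \<le> m \<Longrightarrow> j \<le> Suc m \<Longrightarrow> strand_move i j \<le> Suc m"
  by (simp add: strand_move_def)

lemma strand_move_braid:
  "strand_move i (strand_move (Suc i) (strand_move i j)) = strand_move (Suc i) (strand_move i (strand_move (Suc i) j))"
  by (auto simp: strand_move_def)

lemma strand_move_commute:
  "Suc i < k \<Longrightarrow> strand_move i (strand_move k j) = strand_move k (strand_move i j)"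
  by (auto simp: strand_move_def)

context typeB_family begin

text \<open>Let \<open>t j\<close> be the braid \<open>s j s (j + 1) \<dots> s m\<close> on \<open>m + 2\<close> strands, which relates the position \<open>j\<close> of
  the marked strand to the last position. It represents a coset of the subgroup fixing the last
  position, and \<open>coc\<close> is the resulting cocycle with values in type \<open>B\<close>: the product of the crossing
  \<open>i\<close> with \<open>t j\<close> is \<open>t (strand_move i j)\<close> times \<open>coc i j\<close>. If the crossing does not involve the marked
  strand, only its number changes when that strand is disregarded; if it does, then one of the two
  directions is trivial and the other contributes a loop around the marked strand.\<close>

definition coc where
  "coc i j = (if j = i then loop i else if j = Suc i then \<one> else if j < i then s (i - 1) else s i)"

lemma coc_closed: "i \<le> m \<Longrightarrow> j \<le> Suc m \<Longrightarrow> coc i j \<in> carrier G"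
  by (auto simp: coc_def loop_closed s_closed)

text \<open>The cocycle identity for the braid relation. With the marked strand away from the crossings it is
  the braid relation for the other strands; otherwise it expresses how crossings act on loops.\<close>

lemma coc_braid:
  assumes i: "i < m" and j: "j \<le> Suc m"
  shows "coc i (strand_move (Suc i) (strand_move i j)) \<otimes> (coc (Suc i) (strand_move i j) \<otimes> coc i j) =
    coc (Suc i) (strand_move i (strand_move (Suc i) j)) \<otimes> (coc i (strand_move (Suc i) j) \<otimes> coc (Suc i) j)"
proof -
  consider "j < i" | "j = i" | "j = Suc i" | "j = Suc (Suc i)" | "Suc (Suc i) < j" by linarith
  then show ?thesis
  proof cases
    case 1
    then have "Suc (i - 1) = i" by simp
    then show ?thesis using braid[of "i - 1"] i 1 by (simp add: coc_def strand_move_def)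
  next
    case 2
    then show ?thesis using loop_pair[OF i] by (simp add: coc_def strand_move_def)
  next
    case 3
    then show ?thesis using loop_up[OF i] s_closed[OF i] loop_closed i by (simp add: coc_def strand_move_def)
  next
    case 4
    then show ?thesis using s_closed[OF i] by (simp add: coc_def strand_move_def)
  next
    case 5
    then show ?thesis using braid[of i] i j by (simp add: coc_def strand_move_def)
  qed
qed

lemma coc_commute:
  assumes i: "Suc i < k" and k: "k \<le> m" and j: "j \<le> Suc m"
  shows "coc i (strand_move k j) \<otimes> coc k j = coc k (strand_move i j) \<otimes> coc i j"
proof -
  have c: "s i \<in> carrier G" "s (k - 1) \<in> carrier G" using i k s_closed by auto
  consider "j < i" | "j = i" | "j = Suc i" | "Suc i < j" "j < k" | "j = k" | "j = Suc k" | "Suc k < j" by linarith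
  then show ?thesis
  proof cases
    case 1
    then show ?thesis using commute[of "i - 1" "k - 1"] i k by (simp add: coc_def strand_move_def)
  next
    case 2
    then show ?thesis using loop_commute[of "k - 1" i] i k by (simp add: coc_def strand_move_def)
  next
    case 3
    then show ?thesis using c i by (simp add: coc_def strand_move_def)
  next
    case 4
    then show ?thesis using commute[of i "k - 1"] i k by (simp add: coc_def strand_move_def)
  next
    case 5
    then show ?thesis using loop_commute[of i k] i k by (simp add: coc_def strand_move_def)
  next
    case 6
    then show ?thesis using c i by (simp add: coc_def strand_move_def)
  next
    case 7
    then show ?thesis using commute[of i k] i k j by (simp add: coc_def strand_move_def)
  qed
qed

text \<open>The action induced from the subgroup fixing the marked strand, on pairs of a position and an
  element of that subgroup.\<close>

definition coset_perm where
  "coset_perm i = (\<lambda>(j, a) \<in> {..Suc m} \<times> carrier G. (strand_move i j, coc i j \<otimes> a))"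

lemma coset_perm_apply:
  "j \<le> Suc m \<Longrightarrow> a \<in> carrier G \<Longrightarrow> coset_perm i (j, a) = (strand_move i j, coc i j \<otimes> a)"
  by (simp add: coset_perm_def)

lemma coset_perm_Bij:
  assumes i: "i \<le> m"
  shows "coset_perm i \<in> carrier (BijGroup ({..Suc m} \<times> carrier G))"
proof -
  let ?g = "\<lambda>(j, a). (strand_move i j, inv (coc i (strand_move i j)) \<otimes> a)"
  show ?thesis unfolding coset_perm_def
  proof (rule restrict_in_Bij[where g = ?g])
    fix y assume y: "y \<in> {..Suc m} \<times> carrier G"
    obtain j a where ja: "y = (j, a)" "j \<le> Suc m" "a \<in> carrier G" using y by auto
    have c: "coc i j \<in> carrier G" "coc i (strand_move i j) \<in> carrier G" "strand_move i j \<le> Suc m"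
      using coc_closed i ja(2) strand_move_le by auto
    show "(case y of (j, a) \<Rightarrow> (strand_move i j, coc i j \<otimes> a)) \<in> {..Suc m} \<times> carrier G"
      "?g y \<in> {..Suc m} \<times> carrier G"
      "?g (case y of (j, a) \<Rightarrow> (strand_move i j, coc i j \<otimes> a)) = y"
      "(case ?g y of (j, a) \<Rightarrow> (strand_move i j, coc i j \<otimes> a)) = y"
      using ja c by (simp_all add: strand_move_involution inv_cancel)
  qed
qed

lemma coset_perm_family: "braid_family (BijGroup ({..Suc m} \<times> carrier G)) (Suc m) coset_perm"
proof -
  let ?E = "{..Suc m} \<times> carrier G"
  interpret P: group "BijGroup ?E" by (rule group_BijGroup)
  show ?thesis
  proof
    show "coset_perm i \<in> carrier (BijGroup ?E)" if "i < Suc m" for i using that coset_perm_Bij by simp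
    show "coset_perm i \<otimes>\<^bsub>BijGroup ?E\<^esub> (coset_perm (Suc i) \<otimes>\<^bsub>BijGroup ?E\<^esub> coset_perm i) =
        coset_perm (Suc i) \<otimes>\<^bsub>BijGroup ?E\<^esub> (coset_perm i \<otimes>\<^bsub>BijGroup ?E\<^esub> coset_perm (Suc i))"
      if "Suc i < Suc m" for i
    proof (rule Bij_eqI)
      have i: "i < m" "i \<le> m" "Suc i \<le> m" using that by auto
      note p = coset_perm_Bij[OF i(2)] coset_perm_Bij[OF i(3)]
      show "coset_perm i \<otimes>\<^bsub>BijGroup ?E\<^esub> (coset_perm (Suc i) \<otimes>\<^bsub>BijGroup ?E\<^esub> coset_perm i) \<in> carrier (BijGroup ?E)"
        "coset_perm (Suc i) \<otimes>\<^bsub>BijGroup ?E\<^esub> (coset_perm i \<otimes>\<^bsub>BijGroup ?E\<^esub> coset_perm (Suc i)) \<in> carrier (BijGroup ?E)"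
        using p by auto
      fix y assume y: "y \<in> ?E"
      obtain j a where ja: "y = (j, a)" "j \<le> Suc m" "a \<in> carrier G" using y by auto
      note cl = coc_closed strand_move_le i ja
      have "coc i (strand_move (Suc i) (strand_move i j)) \<otimes> (coc (Suc i) (strand_move i j) \<otimes> (coc i j \<otimes> a)) =
          (coc i (strand_move (Suc i) (strand_move i j)) \<otimes> (coc (Suc i) (strand_move i j) \<otimes> coc i j)) \<otimes> a"
        using cl by (simp add: m_assoc)
      also have "\<dots> = (coc (Suc i) (strand_move i (strand_move (Suc i) j)) \<otimes>
          (coc i (strand_move (Suc i) j) \<otimes> coc (Suc i) j)) \<otimes> a"
        using coc_braid[OF i(1) ja(2)] by simp
      also have "\<dots> = coc (Suc i) (strand_move i (strand_move (Suc i) j)) \<otimes>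
          (coc i (strand_move (Suc i) j) \<otimes> (coc (Suc i) j \<otimes> a))"
        using cl by (simp add: m_assoc)
      finally show "(coset_perm i \<otimes>\<^bsub>BijGroup ?E\<^esub> (coset_perm (Suc i) \<otimes>\<^bsub>BijGroup ?E\<^esub> coset_perm i)) y =
          (coset_perm (Suc i) \<otimes>\<^bsub>BijGroup ?E\<^esub> (coset_perm i \<otimes>\<^bsub>BijGroup ?E\<^esub> coset_perm (Suc i))) y"
        using p y cl by (simp add: Bij_mult_apply coset_perm_apply strand_move_braid)
    qed
    show "coset_perm i \<otimes>\<^bsub>BijGroup ?E\<^esub> coset_perm k = coset_perm k \<otimes>\<^bsub>BijGroup ?E\<^esub> coset_perm i"
      if ik: "Suc i < k" "k < Suc m" for i k
    proof (rule Bij_eqI)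
      have i: "i \<le> m" "k \<le> m" using ik by auto
      note p = coset_perm_Bij[OF i(1)] coset_perm_Bij[OF i(2)]
      show "coset_perm i \<otimes>\<^bsub>BijGroup ?E\<^esub> coset_perm k \<in> carrier (BijGroup ?E)"
        "coset_perm k \<otimes>\<^bsub>BijGroup ?E\<^esub> coset_perm i \<in> carrier (BijGroup ?E)"
        using p by auto
      fix y assume y: "y \<in> ?E"
      obtain j a where ja: "y = (j, a)" "j \<le> Suc m" "a \<in> carrier G" using y by auto
      note cl = coc_closed strand_move_le i ja
      have "coc i (strand_move k j) \<otimes> (coc k j \<otimes> a) = (coc i (strand_move k j) \<otimes> coc k j) \<otimes> a"
        using cl by (simp add: m_assoc)
      also have "\<dots> = (coc k (strand_move i j) \<otimes> coc i j) \<otimes> a"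
        using coc_commute[OF ik(1) i(2) ja(2)] by simp
      also have "\<dots> = coc k (strand_move i j) \<otimes> (coc i j \<otimes> a)"
        using cl by (simp add: m_assoc)
      finally show "(coset_perm i \<otimes>\<^bsub>BijGroup ?E\<^esub> coset_perm k) y = (coset_perm k \<otimes>\<^bsub>BijGroup ?E\<^esub> coset_perm i) y"
        using p y cl strand_move_commute[OF ik(1)] by (simp add: Bij_mult_apply coset_perm_apply)
    qed
  qed
qed

end

text \<open>If the last strand is regarded as the puncture, then the loop of its neighbour is the square of the last
  crossing. The relation of length four holds because \<open>s n\<close> commutes with
  \<open>s k (s n)\<^sup>2 s k\<close>, by two applications of the braid relation.\<close>

lemma (in braid_family) square_last_family:
  assumes m: "m = Suc n"
  shows "typeB_family G n (\<lambda>i. if i < n then s i else s n \<otimes> s n)"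
proof
  let ?u = "\<lambda>i. if i < n then s i else s n \<otimes> s n"
  have sn: "s n \<in> carrier G" using s_closed m by simp
  show "?u n \<in> carrier G" using sn by simp
  show "?u i \<in> carrier G" if "i < n" for i using that s_closed m by simp
  show "?u i \<otimes> (?u (Suc i) \<otimes> ?u i) = ?u (Suc i) \<otimes> (?u i \<otimes> ?u (Suc i))" if "Suc i < n" for i
    using that braid[of i] m by simp
  show "?u i \<otimes> ?u j = ?u j \<otimes> ?u i" if "Suc i < j" "j < n" for i j
    using that far_commute[of i j] m by simp
  show "?u i \<otimes> ?u n = ?u n \<otimes> ?u i" if i: "Suc i < n" for i
  proof -
    have com: "s i \<otimes> s n = s n \<otimes> s i" using far_commute[of i n] i m by simp
    have si: "s i \<in> carrier G" using s_closed i m by simp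
    have "s i \<otimes> (s n \<otimes> s n) = s n \<otimes> (s i \<otimes> s n)" using slide[OF com] si sn by simp
    also have "\<dots> = s n \<otimes> (s n \<otimes> s i)" by (simp only: com)
    also have "\<dots> = (s n \<otimes> s n) \<otimes> s i" using si sn by (simp add: m_assoc)
    finally show ?thesis using i by simp
  qed
  show "?u k \<otimes> (?u n \<otimes> (?u k \<otimes> ?u n)) = ?u n \<otimes> (?u k \<otimes> (?u n \<otimes> ?u k))" if n: "n = Suc k" for k
  proof -
    let ?a = "s k" and ?b = "s n"
    have a: "?a \<in> carrier G" using s_closed n m by simp
    have br: "?a \<otimes> (?b \<otimes> ?a) = ?b \<otimes> (?a \<otimes> ?b)" using braid[of k] n m by simp
    let ?w = "?a \<otimes> (?b \<otimes> (?b \<otimes> ?a))"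
    have wc: "?w \<in> carrier G" using a sn by simp
    have com: "?w \<otimes> ?b = ?b \<otimes> ?w"
    proof -
      have "?w \<otimes> ?b = ?a \<otimes> (?b \<otimes> (?b \<otimes> (?a \<otimes> ?b)))" using a sn by (simp add: m_assoc)
      also have "\<dots> = ?a \<otimes> (?b \<otimes> (?a \<otimes> (?b \<otimes> ?a)))" by (simp only: br)
      also have "\<dots> = (?a \<otimes> (?b \<otimes> ?a)) \<otimes> (?b \<otimes> ?a)" using a sn by (simp add: m_assoc)
      also have "\<dots> = (?b \<otimes> (?a \<otimes> ?b)) \<otimes> (?b \<otimes> ?a)" by (simp only: br)
      also have "\<dots> = ?b \<otimes> ?w" using a sn by (simp add: m_assoc)
      finally show ?thesis .
    qed
    have "?w \<otimes> (?b \<otimes> ?b) = ?b \<otimes> (?w \<otimes> ?b)" using slide[OF com] wc sn by simp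
    also have "\<dots> = ?b \<otimes> (?b \<otimes> ?w)" by (simp only: com)
    finally have "?a \<otimes> ((?b \<otimes> ?b) \<otimes> (?a \<otimes> (?b \<otimes> ?b))) = (?b \<otimes> ?b) \<otimes> (?a \<otimes> ((?b \<otimes> ?b) \<otimes> ?a))"
      using a sn by (simp add: m_assoc)
    then show ?thesis using n by simp
  qed
qed

lemma (in group) square_past_strand:
  assumes c: "a \<in> carrier G" "b \<in> carrier G" "r \<in> carrier G" "y \<in> carrier G"
    and br: "a \<otimes> (b \<otimes> a) = b \<otimes> (a \<otimes> b)" and ar: "a \<otimes> r = r \<otimes> a" and ry: "r \<otimes> y = b \<otimes> (b \<otimes> r)"
  shows "b \<otimes> r \<otimes> (a \<otimes> (y \<otimes> inv a)) = a \<otimes> (a \<otimes> (b \<otimes> r))"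
proof -
  have "b \<otimes> r \<otimes> (a \<otimes> (y \<otimes> inv a)) = b \<otimes> ((r \<otimes> a) \<otimes> (y \<otimes> inv a))" using c by (simp add: m_assoc)
  also have "\<dots> = b \<otimes> ((a \<otimes> r) \<otimes> (y \<otimes> inv a))" by (simp only: ar)
  also have "\<dots> = b \<otimes> (a \<otimes> ((r \<otimes> y) \<otimes> inv a))" using c by (simp add: m_assoc)
  also have "\<dots> = (b \<otimes> (a \<otimes> b)) \<otimes> (b \<otimes> (r \<otimes> inv a))" unfolding ry using c by (simp add: m_assoc)
  also have "\<dots> = (a \<otimes> (b \<otimes> a)) \<otimes> (b \<otimes> (inv a \<otimes> r))" using comm_inv[OF c(3,1)] ar br by simp
  also have "\<dots> = a \<otimes> ((b \<otimes> (a \<otimes> b)) \<otimes> (inv a \<otimes> r))" using c by (simp add: m_assoc)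
  also have "\<dots> = a \<otimes> ((a \<otimes> (b \<otimes> a)) \<otimes> (inv a \<otimes> r))" by (simp only: br)
  also have "\<dots> = a \<otimes> (a \<otimes> (b \<otimes> r))" using c by (simp add: m_assoc inv_cancel)
  finally show ?thesis .
qed

text \<open>The homomorphism \<open>f\<close> sends type \<open>B\<close> to the braids that fix the marked strand. It is injective
  since the induced action of \<open>f a\<close> on pairs with the marked strand in last position is
  multiplication by \<open>a\<close>. Its image has finite index because the finitely many cosets of the braids
  \<open>r j\<close> are permuted by the generators, as the cocycle prescribes.\<close>

theorem virtually_poly_free_braid_Suc:
  assumes "virtually_poly_free (typeB_group m)"
  shows "virtually_poly_free (braid_group (Suc m))"
proof -
  let ?A = "typeB_group m" and ?Q = "braid_group (Suc m)"
  interpret B: typeB_family ?A m "typeB_gen m" by (rule typeB_family_gen)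
  interpret Q: braid_family ?Q "Suc m" "braid_gen (Suc m)" by (rule braid_family_gen)
  let ?E = "{..Suc m} \<times> carrier ?A"
  let ?P = "BijGroup ?E"
  interpret P: group ?P by (rule group_BijGroup)
  define \<sigma> where "\<sigma> = braid_gen (Suc m)"
  have \<sigma>: "\<sigma> i \<in> carrier ?Q" if "i \<le> m" for i using that Q.s_closed by (simp add: \<sigma>_def)
  obtain f where f: "group_hom ?A ?Q f"
    and f_gen: "\<And>i. i \<le> m \<Longrightarrow> f (typeB_gen m i) = (if i < m then \<sigma> i else \<sigma> m \<otimes>\<^bsub>?Q\<^esub> \<sigma> m)"
    using typeB_group_hom[OF Q.square_last_family[OF HOL.refl]] unfolding \<sigma>_def by blast
  interpret f: group_hom ?A ?Q f by (rule f)
  obtain \<alpha> where \<alpha>: "group_hom ?Q ?P \<alpha>" and \<alpha>_gen: "\<And>i. i < Suc m \<Longrightarrow> \<alpha> (\<sigma> i) = B.coset_perm i"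
    using braid_group_hom[OF B.coset_perm_family] unfolding \<sigma>_def by blast
  interpret \<alpha>: group_hom ?Q ?P \<alpha> by (rule \<alpha>)
  have perm: "B.coset_perm i \<in> carrier ?P" if "i \<le> m" for i using B.coset_perm_Bij that .

  have base_gen: "\<alpha> (f (typeB_gen m i)) (Suc m, b) = (Suc m, typeB_gen m i \<otimes>\<^bsub>?A\<^esub> b)"
    if i: "i \<le> m" and b: "b \<in> carrier ?A" for i b
  proof (cases "i = m")
    case True
    have "\<alpha> (f (typeB_gen m i)) (Suc m, b) = B.coset_perm m (B.coset_perm m (Suc m, b))"
      using True \<sigma>[of m] b perm[of m] by (simp add: f_gen \<alpha>_gen Bij_mult_apply)
    then show ?thesis using True b B.last_closed
      by (simp add: B.coset_perm_apply B.coc_def strand_move_def B.loop_last)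
  next
    case False
    then show ?thesis using i b by (simp add: f_gen \<alpha>_gen B.coset_perm_apply B.coc_def strand_move_def)
  qed
  have base: "\<forall>b\<in>carrier ?A. \<alpha> (f a) (Suc m, b) = (Suc m, a \<otimes>\<^bsub>?A\<^esub> b)"
    if "a \<in> generate ?A (typeB_gen m ` {..m})" for a
    using that
  proof induction
    case one
    then show ?case by (simp add: Bij_one_apply)
  next
    case (incl a)
    then show ?case using base_gen by auto
  next
    case (inv a)
    then obtain i where i: "i \<le> m" "a = typeB_gen m i" by auto
    have a: "a \<in> carrier ?A" using i typeB_gen_closed by simp
    show ?case
    proof
      fix b assume b: "b \<in> carrier ?A"
      let ?y = "(Suc m, inv\<^bsub>?A\<^esub> a \<otimes>\<^bsub>?A\<^esub> b)"
      have y: "?y \<in> ?E" using a b by simp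
      have "\<alpha> (f a) ?y = (Suc m, b)"
        using base_gen[of i "inv\<^bsub>?A\<^esub> a \<otimes>\<^bsub>?A\<^esub> b"] i(1) a b by (simp add: i(2)[symmetric] B.inv_cancel)
      moreover have pc: "\<alpha> (f a) \<in> carrier ?P" using a by simp
      ultimately have "\<alpha> (f (inv\<^bsub>?A\<^esub> a)) (Suc m, b) = (inv\<^bsub>?P\<^esub> \<alpha> (f a)) (\<alpha> (f a) ?y)"
        using a by simp
      also have "\<dots> = (inv\<^bsub>?P\<^esub> \<alpha> (f a) \<otimes>\<^bsub>?P\<^esub> \<alpha> (f a)) ?y"
        by (rule Bij_mult_apply[OF P.inv_closed[OF pc] pc y, symmetric])
      also have "\<dots> = ?y" unfolding P.l_inv[OF pc] by (rule Bij_one_apply[OF y])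
      finally show "\<alpha> (f (inv\<^bsub>?A\<^esub> a)) (Suc m, b) = ?y" .
    qed
  next
    case (eng a a')
    have c: "a \<in> carrier ?A" "a' \<in> carrier ?A" using eng.hyps by (simp_all add: generate_typeB_gen)
    show ?case
    proof
      fix b assume b: "b \<in> carrier ?A"
      have "\<alpha> (f (a \<otimes>\<^bsub>?A\<^esub> a')) (Suc m, b) = \<alpha> (f a) (\<alpha> (f a') (Suc m, b))"
        using c b by (simp add: Bij_mult_apply)
      then show "\<alpha> (f (a \<otimes>\<^bsub>?A\<^esub> a')) (Suc m, b) = (Suc m, a \<otimes>\<^bsub>?A\<^esub> a' \<otimes>\<^bsub>?A\<^esub> b)"
        using eng.IH c b by (simp add: B.m_assoc)
    qed
  qed
  have inj: "inj_on f (carrier ?A)"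
  proof (rule inj_onI)
    fix a a' assume a: "a \<in> carrier ?A" "a' \<in> carrier ?A" "f a = f a'"
    have eval: "\<alpha> (f c) (Suc m, \<one>\<^bsub>?A\<^esub>) = (Suc m, c)" if "c \<in> carrier ?A" for c
      using base[of c] that by (simp add: generate_typeB_gen)
    have "(Suc m, a) = \<alpha> (f a) (Suc m, \<one>\<^bsub>?A\<^esub>)" by (rule eval[OF a(1), symmetric])
    also have "\<dots> = \<alpha> (f a') (Suc m, \<one>\<^bsub>?A\<^esub>)" by (simp only: a(3))
    also have "\<dots> = (Suc m, a')" by (rule eval[OF a(2)])
    finally show "a = a'" by simp
  qed

  define r where "r j = run ?Q \<sigma> j (Suc m - j)" for j
  have r: "r j \<in> carrier ?Q" if "j \<le> Suc m" for j
    using that Q.run_closed'[of j "Suc m - j"] by (simp add: r_def \<sigma>_def)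
  have r_rec: "r j = \<sigma> j \<otimes>\<^bsub>?Q\<^esub> r (Suc j)" if "j \<le> m" for j
    using that by (simp add: r_def Suc_diff_le)
  have r_last: "r (Suc m) = \<one>\<^bsub>?Q\<^esub>" by (simp add: r_def)
  have r_commute: "\<sigma> i \<otimes>\<^bsub>?Q\<^esub> r j = r j \<otimes>\<^bsub>?Q\<^esub> \<sigma> i" if "Suc i < j" "j \<le> Suc m" for i j
    unfolding r_def \<sigma>_def using that Q.s_closed Q.far_commute by (intro Q.run_commute) auto
  \<comment> \<open>The only case of the coset rule that is not a slide of a crossing along a strand: the loop of the
    strand \<open>j\<close> around the marked strand is a conjugate of \<open>(\<sigma> j)\<^sup>2\<close>. Downward induction on \<open>j\<close>.\<close>
  have r_loop: "r (Suc j) \<otimes>\<^bsub>?Q\<^esub> f (B.loop j) = \<sigma> j \<otimes>\<^bsub>?Q\<^esub> r j" if "j \<le> m" for j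
    using that
  proof (induction rule: inc_induct)
    case base
    then show ?case using \<sigma>[of m] by (simp add: B.loop_last f_gen r_last r_rec)
  next
    case (step n)
    let ?a = "\<sigma> n" and ?b = "\<sigma> (Suc n)" and ?r = "r (Suc (Suc n))" and ?y = "f (B.loop (Suc n))"
    have c: "?a \<in> carrier ?Q" "?b \<in> carrier ?Q" "?r \<in> carrier ?Q" "?y \<in> carrier ?Q"
      using step \<sigma> r B.loop_closed by auto
    have com: "?a \<otimes>\<^bsub>?Q\<^esub> ?r = ?r \<otimes>\<^bsub>?Q\<^esub> ?a" using r_commute[of n "Suc (Suc n)"] step by simp
    have br: "?a \<otimes>\<^bsub>?Q\<^esub> (?b \<otimes>\<^bsub>?Q\<^esub> ?a) = ?b \<otimes>\<^bsub>?Q\<^esub> (?a \<otimes>\<^bsub>?Q\<^esub> ?b)"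
      using Q.braid[of n] step by (simp add: \<sigma>_def)
    have rn: "r (Suc n) = ?b \<otimes>\<^bsub>?Q\<^esub> ?r" using r_rec[of "Suc n"] step by simp
    have IH: "?r \<otimes>\<^bsub>?Q\<^esub> ?y = ?b \<otimes>\<^bsub>?Q\<^esub> (?b \<otimes>\<^bsub>?Q\<^esub> ?r)" using step by (simp add: rn)
    have fx: "f (B.loop n) = ?a \<otimes>\<^bsub>?Q\<^esub> (?y \<otimes>\<^bsub>?Q\<^esub> inv\<^bsub>?Q\<^esub> ?a)"
      using step B.s_closed[of n] B.loop_closed[of "Suc n"] c by (simp add: B.loop_rec f_gen Q.m_assoc)
    show ?case unfolding fx rn using Q.square_past_strand[OF c br com IH] r_rec[of n] step by (simp add: rn)
  qed
  have key: "\<sigma> i \<otimes>\<^bsub>?Q\<^esub> r j = r (strand_move i j) \<otimes>\<^bsub>?Q\<^esub> f (B.coc i j)" if i: "i \<le> m" and j: "j \<le> Suc m" for i j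
  proof -
    consider "j = i" | "j = Suc i" | "j < i" | "Suc i < j" by linarith
    then show ?thesis
    proof cases
      case 1
      then show ?thesis using r_loop[OF i] by (simp add: B.coc_def strand_move_def)
    next
      case 2
      then show ?thesis using r_rec[OF i] r[of i] i by (simp add: B.coc_def strand_move_def)
    next
      case 3
      then obtain i' where "i = Suc i'" by (cases i) auto
      then show ?thesis using Q.run_shift[of j i "Suc m - j"] i 3
        by (simp add: B.coc_def strand_move_def f_gen r_def \<sigma>_def)
    next
      case 4
      then show ?thesis using r_commute[of i j] j by (simp add: B.coc_def strand_move_def f_gen)
    qed
  qed
  have fc: "f (B.coc i j) \<in> carrier ?Q" if "i \<le> m" "j \<le> Suc m" for i j
    using B.coc_closed[OF that] by simp
  define M where "M = {r j \<otimes>\<^bsub>?Q\<^esub> f a | j a. j \<le> Suc m \<and> a \<in> carrier ?A}"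
  have MI: "r j \<otimes>\<^bsub>?Q\<^esub> f a \<in> M" if "j \<le> Suc m" "a \<in> carrier ?A" for j a
    using that by (auto simp: M_def)
  have step: "\<sigma> i \<otimes>\<^bsub>?Q\<^esub> z \<in> M \<and> inv\<^bsub>?Q\<^esub> \<sigma> i \<otimes>\<^bsub>?Q\<^esub> z \<in> M" if i: "i \<le> m" and z: "z \<in> M" for i z
  proof -
    obtain j a where ja: "z = r j \<otimes>\<^bsub>?Q\<^esub> f a" "j \<le> Suc m" "a \<in> carrier ?A" using z by (auto simp: M_def)
    let ?j = "strand_move i j"
    have j': "?j \<le> Suc m" by (rule strand_move_le[OF i ja(2)])
    have c: "\<sigma> i \<in> carrier ?Q" "r j \<in> carrier ?Q" "r ?j \<in> carrier ?Q" "f a \<in> carrier ?Q"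
      "B.coc i j \<in> carrier ?A" "B.coc i ?j \<in> carrier ?A"
      using \<sigma> r i ja(2,3) j' B.coc_closed by auto
    have 1: "\<sigma> i \<otimes>\<^bsub>?Q\<^esub> z = r ?j \<otimes>\<^bsub>?Q\<^esub> f (B.coc i j \<otimes>\<^bsub>?A\<^esub> a)"
      using Q.slide[OF key[OF i ja(2)]] c ja by (simp add: Q.m_assoc)
    have 2: "inv\<^bsub>?Q\<^esub> \<sigma> i \<otimes>\<^bsub>?Q\<^esub> z = r ?j \<otimes>\<^bsub>?Q\<^esub> f (inv\<^bsub>?A\<^esub> B.coc i ?j \<otimes>\<^bsub>?A\<^esub> a)"
    proof -
      have "\<sigma> i \<otimes>\<^bsub>?Q\<^esub> (r ?j \<otimes>\<^bsub>?Q\<^esub> f (inv\<^bsub>?A\<^esub> B.coc i ?j \<otimes>\<^bsub>?A\<^esub> a)) =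
          r j \<otimes>\<^bsub>?Q\<^esub> (f (B.coc i ?j) \<otimes>\<^bsub>?Q\<^esub> f (inv\<^bsub>?A\<^esub> B.coc i ?j \<otimes>\<^bsub>?A\<^esub> a))"
        using Q.slide[OF key[OF i j']] c ja by (simp add: strand_move_involution)
      also have "\<dots> = z" using c ja by (simp add: Q.inv_cancel)
      finally show ?thesis using c ja by (metis Q.inv_cancel(1) B.inv_closed B.m_closed Q.m_closed f.hom_closed)
    qed
    show ?thesis unfolding 1 2 using c ja by (intro conjI MI j' B.m_closed B.inv_closed)
  qed
  have "\<forall>z\<in>M. y \<otimes>\<^bsub>?Q\<^esub> z \<in> M" if "y \<in> generate ?Q (braid_gen (Suc m) ` {..<Suc m})" for y
    using that
  proof induction
    case one
    have "z \<in> carrier ?Q" if "z \<in> M" for z using that r by (auto simp: M_def)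
    then show ?case by simp
  next
    case (incl y)
    then show ?case using step by (auto simp: \<sigma>_def less_Suc_eq_le)
  next
    case (inv y)
    then show ?case using step by (auto simp: \<sigma>_def less_Suc_eq_le)
  next
    case (eng y y')
    have "y \<in> carrier ?Q" "y' \<in> carrier ?Q" using eng.hyps by (simp_all add: generate_braid_gen)
    moreover have "z \<in> carrier ?Q" if "z \<in> M" for z using that r by (auto simp: M_def)
    ultimately show ?case using eng.IH by (simp add: Q.m_assoc)
  qed
  moreover have "\<one>\<^bsub>?Q\<^esub> \<in> M" using MI[of "Suc m" "\<one>\<^bsub>?A\<^esub>"] by (simp add: r_last)
  ultimately have all: "y \<in> M" if "y \<in> carrier ?Q" for y
    using that Q.r_one[OF that] unfolding generate_braid_gen by metis
  show ?thesis
  proof (rule virtually_poly_free_finite_index[OF f inj, of "r ` {..Suc m}"])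
    show "\<exists>t\<in>r ` {..Suc m}. \<exists>a\<in>carrier ?A. y = t \<otimes>\<^bsub>?Q\<^esub> f a" if "y \<in> carrier ?Q" for y
      using all[OF that] by (auto simp: M_def)
  qed (use r assms in auto)
qed

text \<open>Each braid group contains with finite index a group of type \<open>B\<close>, which maps onto the braid group
  with one strand less, with free kernel.\<close>

theorem virtually_poly_free_braid_group: "virtually_poly_free (braid_group m)"
proof (induction m)
  case 0
  have "carrier (braid_group 0) = {\<one>\<^bsub>braid_group 0\<^esub>}"
    using generate_braid_gen[of 0] by (simp add: group.generate_empty group_braid_group)
  then show ?case by (rule virtually_poly_free_trivial[OF group_braid_group])
next
  case (Suc m)
  then show ?case by (intro virtually_poly_free_braid_Suc virtually_poly_free_typeB)
qed

section \<open>The annular description of type B\<close>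

lemma (in group) run_intertwine:
  assumes "t \<in> carrier G"
    and "\<And>l. i \<le> l \<Longrightarrow> l < i + k \<Longrightarrow> s l \<in> carrier G \<and> s (Suc l) \<in> carrier G \<and> t \<otimes> s l = s (Suc l) \<otimes> t"
  shows "t \<otimes> run G s i k = run G s (Suc i) k \<otimes> t"
  using assms(2)
proof (induction k arbitrary: i)
  case 0
  then show ?case using assms(1) by simp
next
  case (Suc k)
  have r: "run G s (Suc i) k \<in> carrier G" "run G s (Suc (Suc i)) k \<in> carrier G"
  proof -
    show "run G s (Suc i) k \<in> carrier G" using Suc.prems by (intro run_closed) auto
    have "s l \<in> carrier G" if "Suc (Suc i) \<le> l" "l < Suc (Suc i) + k" for l
      using Suc.prems[of "l - 1"] that by (cases l) auto
    then show "run G s (Suc (Suc i)) k \<in> carrier G" by (rule run_closed)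
  qed
  have i: "s i \<in> carrier G" "s (Suc i) \<in> carrier G" "t \<otimes> s i = s (Suc i) \<otimes> t"
    using Suc.prems[of i] by auto
  have IH: "t \<otimes> run G s (Suc i) k = run G s (Suc (Suc i)) k \<otimes> t" using Suc.prems by (intro Suc.IH) auto
  have "t \<otimes> run G s i (Suc k) = s (Suc i) \<otimes> (t \<otimes> run G s (Suc i) k)"
    using slide[OF i(3)] i assms(1) r by simp
  also have "\<dots> = s (Suc i) \<otimes> (run G s (Suc (Suc i)) k \<otimes> t)" by (simp only: IH)
  also have "\<dots> = run G s (Suc i) (Suc k) \<otimes> t" using i assms(1) r by (simp add: m_assoc)
  finally show ?case .
qed

context braid_family begin

lemma run_all_shift: "Suc i < m \<Longrightarrow> run G s 0 m \<otimes> s i = s (Suc i) \<otimes> run G s 0 m"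
  using run_shift[of 0 "Suc i" m] by simp

text \<open>Type \<open>B\<close> has a second description, as braids in an annulus. There the last generator \<open>y\<close> is
  replaced by the rotation \<open>\<tau> = s 0 \<dots> s (m - 1) y\<close>, and the relations say that \<open>\<tau>\<close> shifts the crossings
  cyclically. This lemma and the next translate the relations that involve \<open>y\<close>, one by one and in
  both directions: one direction serves inside the affine group, the other is used to verify the
  relations for the periodic automorphisms below.\<close>

lemma annular_commute_iff:
  assumes y: "y \<in> carrier G" and i: "Suc i < m"
  shows "(run G s 0 m \<otimes> y) \<otimes> s i = s (Suc i) \<otimes> (run G s 0 m \<otimes> y) \<longleftrightarrow> s i \<otimes> y = y \<otimes> s i"
proof -
  let ?P = "run G s 0 m"
  have c: "?P \<in> carrier G" "s i \<in> carrier G" "s (Suc i) \<in> carrier G"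
    using run_closed'[of 0 m] s_closed i by auto
  have "s (Suc i) \<otimes> (?P \<otimes> y) = ?P \<otimes> (s i \<otimes> y)"
    using slide[OF run_all_shift[OF i, symmetric]] c y by simp
  then show ?thesis using c y by (auto simp: m_assoc)
qed

text \<open>Rotating \<open>s (m - 1)\<close> by one step gives the crossing that closes up the annulus, and rotating once more
  gives \<open>s 0\<close>. Both sides have the form \<open>R' R v\<close>, with \<open>v = u u (s k)\<close> on one side and
  \<open>v = (s k) u u\<close> on the other, where \<open>u = s k y\<close>. Hence the equation says that \<open>s k\<close> commutes with \<open>u\<^sup>2\<close>,
  which is the relation of length four.\<close>

lemma annular_square_iff:
  assumes y: "y \<in> carrier G" and t: "t = run G s 0 m \<otimes> y" and m: "m = Suc k"
    and shift: "\<And>i. Suc i < m \<Longrightarrow> t \<otimes> s i = s (Suc i) \<otimes> t"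
  shows "t \<otimes> (t \<otimes> s k) = s 0 \<otimes> (t \<otimes> t) \<longleftrightarrow> s k \<otimes> (y \<otimes> (s k \<otimes> y)) = y \<otimes> (s k \<otimes> (y \<otimes> s k))"
proof -
  define P where "P = run G s 0 m"
  define R where "R = run G s 0 k"
  define R' where "R' = run G s (Suc 0) k"
  define u where "u = s k \<otimes> y"
  have c: "P \<in> carrier G" "R \<in> carrier G" "R' \<in> carrier G" "s k \<in> carrier G" "s 0 \<in> carrier G"
    using run_closed'[of 0 m] run_closed'[of 0 k] run_closed'[of 1 k] s_closed m
    by (auto simp: P_def R_def R'_def)
  have uc: "u \<in> carrier G" using c y by (simp add: u_def)
  have PR: "P = R \<otimes> s k" using run_snoc[of 0 k s] s_closed m by (simp add: P_def R_def)
  have P0: "P = s 0 \<otimes> R'" using m by (simp add: P_def R'_def)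
  have tR: "t = R \<otimes> u" using c y t PR by (simp add: u_def m_assoc P_def[symmetric])
  have tc: "t \<in> carrier G" using tR c uc by simp
  have h1: "t \<otimes> R = R' \<otimes> t"
    unfolding R_def R'_def using s_closed shift tc m by (intro run_intertwine) auto
  have h2: "P \<otimes> R = R' \<otimes> P"
    unfolding R_def R'_def using s_closed run_all_shift c(1) m unfolding P_def by (intro run_intertwine) auto
  have tt: "t \<otimes> t = R' \<otimes> (R \<otimes> (u \<otimes> u))"
  proof -
    have "t \<otimes> t = t \<otimes> (R \<otimes> u)" by (simp only: tR[symmetric])
    also have "\<dots> = R' \<otimes> (t \<otimes> u)" using slide[OF h1] tc c uc by simp
    finally show ?thesis using c uc by (simp add: tR m_assoc)
  qed
  have "t \<otimes> (t \<otimes> s k) = (R' \<otimes> R) \<otimes> (u \<otimes> (u \<otimes> s k))"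
  proof -
    have "t \<otimes> (t \<otimes> s k) = (t \<otimes> t) \<otimes> s k" using tc c by (simp add: m_assoc)
    then show ?thesis unfolding tt using c uc by (simp add: m_assoc)
  qed
  moreover have "s 0 \<otimes> (t \<otimes> t) = (R' \<otimes> R) \<otimes> (s k \<otimes> (u \<otimes> u))"
  proof -
    have "s 0 \<otimes> (t \<otimes> t) = (s 0 \<otimes> R') \<otimes> (R \<otimes> (u \<otimes> u))" unfolding tt using c uc by (simp add: m_assoc)
    also have "\<dots> = P \<otimes> (R \<otimes> (u \<otimes> u))" by (simp only: P0)
    also have "\<dots> = R' \<otimes> (P \<otimes> (u \<otimes> u))" using slide[OF h2] c uc by simp
    finally show ?thesis using c uc by (simp add: PR m_assoc)
  qed
  ultimately have "t \<otimes> (t \<otimes> s k) = s 0 \<otimes> (t \<otimes> t) \<longleftrightarrow> u \<otimes> (u \<otimes> s k) = s k \<otimes> (u \<otimes> u)"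
    using c uc by simp
  also have "\<dots> \<longleftrightarrow> y \<otimes> (s k \<otimes> (y \<otimes> s k)) = s k \<otimes> (y \<otimes> (s k \<otimes> y))"
    using c y by (simp add: u_def m_assoc)
  finally show ?thesis by auto
qed

lemma typeB_of_annular:
  assumes t: "t \<in> carrier G" and shift: "\<And>i. Suc i < m \<Longrightarrow> t \<otimes> s i = s (Suc i) \<otimes> t"
    and square: "\<And>k. m = Suc k \<Longrightarrow> t \<otimes> (t \<otimes> s k) = s 0 \<otimes> (t \<otimes> t)"
  shows "typeB_family G m (\<lambda>i. if i < m then s i else inv (run G s 0 m) \<otimes> t)"
proof
  let ?P = "run G s 0 m"
  let ?y = "inv ?P \<otimes> t"
  let ?f = "\<lambda>i. if i < m then s i else ?y"
  have P: "?P \<in> carrier G" by (simp add: run_closed')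
  have y: "?y \<in> carrier G" using P t by simp
  have ty: "t = ?P \<otimes> ?y" using P t by (simp add: inv_cancel)
  show "?f m \<in> carrier G" using y by simp
  show "?f i \<in> carrier G" if "i < m" for i using that s_closed by simp
  show "?f i \<otimes> (?f (Suc i) \<otimes> ?f i) = ?f (Suc i) \<otimes> (?f i \<otimes> ?f (Suc i))" if "Suc i < m" for i
    using that braid[of i] by simp
  show "?f i \<otimes> ?f j = ?f j \<otimes> ?f i" if "Suc i < j" "j < m" for i j
    using that far_commute[of i j] by simp
  show "?f i \<otimes> ?f m = ?f m \<otimes> ?f i" if i: "Suc i < m" for i
  proof -
    have "s i \<otimes> ?y = ?y \<otimes> s i"
      using annular_commute_iff[OF y i] shift[OF i] unfolding ty[symmetric] by blast
    then show ?thesis using i by simp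
  qed
  show "?f k \<otimes> (?f m \<otimes> (?f k \<otimes> ?f m)) = ?f m \<otimes> (?f k \<otimes> (?f m \<otimes> ?f k))" if m: "m = Suc k" for k
  proof -
    have "s k \<otimes> (?y \<otimes> (s k \<otimes> ?y)) = ?y \<otimes> (s k \<otimes> (?y \<otimes> s k))"
      using annular_square_iff[OF y ty m shift] square[OF m] by blast
    moreover have "k < m" using m by simp
    ultimately show ?thesis by simp
  qed
qed

end

context typeB_family begin

definition tau where "tau = run G s 0 (Suc m)"

lemma tau_eq: "tau = run G s 0 m \<otimes> s m"
  unfolding tau_def using run_snoc[of 0 m s] gen_closed by simp

lemma tau_closed: "tau \<in> carrier G"
  unfolding tau_eq by (simp add: run_closed' last_closed)

lemma tau_shift: "Suc i < m \<Longrightarrow> tau \<otimes> s i = s (Suc i) \<otimes> tau"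
  unfolding tau_eq using annular_commute_iff[OF last_closed] last_commute by blast

lemma tau_square: "m = Suc k \<Longrightarrow> tau \<otimes> (tau \<otimes> s k) = s 0 \<otimes> (tau \<otimes> tau)"
  using annular_square_iff[OF last_closed tau_eq _ tau_shift] last_four by blast

end

section \<open>Conjugation\<close>

definition conj_by :: "('a, 'x) monoid_scheme \<Rightarrow> 'a \<Rightarrow> 'a \<Rightarrow> 'a"
  where "conj_by G t y = t \<otimes>\<^bsub>G\<^esub> y \<otimes>\<^bsub>G\<^esub> inv\<^bsub>G\<^esub> t"

context group begin

lemma conj_by_closed: "t \<in> carrier G \<Longrightarrow> y \<in> carrier G \<Longrightarrow> conj_by G t y \<in> carrier G"
  by (simp add: conj_by_def)

lemma conj_by_mult:
  "t \<in> carrier G \<Longrightarrow> x \<in> carrier G \<Longrightarrow> y \<in> carrier G \<Longrightarrow>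
    conj_by G t (x \<otimes> y) = conj_by G t x \<otimes> conj_by G t y"
  by (simp add: conj_by_def m_assoc inv_cancel)

lemma conj_by_inv:
  "t \<in> carrier G \<Longrightarrow> x \<in> carrier G \<Longrightarrow> conj_by G t (inv x) = inv (conj_by G t x)"
  by (simp add: conj_by_def m_assoc inv_mult_group)

lemma conj_by_comp:
  "t \<in> carrier G \<Longrightarrow> u \<in> carrier G \<Longrightarrow> x \<in> carrier G \<Longrightarrow>
    conj_by G t (conj_by G u x) = conj_by G (t \<otimes> u) x"
  by (simp add: conj_by_def m_assoc inv_mult_group)

lemma conj_by_one: "x \<in> carrier G \<Longrightarrow> conj_by G \<one> x = x"
  by (simp add: conj_by_def)

lemma conj_by_eqI:
  "t \<in> carrier G \<Longrightarrow> x \<in> carrier G \<Longrightarrow> y \<in> carrier G \<Longrightarrow> t \<otimes> x = y \<otimes> t \<Longrightarrow> conj_by G t x = y"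
  unfolding conj_by_def by (rule conj_eqI(1))

end

section \<open>The relations of affine type B\<close>

text \<open>The generators \<open>s 0, \<dots>, s m\<close> are \<open>s\<^sub>1, \<dots>, s\<^sub>n\<close> of the diagram, so \<open>n = m + 1\<close>, and \<open>z\<close> is \<open>s\<^sub>0\<close>, the twin
  of \<open>s 0\<close>.\<close>

locale affineB_family = typeB_family +
  fixes z
  assumes m_ge: "2 \<le> m" and z_closed: "z \<in> carrier G"
    and z_commute: "i \<le> m \<Longrightarrow> i \<noteq> Suc 0 \<Longrightarrow> z \<otimes> s i = s i \<otimes> z"
    and z_braid: "z \<otimes> (s (Suc 0) \<otimes> z) = s (Suc 0) \<otimes> (z \<otimes> s (Suc 0))"
begin

lemma c01: "s 0 \<in> carrier G" "s (Suc 0) \<in> carrier G"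
  using m_ge s_closed by auto

text \<open>The rotation spreads \<open>s 0\<close> to crossings \<open>pgen k\<close> for all integers \<open>k\<close>, periodic with period \<open>m + 1\<close>,
  and the difference of the twins to elements \<open>kgen k\<close>, which will form a basis of the kernel.\<close>

definition pgen :: "int \<Rightarrow> 'a" where "pgen k = conj_by G (tau [^] k) (s 0)"

definition kgen :: "int \<Rightarrow> 'a" where "kgen k = conj_by G (tau [^] k) (z \<otimes> inv (s 0))"

lemma pgen_closed: "pgen k \<in> carrier G" and kgen_closed: "kgen k \<in> carrier G"
  using tau_closed c01 z_closed by (simp_all add: pgen_def kgen_def conj_by_closed)

lemma pgen_add: "conj_by G (tau [^] j) (pgen k) = pgen (j + k)"
  and kgen_add: "conj_by G (tau [^] j) (kgen k) = kgen (j + k)"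
  using tau_closed c01 z_closed
  by (simp_all add: pgen_def kgen_def conj_by_comp int_pow_mult)

lemma tau_one: "tau [^] (1::int) = tau"
  using tau_closed by (simp add: int_pow_1)

lemma kgen_zero: "kgen 0 = z \<otimes> inv (s 0)"
  using c01 z_closed by (simp add: kgen_def conj_by_one)

lemma pgen_nat: "i < m \<Longrightarrow> pgen (int i) = s i"
proof (induction i)
  case 0
  then show ?case using c01 by (simp add: pgen_def conj_by_one)
next
  case (Suc i)
  have "pgen (int (Suc i)) = conj_by G tau (s i)"
    using pgen_add[of 1 "int i"] Suc by (simp add: tau_one add.commute)
  also have "\<dots> = s (Suc i)"
    using Suc s_closed tau_closed by (intro conj_by_eqI tau_shift) auto
  finally show ?case .
qed

lemma pgen_period1: "pgen (k + (int m + 1)) = pgen k"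
proof -
  obtain j where j: "m = Suc j" using m_ge by (cases m) auto
  have sj: "s j \<in> carrier G" using s_closed j by simp
  have "tau [^] (2::int) = tau \<otimes> tau"
    using int_pow_mult[OF tau_closed, of 1 1] tau_closed by (simp add: int_pow_1)
  moreover have "conj_by G (tau \<otimes> tau) (s j) = s 0"
    using tau_square[OF j] tau_closed c01 sj by (intro conj_by_eqI) (simp_all add: m_assoc)
  ultimately have "pgen (int m + 1) = s 0"
    using pgen_add[of 2 "int j"] pgen_nat[of j] j by (simp add: add.commute)
  also have "\<dots> = pgen 0" using pgen_nat[of 0] m_ge by simp
  finally show ?thesis using pgen_add[of k "int m + 1"] pgen_add[of k 0] by simp
qed

lemma pgen_cong: "k mod (int m + 1) = l mod (int m + 1) \<Longrightarrow> pgen k = pgen l"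
proof -
  have step: "pgen (k + q * (int m + 1)) = pgen k" for k q
  proof (induction q rule: int_induct[where k = 0])
    case (step1 i)
    then show ?case using pgen_period1[of "k + i * (int m + 1)"] by (simp add: algebra_simps)
  next
    case (step2 i)
    then show ?case using pgen_period1[of "k + (i - 1) * (int m + 1)"] by (simp add: algebra_simps)
  qed simp
  have r: "pgen k = pgen (k mod (int m + 1))" for k
    using step[of "k mod (int m + 1)" "k div (int m + 1)"] unfolding mod_div_mult_eq .
  show "k mod (int m + 1) = l mod (int m + 1) \<Longrightarrow> pgen k = pgen l" using r[of k] r[of l] by simp
qed

text \<open>All letters of \<open>tau\<close> after the first two commute with \<open>z\<close>, so the conjugate of \<open>z\<close> by \<open>tau\<close>
  can be computed from the braid relation between \<open>z\<close> and \<open>s 1\<close>.\<close>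

lemma kgen_one: "kgen 1 = inv (kgen 0) \<otimes> (s (Suc 0) \<otimes> (kgen 0 \<otimes> inv (s (Suc 0))))"
proof -
  let ?a = "s 0" and ?b = "s (Suc 0)"
  define W where "W = run G s 2 (m - 1)"
  have Wc: "W \<in> carrier G" unfolding W_def using gen_closed m_ge by (intro run_closed) auto
  have zW: "z \<otimes> W = W \<otimes> z" unfolding W_def using z_closed gen_closed z_commute m_ge
    by (intro run_commute) auto
  have "Suc m = Suc (Suc (m - 1))" using m_ge by simp
  then have tau: "tau = ?a \<otimes> (?b \<otimes> W)" unfolding tau_def W_def by (simp only: run.simps numeral_2_eq_2)
  have "conj_by G tau z = conj_by G (?a \<otimes> ?b) z"
  proof -
    have "conj_by G W z = z" using zW Wc z_closed by (intro conj_by_eqI) auto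
    moreover have "tau = (?a \<otimes> ?b) \<otimes> W" using tau c01 Wc by (simp add: m_assoc)
    ultimately show ?thesis using conj_by_comp[of "?a \<otimes> ?b" W z] c01 Wc z_closed by simp
  qed
  also have "\<dots> = conj_by G ?a (conj_by G ?b z)" using c01 z_closed by (simp add: conj_by_comp)
  also have "conj_by G ?b z = inv z \<otimes> ?b \<otimes> z"
  proof (rule conj_by_eqI)
    have "inv z \<otimes> ?b \<otimes> z \<otimes> ?b = inv z \<otimes> (?b \<otimes> (z \<otimes> ?b))" using c01 z_closed by (simp add: m_assoc)
    also have "\<dots> = inv z \<otimes> (z \<otimes> (?b \<otimes> z))" by (simp only: z_braid)
    also have "\<dots> = ?b \<otimes> z" using c01 z_closed by (simp add: inv_cancel)
    finally show "?b \<otimes> z = inv z \<otimes> ?b \<otimes> z \<otimes> ?b" by simp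
  qed (use c01 z_closed in auto)
  finally have tz: "conj_by G tau z = ?a \<otimes> (inv z \<otimes> ?b \<otimes> z) \<otimes> inv ?a" by (simp add: conj_by_def)
  have ts: "conj_by G tau ?a = ?b"
    using tau_shift[of 0] tau_closed c01 m_ge by (intro conj_by_eqI) auto
  have "kgen 1 = conj_by G tau z \<otimes> inv (conj_by G tau ?a)"
    using kgen_add[of 1 0] tau_closed z_closed c01 by (simp add: tau_one kgen_zero conj_by_mult conj_by_inv)
  then show ?thesis unfolding tz ts kgen_zero using c01 z_closed by (simp add: m_assoc inv_mult_group)
qed

text \<open>With \<open>kgen j = e j e (j + 1)\<close> for involutions \<open>e j\<close>, conjugation by the crossing \<open>k\<close> takes \<open>e k\<close>
  to \<open>e (k + 1)\<close>, and \<open>e (k + 1)\<close> to the conjugate of \<open>e k\<close> by \<open>e (k + 1)\<close>. This rule predicts the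
  formulas in this and the next lemmas.\<close>

lemma kgen_rel_down: "s (Suc 0) \<otimes> kgen 0 = kgen 0 \<otimes> (kgen 1 \<otimes> s (Suc 0))"
  using kgen_closed[of 0] c01 unfolding kgen_one by (simp add: m_assoc inv_cancel)

lemma kgen_rel_same: "s 0 \<otimes> kgen 0 = kgen 0 \<otimes> s 0"
proof -
  have com: "z \<otimes> s 0 = s 0 \<otimes> z" using z_commute[of 0] by simp
  have "s 0 \<otimes> kgen 0 = (s 0 \<otimes> z) \<otimes> inv (s 0)" using c01 z_closed by (simp add: kgen_zero m_assoc)
  also have "\<dots> = (z \<otimes> s 0) \<otimes> inv (s 0)" by (simp only: com)
  also have "\<dots> = kgen 0 \<otimes> s 0" using c01 z_closed by (simp add: kgen_zero m_assoc)
  finally show ?thesis .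
qed

lemma kgen_rel_up: "s 0 \<otimes> kgen 1 = inv (kgen 0) \<otimes> (kgen 1 \<otimes> s 0)"
proof -
  let ?a = "s 0" and ?b = "s (Suc 0)" and ?c = "kgen 0"
  note cl = c01 z_closed kgen_closed[of 0]
  have br: "?a \<otimes> (?b \<otimes> ?a) = ?b \<otimes> (?a \<otimes> ?b)" using braid[of 0] m_ge by simp
  have com: "?a \<otimes> inv ?c = inv ?c \<otimes> ?a" using comm_inv[OF c01(1) kgen_closed kgen_rel_same] .
  have ca: "?c \<otimes> ?a = z" using cl by (simp add: kgen_zero m_assoc)
  have zb: "?b \<otimes> (z \<otimes> (?b \<otimes> inv z)) = z \<otimes> ?b"
  proof -
    have "?b \<otimes> (z \<otimes> (?b \<otimes> inv z)) = (?b \<otimes> (z \<otimes> ?b)) \<otimes> inv z" using cl by (simp add: m_assoc)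
    also have "\<dots> = (z \<otimes> (?b \<otimes> z)) \<otimes> inv z" by (simp only: z_braid)
    finally show ?thesis using cl by (simp add: m_assoc)
  qed
  \<comment> \<open>The assertion multiplied on the left by the square of \<open>kgen 0\<close>, with \<open>kgen_one\<close> inserted.\<close>
  have key: "?c \<otimes> (?a \<otimes> (?b \<otimes> (?c \<otimes> inv ?b))) = ?b \<otimes> (?c \<otimes> (inv ?b \<otimes> ?a))"
  proof -
    have bab: "inv ?b \<otimes> (?a \<otimes> ?b) = ?a \<otimes> (?b \<otimes> inv ?a)"
    proof -
      have "inv ?b \<otimes> (?a \<otimes> ?b) = inv ?b \<otimes> ((?a \<otimes> (?b \<otimes> ?a)) \<otimes> inv ?a)" using cl by (simp add: m_assoc)
      also have "\<dots> = inv ?b \<otimes> ((?b \<otimes> (?a \<otimes> ?b)) \<otimes> inv ?a)" by (simp only: br)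
      also have "\<dots> = ?a \<otimes> (?b \<otimes> inv ?a)" using cl by (simp add: m_assoc inv_cancel)
      finally show ?thesis .
    qed
    have "?b \<otimes> (?c \<otimes> (inv ?b \<otimes> ?a)) \<otimes> ?b = ?b \<otimes> (?c \<otimes> (inv ?b \<otimes> (?a \<otimes> ?b)))" using cl by (simp add: m_assoc)
    also have "\<dots> = ?b \<otimes> (?c \<otimes> (?a \<otimes> (?b \<otimes> inv ?a)))" by (simp only: bab)
    also have "\<dots> = ?b \<otimes> ((?c \<otimes> ?a) \<otimes> (?b \<otimes> inv ?a))" using cl by (simp add: m_assoc)
    also have "\<dots> = ?b \<otimes> (z \<otimes> (?b \<otimes> inv ?a))" by (simp only: ca)
    also have "\<dots> = (?b \<otimes> (z \<otimes> (?b \<otimes> inv z))) \<otimes> (z \<otimes> inv ?a)" using cl by (simp add: m_assoc inv_cancel)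
    also have "\<dots> = (z \<otimes> ?b) \<otimes> ?c" by (simp only: zb kgen_zero)
    also have "\<dots> = (?c \<otimes> ?a) \<otimes> (?b \<otimes> ?c)" using cl by (simp add: ca m_assoc)
    also have "\<dots> = ?c \<otimes> (?a \<otimes> (?b \<otimes> (?c \<otimes> inv ?b))) \<otimes> ?b" using cl by (simp add: m_assoc)
    finally show ?thesis using cl by (simp add: m_closed)
  qed
  have "?a \<otimes> kgen 1 = (?a \<otimes> inv ?c) \<otimes> (?b \<otimes> (?c \<otimes> inv ?b))" unfolding kgen_one using cl by (simp add: m_assoc)
  also have "\<dots> = inv ?c \<otimes> (?a \<otimes> (?b \<otimes> (?c \<otimes> inv ?b)))" unfolding com using cl by (simp add: m_assoc)
  also have "\<dots> = inv ?c \<otimes> (inv ?c \<otimes> (?c \<otimes> (?a \<otimes> (?b \<otimes> (?c \<otimes> inv ?b)))))" using cl by (simp add: inv_cancel)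
  also have "\<dots> = inv ?c \<otimes> (inv ?c \<otimes> (?b \<otimes> (?c \<otimes> (inv ?b \<otimes> ?a))))" by (simp only: key)
  also have "\<dots> = inv ?c \<otimes> (kgen 1 \<otimes> ?a)" unfolding kgen_one using cl by (simp add: m_assoc)
  finally show ?thesis .
qed

lemma kgen_rel_far: "2 \<le> i \<Longrightarrow> i < m \<Longrightarrow> s i \<otimes> kgen 0 = kgen 0 \<otimes> s i"
proof -
  assume i: "2 \<le> i" "i < m"
  have si: "s i \<in> carrier G" using s_closed i by simp
  have "s i \<otimes> inv (s 0) = inv (s 0) \<otimes> s i" using commute[of i 0] i si c01 by (intro comm_inv) auto
  moreover have "z \<otimes> s i = s i \<otimes> z" using z_commute[of i] i by simp
  ultimately show ?thesis unfolding kgen_zero using si c01 z_closed by (metis inv_closed m_assoc)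
qed

end

lemma mod_shift_one:
  fixes a N :: int
  assumes "2 \<le> N"
  shows "(a - 1) mod N = (if a mod N = 0 then N - 1 else a mod N - 1)"
    and "(a + 1) mod N = (if a mod N = N - 1 then 0 else a mod N + 1)"
proof -
  have r: "0 \<le> a mod N" "a mod N < N" using assms by simp_all
  show "(a - 1) mod N = (if a mod N = 0 then N - 1 else a mod N - 1)"
  proof -
    have "(a - 1) mod N = (a mod N - 1) mod N" by (simp add: mod_diff_left_eq)
    also have "\<dots> = (if a mod N = 0 then N - 1 else a mod N - 1)"
    proof (cases "a mod N = 0")
      case True
      then show ?thesis using assms by (simp add: zmod_minus1)
    next
      case False
      then have "0 \<le> a mod N - 1" "a mod N - 1 < N" using r by linarith+
      then show ?thesis using False by (simp only: mod_pos_pos_trivial if_False)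
    qed
    finally show ?thesis .
  qed
  show "(a + 1) mod N = (if a mod N = N - 1 then 0 else a mod N + 1)"
  proof -
    have "(a + 1) mod N = (a mod N + 1) mod N" by (simp add: mod_add_left_eq)
    also have "\<dots> = (if a mod N = N - 1 then 0 else a mod N + 1)"
    proof (cases "a mod N = N - 1")
      case False
      then have "0 \<le> a mod N + 1" "a mod N + 1 < N" using r by linarith+
      then show ?thesis using False by (simp only: mod_pos_pos_trivial if_False)
    qed simp
    finally show ?thesis .
  qed
qed

context affineB_family begin

text \<open>By periodicity the crossings \<open>1\<close>, \<open>m\<close> (which is \<open>- 1\<close>), \<open>0\<close> and those from \<open>2\<close> to \<open>m - 1\<close> represent all cases.
  The case \<open>- 1\<close> is \<open>kgen_rel_up\<close> rotated back by one step.\<close>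

lemma kgen_rel_zero:
  shows "k mod (int m + 1) = 1 \<Longrightarrow> pgen k \<otimes> kgen 0 = kgen 0 \<otimes> (kgen 1 \<otimes> pgen k)"
    and "k mod (int m + 1) = int m \<Longrightarrow> pgen k \<otimes> kgen 0 = inv (kgen (- 1)) \<otimes> (kgen 0 \<otimes> pgen k)"
    and "k mod (int m + 1) \<noteq> 1 \<Longrightarrow> k mod (int m + 1) \<noteq> int m \<Longrightarrow> pgen k \<otimes> kgen 0 = kgen 0 \<otimes> pgen k"
proof -
  let ?N = "int m + 1"
  show "pgen k \<otimes> kgen 0 = kgen 0 \<otimes> (kgen 1 \<otimes> pgen k)" if "k mod ?N = 1"
  proof -
    have "pgen k = s (Suc 0)" using pgen_cong[of k 1] pgen_nat[of "Suc 0"] that m_ge by simp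
    then show ?thesis using kgen_rel_down by simp
  qed
  show "pgen k \<otimes> kgen 0 = inv (kgen (- 1)) \<otimes> (kgen 0 \<otimes> pgen k)" if "k mod ?N = int m"
  proof -
    have k: "pgen k = pgen (- 1)" using pgen_cong[of k "- 1"] that m_ge by (simp add: zmod_minus1)
    have s0: "pgen 0 = s 0" using pgen_nat[of 0] m_ge by simp
    have t: "tau [^] (- 1 :: int) \<in> carrier G" using tau_closed by simp
    have "conj_by G (tau [^] (- 1 :: int)) (pgen 0 \<otimes> kgen 1) = pgen (- 1) \<otimes> kgen 0"
      using t pgen_closed kgen_closed by (simp add: conj_by_mult pgen_add kgen_add)
    moreover have "conj_by G (tau [^] (- 1 :: int)) (inv (kgen 0) \<otimes> (kgen 1 \<otimes> pgen 0)) =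
        inv (kgen (- 1)) \<otimes> (kgen 0 \<otimes> pgen (- 1))"
      using t pgen_closed kgen_closed by (simp add: conj_by_mult conj_by_inv pgen_add kgen_add)
    moreover have "pgen 0 \<otimes> kgen 1 = inv (kgen 0) \<otimes> (kgen 1 \<otimes> pgen 0)" using kgen_rel_up s0 by simp
    ultimately show ?thesis unfolding k by simp
  qed
  show "pgen k \<otimes> kgen 0 = kgen 0 \<otimes> pgen k" if k: "k mod ?N \<noteq> 1" "k mod ?N \<noteq> int m"
  proof -
    define i where "i = nat (k mod ?N)"
    have "0 \<le> k mod ?N" "k mod ?N < ?N" using pos_mod_bound[of ?N k] by simp_all
    then have "k mod ?N < int m" using k by linarith
    then have i: "k mod ?N = int i" "i < m" "i \<noteq> 1" using k by (auto simp: i_def nat_less_iff)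
    have ki: "pgen k = s i" using pgen_cong[of k "int i"] pgen_nat[OF i(2)] i by simp
    show ?thesis
    proof (cases "i = 0")
      case True
      then show ?thesis using kgen_rel_same ki by simp
    next
      case False
      then show ?thesis using kgen_rel_far[of i] ki i by simp
    qed
  qed
qed

text \<open>The general case is the previous lemma conjugated by a power of the rotation.\<close>

lemma kgen_rel:
  shows "(k - j) mod (int m + 1) = 1 \<Longrightarrow> pgen k \<otimes> kgen j = kgen j \<otimes> (kgen (j + 1) \<otimes> pgen k)"
    and "(k - j) mod (int m + 1) = int m \<Longrightarrow> pgen k \<otimes> kgen j = inv (kgen (j - 1)) \<otimes> (kgen j \<otimes> pgen k)"
    and "(k - j) mod (int m + 1) \<noteq> 1 \<Longrightarrow> (k - j) mod (int m + 1) \<noteq> int m \<Longrightarrow> pgen k \<otimes> kgen j = kgen j \<otimes> pgen k"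
proof -
  have t: "tau [^] j \<in> carrier G" using tau_closed by simp
  have l: "conj_by G (tau [^] j) (pgen (k - j) \<otimes> kgen 0) = pgen k \<otimes> kgen j"
    using t pgen_closed kgen_closed by (simp add: conj_by_mult pgen_add kgen_add)
  have r: "conj_by G (tau [^] j) (kgen 0 \<otimes> (kgen 1 \<otimes> pgen (k - j))) = kgen j \<otimes> (kgen (j + 1) \<otimes> pgen k)"
    "conj_by G (tau [^] j) (inv (kgen (- 1)) \<otimes> (kgen 0 \<otimes> pgen (k - j))) = inv (kgen (j - 1)) \<otimes> (kgen j \<otimes> pgen k)"
    "conj_by G (tau [^] j) (kgen 0 \<otimes> pgen (k - j)) = kgen j \<otimes> pgen k"
    using t pgen_closed kgen_closed by (simp_all add: conj_by_mult conj_by_inv pgen_add kgen_add)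
  show "(k - j) mod (int m + 1) = 1 \<Longrightarrow> pgen k \<otimes> kgen j = kgen j \<otimes> (kgen (j + 1) \<otimes> pgen k)"
    using kgen_rel_zero(1)[of "k - j"] l r(1) by simp
  show "(k - j) mod (int m + 1) = int m \<Longrightarrow> pgen k \<otimes> kgen j = inv (kgen (j - 1)) \<otimes> (kgen j \<otimes> pgen k)"
    using kgen_rel_zero(2)[of "k - j"] l r(2) by simp
  show "(k - j) mod (int m + 1) \<noteq> 1 \<Longrightarrow> (k - j) mod (int m + 1) \<noteq> int m \<Longrightarrow> pgen k \<otimes> kgen j = kgen j \<otimes> pgen k"
    using kgen_rel_zero(3)[of "k - j"] l r(3) by simp
qed

text \<open>The conjugate by the inverse of the crossing is found from \<open>kgen_rel\<close> because the neighbour of \<open>kgen j\<close>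
  that occurs there commutes with the crossing.\<close>

lemma kgen_conj_in_generate:
  assumes "i < m"
  shows "s i \<otimes> kgen j \<otimes> inv (s i) \<in> generate G (range kgen)"
    and "inv (s i) \<otimes> kgen j \<otimes> s i \<in> generate G (range kgen)"
proof -
  let ?K = "generate G (range kgen)" and ?N = "int m + 1"
  have sub: "subgroup ?K G" using kgen_closed by (intro generate_is_subgroup) auto
  interpret K: subgroup ?K G by (rule sub)
  have bK: "kgen j \<in> ?K" for j by (rule generate.incl) simp
  have S: "pgen (int i) = s i" by (rule pgen_nat[OF assms])
  have sc: "s i \<in> carrier G" using s_closed assms by simp
  note cl = kgen_closed sc
  have N: "2 \<le> ?N" using m_ge by simp
  let ?r = "(int i - j) mod ?N"
  have "\<exists>c\<in>?K. s i \<otimes> kgen j = c \<otimes> s i"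
  proof -
    consider "?r = 1" | "?r = int m" | "?r \<noteq> 1" "?r \<noteq> int m" by blast
    then show ?thesis
    proof cases
      case 1
      then show ?thesis using kgen_rel(1)[of "int i" j] cl bK
        by (intro bexI[of _ "kgen j \<otimes> kgen (j + 1)"]) (simp_all add: S m_assoc)
    next
      case 2
      then show ?thesis using kgen_rel(2)[of "int i" j] cl bK
        by (intro bexI[of _ "inv (kgen (j - 1)) \<otimes> kgen j"]) (simp_all add: S m_assoc)
    next
      case 3
      then show ?thesis using kgen_rel(3)[of "int i" j] bK by (intro bexI[of _ "kgen j"]) (simp_all add: S)
    qed
  qed
  then show "s i \<otimes> kgen j \<otimes> inv (s i) \<in> ?K" using conj_memI(1)[OF sub sc kgen_closed] by blast
  have "\<exists>d\<in>?K. s i \<otimes> d = kgen j \<otimes> s i"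
  proof -
    consider "?r = 1" | "?r = int m" | "?r \<noteq> 1" "?r \<noteq> int m" by blast
    then show ?thesis
    proof cases
      case 1
      have "(int i - (j + 1)) mod ?N = 0" using mod_shift_one(1)[OF N, of "int i - j"] 1 by (simp add: algebra_simps)
      then have "s i \<otimes> kgen (j + 1) = kgen (j + 1) \<otimes> s i" using kgen_rel(3)[of "int i" "j + 1"] m_ge by (simp add: S)
      then have com: "s i \<otimes> inv (kgen (j + 1)) = inv (kgen (j + 1)) \<otimes> s i" by (rule comm_inv[OF sc kgen_closed])
      have "s i \<otimes> (kgen j \<otimes> inv (kgen (j + 1))) = kgen j \<otimes> (kgen (j + 1) \<otimes> (s i \<otimes> inv (kgen (j + 1))))"
        using kgen_rel(1)[of "int i" j] 1 cl by (simp add: S m_assoc[symmetric])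
      also have "\<dots> = kgen j \<otimes> (kgen (j + 1) \<otimes> (inv (kgen (j + 1)) \<otimes> s i))" by (simp only: com)
      also have "\<dots> = kgen j \<otimes> s i" using cl by (simp add: inv_cancel)
      finally show ?thesis using bK by (intro bexI[of _ "kgen j \<otimes> inv (kgen (j + 1))"]) simp_all
    next
      case 2
      have "(int i - (j - 1)) mod ?N = 0" using mod_shift_one(2)[OF N, of "int i - j"] 2 by (simp add: algebra_simps)
      then have com: "s i \<otimes> kgen (j - 1) = kgen (j - 1) \<otimes> s i" using kgen_rel(3)[of "int i" "j - 1"] m_ge by (simp add: S)
      have "s i \<otimes> (kgen (j - 1) \<otimes> kgen j) = kgen (j - 1) \<otimes> (s i \<otimes> kgen j)" using slide[OF com] cl by simp
      also have "\<dots> = kgen j \<otimes> s i" using kgen_rel(2)[of "int i" j] 2 cl by (simp add: S inv_cancel)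
      finally show ?thesis using bK by (intro bexI[of _ "kgen (j - 1) \<otimes> kgen j"]) simp_all
    next
      case 3
      then show ?thesis using kgen_rel(3)[of "int i" j] bK by (intro bexI[of _ "kgen j"]) (simp_all add: S)
    qed
  qed
  then show "inv (s i) \<otimes> kgen j \<otimes> s i \<in> ?K" using conj_memI(2)[OF sub sc kgen_closed] by blast
qed

lemma kgen_conj_tau:
  "tau \<otimes> kgen j \<otimes> inv tau = kgen (j + 1)" "inv tau \<otimes> kgen j \<otimes> tau = kgen (j - 1)"
proof -
  show "tau \<otimes> kgen j \<otimes> inv tau = kgen (j + 1)"
    using kgen_add[of 1 j] by (simp add: tau_one conj_by_def add.commute)
  have "tau [^] (- 1 :: int) = inv tau" using int_pow_neg[OF tau_closed, of 1] by (simp add: tau_one)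
  then show "inv tau \<otimes> kgen j \<otimes> tau = kgen (j - 1)"
    using kgen_add[of "- 1" j] tau_closed by (simp add: conj_by_def)
qed

end

section \<open>The periodic action on a free group of infinite rank\<close>

text \<open>
  The same formulas define an action on the free group with basis indexed by the integers: \<open>per_aut N k\<close> stands
  for the crossing \<open>k\<close>, in an annulus with \<open>N\<close> strands, and \<open>shift_aut\<close> for the rotation.
\<close>

definition per_img :: "int \<Rightarrow> int \<Rightarrow> int \<Rightarrow> int gword set"
  where "per_img N k j =
    (if (k - j) mod N = 1 then free_gen UNIV j \<otimes>\<^bsub>free_group UNIV\<^esub> free_gen UNIV (j + 1)
     else if (k - j) mod N = N - 1 then inv\<^bsub>free_group UNIV\<^esub> free_gen UNIV (j - 1) \<otimes>\<^bsub>free_group UNIV\<^esub> free_gen UNIV j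
     else free_gen UNIV j)"

definition per_img_inv :: "int \<Rightarrow> int \<Rightarrow> int \<Rightarrow> int gword set"
  where "per_img_inv N k j =
    (if (k - j) mod N = 1 then free_gen UNIV j \<otimes>\<^bsub>free_group UNIV\<^esub> inv\<^bsub>free_group UNIV\<^esub> free_gen UNIV (j + 1)
     else if (k - j) mod N = N - 1 then free_gen UNIV (j - 1) \<otimes>\<^bsub>free_group UNIV\<^esub> free_gen UNIV j
     else free_gen UNIV j)"

definition per_aut :: "int \<Rightarrow> int \<Rightarrow> int gword set \<Rightarrow> int gword set"
  where "per_aut N k = free_end UNIV (per_img N k)"

definition shift_aut :: "int gword set \<Rightarrow> int gword set"
  where "shift_aut = free_end UNIV (\<lambda>j. free_gen UNIV (j + 1))"

abbreviation FZ where "FZ \<equiv> free_group (UNIV :: int set)"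

abbreviation gz where "gz \<equiv> free_gen (UNIV :: int set)"

lemma gz_closed: "gz j \<in> carrier FZ"
  by (simp add: free_gen_closed)

lemma FZ_hom:
  assumes "h \<in> hom FZ FZ" "x \<in> carrier FZ"
  shows "y \<in> carrier FZ \<Longrightarrow> h (x \<otimes>\<^bsub>FZ\<^esub> y) = h x \<otimes>\<^bsub>FZ\<^esub> h y" "h (inv\<^bsub>FZ\<^esub> x) = inv\<^bsub>FZ\<^esub> h x"
  using assms group_hom.hom_inv[of FZ FZ h x] group_free_group
  by (auto simp: hom_mult group_hom_def group_hom_axioms_def)

lemma per_img_closed: "per_img N k j \<in> carrier FZ" "per_img_inv N k j \<in> carrier FZ"
proof -
  interpret group FZ by (rule group_free_group)
  show "per_img N k j \<in> carrier FZ" "per_img_inv N k j \<in> carrier FZ"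
    by (simp_all add: per_img_def per_img_inv_def gz_closed)
qed

lemma per_aut_hom: "per_aut N k \<in> hom FZ FZ" and per_aut_gz: "per_aut N k (gz j) = per_img N k j"
  unfolding per_aut_def by (simp_all add: free_end per_img_closed)

lemma shift_aut_hom: "shift_aut \<in> hom FZ FZ" and shift_aut_gz: "shift_aut (gz j) = gz (j + 1)"
  unfolding shift_aut_def by (simp_all add: free_end gz_closed)

lemma per_aut_cong: "k mod N = l mod N \<Longrightarrow> per_aut N k = per_aut N l"
proof -
  assume "k mod N = l mod N"
  then have "(k - j) mod N = (l - j) mod N" for j by (metis mod_diff_left_eq)
  then have "per_img N k = per_img N l" by (intro ext) (simp add: per_img_def)
  then show ?thesis by (simp add: per_aut_def)
qed

lemma free_aut_shift: "free_aut UNIV shift_aut"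
proof (rule free_autI[OF shift_aut_hom, of "free_end UNIV (\<lambda>j. gz (j - 1))"])
  have h: "free_end UNIV (\<lambda>j. gz (j - 1)) \<in> hom FZ FZ"
    "free_end UNIV (\<lambda>j. gz (j - 1)) (gz j) = gz (j - 1)" for j
    by (simp_all add: free_end gz_closed)
  show "free_end UNIV (\<lambda>j. gz (j - 1)) \<in> hom FZ FZ" by (rule h)
  show "free_end UNIV (\<lambda>j. gz (j - 1)) (shift_aut (gz i)) = gz i"
    "shift_aut (free_end UNIV (\<lambda>j. gz (j - 1)) (gz i)) = gz i" for i
    by (simp_all add: h shift_aut_gz)
qed

context
  fixes N :: int
  assumes N: "3 \<le> N"
begin

interpretation F: group FZ by (rule group_free_group)

lemma N_mods: "(1::int) mod N = 1" "(2::int) mod N = 2" "(- 1) mod N = N - 1" "(- 2) mod N = N - 2"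
proof -
  show "(1::int) mod N = 1" "(2::int) mod N = 2" using N by (simp_all add: mod_pos_pos_trivial)
  show 1: "(- 1) mod N = N - 1" using N by (simp add: zmod_minus1)
  show "(- 2) mod N = N - 2" using mod_shift_one(1)[of N "- 1"] N 1 by simp
qed

lemma per_aut_down: "(k - j) mod N = 1 \<Longrightarrow> per_aut N k (gz j) = gz j \<otimes>\<^bsub>FZ\<^esub> gz (j + 1)"
  and per_aut_up: "(k - j) mod N = N - 1 \<Longrightarrow> per_aut N k (gz j) = inv\<^bsub>FZ\<^esub> gz (j - 1) \<otimes>\<^bsub>FZ\<^esub> gz j"
  and per_aut_fix: "(k - j) mod N \<noteq> 1 \<Longrightarrow> (k - j) mod N \<noteq> N - 1 \<Longrightarrow> per_aut N k (gz j) = gz j"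
  using N by (simp_all add: per_aut_gz per_img_def)

lemma free_aut_per: "free_aut UNIV (per_aut N k)"
proof (rule free_autI[OF per_aut_hom, of "free_end UNIV (per_img_inv N k)"])
  let ?d = "free_end UNIV (per_img_inv N k)"
  have d: "?d \<in> hom FZ FZ" "?d (gz j) = per_img_inv N k j" for j
    by (simp_all add: free_end per_img_closed)
  show "?d \<in> hom FZ FZ" by (rule d)
  fix j :: int
  have nxt: "(k - (j + 1)) mod N = 0" if "(k - j) mod N = 1"
    using mod_shift_one(1)[of N "k - j"] N that by (simp add: algebra_simps)
  have prv: "(k - (j - 1)) mod N = 0" if "(k - j) mod N = N - 1"
    using mod_shift_one(2)[of N "k - j"] N that by (simp add: algebra_simps)
  consider "(k - j) mod N = 1" | "(k - j) mod N = N - 1" | "(k - j) mod N \<noteq> 1" "(k - j) mod N \<noteq> N - 1" by blast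
  then have "?d (per_aut N k (gz j)) = gz j \<and> per_aut N k (?d (gz j)) = gz j"
  proof cases
    case 1
    then show ?thesis using N nxt
      by (simp add: d per_aut_gz per_img_def per_img_inv_def FZ_hom[OF per_aut_hom] FZ_hom[OF d(1)] gz_closed F.m_assoc F.inv_cancel)
  next
    case 2
    then show ?thesis using N prv
      by (simp add: d per_aut_gz per_img_def per_img_inv_def FZ_hom[OF per_aut_hom] FZ_hom[OF d(1)] gz_closed F.m_assoc F.inv_cancel)
  next
    case 3
    then show ?thesis using N by (simp add: d per_aut_gz per_img_def per_img_inv_def)
  qed
  then show "?d (per_aut N k (gz j)) = gz j" "per_aut N k (?d (gz j)) = gz j" by simp_all
qed

text \<open>Only the position of \<open>j\<close> relative to \<open>k\<close> matters. If \<open>N\<close> is at least 4, then the crossings \<open>k\<close> and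
  \<open>k + 1\<close> move exactly four basis elements up to periodicity; if \<open>N\<close> is 3, then two of these four
  positions coincide.\<close>

lemma per_aut_braid:
  "per_aut N k (per_aut N (k + 1) (per_aut N k (gz j))) = per_aut N (k + 1) (per_aut N k (per_aut N (k + 1) (gz j)))"
proof -
  note simps = FZ_hom[OF per_aut_hom] gz_closed F.m_assoc F.inv_cancel F.inv_mult_group per_aut_gz per_img_def
    add.commute[of 1 j] add.commute[of "numeral w" j for w]
  let ?thesis' = "\<lambda>k. per_aut N k (per_aut N (k + 1) (per_aut N k (gz j))) =
    per_aut N (k + 1) (per_aut N k (per_aut N (k + 1) (gz j)))"
  have reduce: "?thesis' k" if "(k - j) mod N = r mod N" "?thesis' (j + r)" for r
  proof -
    have "k mod N = (j + r) mod N" using mod_add_cong[OF that(1) HOL.refl, of j] by (simp add: add.commute)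
    then have "per_aut N k = per_aut N (j + r)" "per_aut N (k + 1) = per_aut N (j + r + 1)"
      by (intro per_aut_cong mod_add_cong HOL.refl; assumption)+
    then show ?thesis using that(2) by simp
  qed
  show ?thesis
  proof (cases "N = 3")
    case True
    have "(k - j) mod N = 0 \<or> (k - j) mod N = 1 \<or> (k - j) mod N = 2" unfolding True by presburger
    moreover have "?thesis' (j + 0)" "?thesis' (j + 1)" "?thesis' (j + 2)"
      unfolding True by (simp_all add: simps)
    ultimately show ?thesis using reduce[of 0] reduce[of 1] reduce[of 2] True by fastforce
  next
    case False
    then have N4: "2 \<noteq> N - 1" "N - 2 \<noteq> 1" "4 \<le> N" using N by linarith+
    have "?thesis' (j + 0)" "?thesis' (j + 1)" "?thesis' (j + (- 1))" "?thesis' (j + (- 2))"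
      using N N4 by (simp_all add: simps N_mods)
    moreover have "?thesis' k" if "(k - j) mod N \<notin> {0, 1, N - 1, N - 2}"
    proof -
      have "(k + 1 - j) mod N = (k - j) mod N + 1"
        using mod_shift_one(2)[of N "k - j"] N that by (simp add: algebra_simps)
      then show ?thesis using that by (simp add: per_aut_fix)
    qed
    ultimately show ?thesis using reduce[of 0] reduce[of 1] reduce[of "- 1"] reduce[of "- 2"] N_mods
      by (cases "(k - j) mod N \<in> {0, 1, N - 1, N - 2}") auto
  qed
qed

text \<open>The crossings are not neighbours modulo \<open>N\<close>, so each of them fixes the basis elements that the
  other one multiplies by.\<close>

lemma per_aut_commute:
  assumes d: "2 \<le> l - k" "l - k \<le> N - 2"
  shows "per_aut N k (per_aut N l (gz j)) = per_aut N l (per_aut N k (gz j))"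
proof -
  note hom = FZ_hom[OF per_aut_hom] gz_closed F.m_assoc
  define p where "p = (k - j) mod N"
  define q where "q = (l - j) mod N"
  have pq: "0 \<le> p" "p < N" "0 \<le> q" "q < N" using N by (simp_all add: p_def q_def)
  have "q - p = l - k \<or> q - p = l - k - N"
  proof -
    have "q = (p + (l - k)) mod N" unfolding p_def q_def by (simp add: mod_add_left_eq)
    moreover have "(p + (l - k)) mod N = (if p + (l - k) < N then p + (l - k) else p + (l - k) - N)"
    proof (cases "p + (l - k) < N")
      case True
      then show ?thesis using pq d by (simp add: mod_pos_pos_trivial)
    next
      case False
      have "(p + (l - k)) mod N = (p + (l - k) - N) mod N" by (simp only: mod_diff_right_eq minus_mod_self2)
      also have "\<dots> = p + (l - k) - N" using False pq d by (intro mod_pos_pos_trivial) linarith+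
      finally show ?thesis using False by simp
    qed
    ultimately show ?thesis by (auto split: if_splits)
  qed
  then have ne: "q \<noteq> p" "q \<noteq> p + 1" "p \<noteq> q + 1" "\<not> (p = 0 \<and> q = N - 1)" "\<not> (q = 0 \<and> p = N - 1)"
    using d by linarith+
  have N4: "4 \<le> N" using d by linarith
  have nxt: "(k - (j + 1)) mod N = (if p = 0 then N - 1 else p - 1)"
    "(l - (j + 1)) mod N = (if q = 0 then N - 1 else q - 1)"
    using mod_shift_one(1)[of N "k - j"] mod_shift_one(1)[of N "l - j"] N
    by (simp_all add: p_def q_def algebra_simps)
  have prv: "(k - (j - 1)) mod N = (if p = N - 1 then 0 else p + 1)"
    "(l - (j - 1)) mod N = (if q = N - 1 then 0 else q + 1)"
    using mod_shift_one(2)[of N "k - j"] mod_shift_one(2)[of N "l - j"] N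
    by (simp_all add: p_def q_def algebra_simps)
  note ev = per_aut_gz per_img_def p_def[symmetric] q_def[symmetric] nxt prv
  consider "p = 1" | "p = N - 1" | "p \<noteq> 1" "p \<noteq> N - 1" by blast
  then show ?thesis
  proof cases
    case 1
    then have "q \<noteq> 0" "q \<noteq> 1" "q \<noteq> 2" using ne by auto
    then show ?thesis using 1 N4 pq by (cases "q = N - 1") (simp_all add: hom ev)
  next
    case 2
    then have "q \<noteq> 0" "q \<noteq> N - 1" "q \<noteq> N - 2" using ne by auto
    then show ?thesis using 2 N4 pq by (cases "q = 1") (simp_all add: hom ev)
  next
    case 3
    consider "q = 1" | "q = N - 1" | "q \<noteq> 1" "q \<noteq> N - 1" by blast
    then show ?thesis
    proof cases
      case 1
      then have "p \<noteq> 0" "p \<noteq> 2" using ne by auto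
      then show ?thesis using 1 3 N4 pq by (simp add: hom ev)
    next
      case 2
      then have "p \<noteq> 0" "p \<noteq> N - 2" using ne by auto
      then show ?thesis using 2 3 N4 pq by (simp add: hom ev)
    next
      case inner: 3
      then show ?thesis using 3 by (simp add: hom ev)
    qed
  qed
qed

lemma shift_per_aut: "shift_aut (per_aut N k (gz j)) = per_aut N (k + 1) (shift_aut (gz j))"
  by (simp add: FZ_hom[OF shift_aut_hom] shift_aut_gz gz_closed per_aut_gz per_img_def)

end

section \<open>The Artin group of affine type B\<close>

lemma affine_B_matrix_Suc_Suc:
  assumes "2 \<le> m" "i \<le> m" "j \<le> m"
  shows "affine_B_matrix (Suc m) (Suc i) (Suc j) = typeB_matrix m i j"
proof -
  have "{Suc i, Suc j} \<noteq> {0, 2}" by auto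
  moreover have "(\<exists>k. 1 \<le> k \<and> k \<le> Suc m - 2 \<and> {Suc i, Suc j} = {k, k + 1}) \<longleftrightarrow>
      (j = Suc i \<and> j < m) \<or> (i = Suc j \<and> i < m)"
  proof
    assume "(j = Suc i \<and> j < m) \<or> (i = Suc j \<and> i < m)"
    then show "\<exists>k. 1 \<le> k \<and> k \<le> Suc m - 2 \<and> {Suc i, Suc j} = {k, k + 1}"
      by (intro exI[of _ "Suc (min i j)"]) (auto simp: min_def)
  qed (use assms(1) in \<open>auto simp: doubleton_eq_iff\<close>)
  moreover have "{Suc i, Suc j} = {Suc m - 1, Suc m} \<longleftrightarrow> (j = Suc i \<and> j = m) \<or> (i = Suc j \<and> i = m)"
    unfolding doubleton_eq_iff by auto
  ultimately show ?thesis using assms(2,3) by (simp add: affine_B_matrix_def typeB_matrix_def insert_commute)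
qed

lemma affine_B_matrix_0_Suc:
  assumes "2 \<le> m" "j \<le> m"
  shows "affine_B_matrix (Suc m) 0 (Suc j) = (if j = Suc 0 then 3 else 2)"
    and "affine_B_matrix (Suc m) (Suc j) 0 = (if j = Suc 0 then 3 else 2)"
  using assms unfolding affine_B_matrix_def doubleton_eq_iff by auto

definition affine_gen :: "nat \<Rightarrow> nat \<Rightarrow> nat gword set"
  where "affine_gen m = artin_gen {0..Suc m} (affine_B_matrix (Suc m))"

lemma group_affine_B: "group (affine_B_artin_group n)"
  by (simp add: affine_B_artin_group_def group_artin_group)

lemma affine_gen_closed: "i \<le> Suc m \<Longrightarrow> affine_gen m i \<in> carrier (affine_B_artin_group (Suc m))"
  by (simp add: affine_gen_def affine_B_artin_group_def artin_gen_closed)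

lemma generate_affine_gen:
  "generate (affine_B_artin_group (Suc m)) (affine_gen m ` {0..Suc m}) = carrier (affine_B_artin_group (Suc m))"
  by (simp add: affine_gen_def affine_B_artin_group_def generate_artin_gen)

lemma affineB_family_gen:
  assumes m: "2 \<le> m"
  shows "affineB_family (affine_B_artin_group (Suc m)) m (\<lambda>i. affine_gen m (Suc i)) (affine_gen m 0)"
proof -
  let ?G = "affine_B_artin_group (Suc m)"
  have r: "alt_prod ?G k (affine_gen m i) (affine_gen m j) = alt_prod ?G k (affine_gen m j) (affine_gen m i)"
    if "i \<le> Suc m" "j \<le> Suc m" "i \<noteq> j" "affine_B_matrix (Suc m) i j = enat k" for i j k
    unfolding affine_gen_def affine_B_artin_group_def using that by (intro artin_gen_relation) auto
  have "typeB_family ?G m (\<lambda>i. affine_gen m (Suc i))"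
  proof (rule typeB_familyI)
    show "alt_prod ?G k (affine_gen m (Suc i)) (affine_gen m (Suc j)) =
        alt_prod ?G k (affine_gen m (Suc j)) (affine_gen m (Suc i))"
      if "i \<le> m" "j \<le> m" "i \<noteq> j" "typeB_matrix m i j = enat k" for i j k
      using that m by (intro r) (simp_all add: affine_B_matrix_Suc_Suc)
  qed (simp_all add: group_affine_B affine_gen_closed)
  then interpret B: typeB_family ?G m "\<lambda>i. affine_gen m (Suc i)" .
  show ?thesis
  proof
    show "2 \<le> m" by (rule m)
    show "affine_gen m 0 \<in> carrier ?G" by (simp add: affine_gen_closed)
    show "affine_gen m 0 \<otimes>\<^bsub>?G\<^esub> affine_gen m (Suc i) = affine_gen m (Suc i) \<otimes>\<^bsub>?G\<^esub> affine_gen m 0"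
      if "i \<le> m" "i \<noteq> Suc 0" for i
      using r[of 0 "Suc i" 2] that m
      by (simp add: affine_B_matrix_0_Suc enat_numeral_eq B.alt_prod_numeral affine_gen_closed)
    show "affine_gen m 0 \<otimes>\<^bsub>?G\<^esub> (affine_gen m (Suc (Suc 0)) \<otimes>\<^bsub>?G\<^esub> affine_gen m 0) =
        affine_gen m (Suc (Suc 0)) \<otimes>\<^bsub>?G\<^esub> (affine_gen m 0 \<otimes>\<^bsub>?G\<^esub> affine_gen m (Suc (Suc 0)))"
      using r[of 0 "Suc (Suc 0)" 3] m
      by (simp add: affine_B_matrix_0_Suc enat_numeral_eq B.alt_prod_numeral affine_gen_closed)
  qed
qed

lemma affineB_group_hom:
  assumes "affineB_family H m f z"
  shows "\<exists>h. group_hom (affine_B_artin_group (Suc m)) H h \<and> h (affine_gen m 0) = z \<and>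
    (\<forall>i\<le>m. h (affine_gen m (Suc i)) = f i)"
proof -
  interpret f: affineB_family H m f z by fact
  define u where "u i = (case i of 0 \<Rightarrow> z | Suc j \<Rightarrow> f j)" for i
  have u: "u 0 = z" "u (Suc j) = f j" for j by (simp_all add: u_def)
  have uc: "u i \<in> carrier H" if "i \<le> Suc m" for i
    using that f.gen_closed f.z_closed by (cases i) (simp_all add: u)
  have zr: "alt_prod H k z (f j) = alt_prod H k (f j) z" if "j \<le> m" "(if j = Suc 0 then 3 else 2) = enat k" for j k
  proof (cases "j = Suc 0")
    case True
    then have "k = 3" using that by (simp add: enat_numeral_eq)
    then show ?thesis using True f.z_braid f.z_closed f.gen_closed[OF that(1)] by (simp add: f.alt_prod_numeral)
  next
    case False
    then have "k = 2" using that by (simp add: enat_numeral_eq)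
    then show ?thesis using f.z_commute[OF that(1) False] f.z_closed f.gen_closed[OF that(1)]
      by (simp add: f.alt_prod_numeral)
  qed
  have rel: "alt_prod H k (u i) (u j) = alt_prod H k (u j) (u i)"
    if ij: "i \<in> {0..Suc m}" "j \<in> {0..Suc m}" "i \<noteq> j" "affine_B_matrix (Suc m) i j = enat k" for i j k
  proof (cases i)
    case 0
    then obtain j' where "j = Suc j'" using ij by (cases j) auto
    then show ?thesis using 0 that zr[of j' k] f.m_ge by (simp add: u affine_B_matrix_0_Suc)
  next
    case (Suc i')
    show ?thesis
    proof (cases j)
      case 0
      then show ?thesis using Suc that zr[of i' k] f.m_ge by (simp add: u affine_B_matrix_0_Suc)
    next
      case (Suc j')
      then show ?thesis using \<open>i = Suc i'\<close> that f.alt_prod_relation[of i' j' k] f.m_ge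
        by (simp add: u affine_B_matrix_Suc_Suc)
    qed
  qed
  have "\<exists>h. group_hom (artin_group {0..Suc m} (affine_B_matrix (Suc m))) H h \<and>
      (\<forall>i\<in>{0..Suc m}. h (artin_gen {0..Suc m} (affine_B_matrix (Suc m)) i) = u i)"
  proof (rule artin_group_hom[OF f.is_group])
    show "u i \<in> carrier H" if "i \<in> {0..Suc m}" for i using that uc by simp
  qed (rule rel)
  then obtain h where h: "group_hom (affine_B_artin_group (Suc m)) H h"
    "\<forall>i\<in>{0..Suc m}. h (affine_gen m i) = u i"
    unfolding affine_gen_def affine_B_artin_group_def by blast
  then show ?thesis using u by (intro exI[of _ h]) auto
qed

lemma (in group_hom) hom_run:
  "(\<And>l. j \<le> l \<Longrightarrow> l < j + k \<Longrightarrow> s l \<in> carrier G) \<Longrightarrow> h (run G s j k) = run H (\<lambda>i. h (s i)) j k"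
proof (induction k arbitrary: j)
  case (Suc k)
  have "run G s (Suc j) k \<in> carrier G" using Suc.prems by (intro G.run_closed) auto
  moreover have "h (run G s (Suc j) k) = run H (\<lambda>i. h (s i)) (Suc j) k" using Suc.prems by (intro Suc.IH) auto
  ultimately show ?case using Suc.prems[of j] by simp
qed simp

lemma run_cong: "(\<And>l. j \<le> l \<Longrightarrow> l < j + k \<Longrightarrow> s l = t l) \<Longrightarrow> run G s j k = run G t j k"
  by (induction k arbitrary: j) auto

lemma (in group_hom) hom_conj_by:
  "t \<in> carrier G \<Longrightarrow> y \<in> carrier G \<Longrightarrow> h (conj_by G t y) = conj_by H (h t) (h y)"
  by (simp add: conj_by_def)

text \<open>Identifying the twins satisfies the affine relations; this gives the projection to type \<open>B\<close>.\<close>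

lemma (in braid_family) double_first_family:
  assumes B: "typeB_family G m s" and m: "2 \<le> m"
  shows "affineB_family G m s (s 0)"
proof -
  interpret B: typeB_family G m s by (rule B)
  have s0: "s 0 \<in> carrier G" using s_closed m by simp
  show ?thesis
  proof
    show "s 0 \<otimes> s i = s i \<otimes> s 0" if i: "i \<le> m" "i \<noteq> Suc 0" for i
    proof (cases "i = m")
      case True
      then show ?thesis using B.last_commute[of 0] m by simp
    next
      case False
      then show ?thesis using commute[of 0 i] i m by (cases "i = 0") auto
    qed
    show "s 0 \<otimes> (s (Suc 0) \<otimes> s 0) = s (Suc 0) \<otimes> (s 0 \<otimes> s (Suc 0))" using braid[of 0] m by simp
  qed (use m s0 in simp_all)
qed

section \<open>The affine group acting on the free group\<close>

context
  fixes m :: nat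
  assumes m: "2 \<le> m"
begin

abbreviation "PZ \<equiv> free_perms (UNIV :: int set)"

abbreviation perm_mult (infixl \<open>\<odot>\<close> 70) where "f \<odot> g \<equiv> f \<otimes>\<^bsub>PZ\<^esub> g"

interpretation P: group PZ by (rule group_free_perms)
interpretation F: group FZ by (rule group_free_group)

definition perm_T :: "int \<Rightarrow> int gword set \<Rightarrow> int gword set"
  where "perm_T k = as_perm UNIV (per_aut (int m + 1) k)"

definition perm_shift :: "int gword set \<Rightarrow> int gword set"
  where "perm_shift = as_perm UNIV shift_aut"

lemma N3: "3 \<le> int m + 1"
  using m by simp

lemma perm_T_closed: "perm_T k \<in> carrier PZ"
  unfolding perm_T_def by (rule free_aut_perm[OF free_aut_per[OF N3]])

lemma perm_shift_closed: "perm_shift \<in> carrier PZ"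
  unfolding perm_shift_def by (rule free_aut_perm[OF free_aut_shift])

lemma perm_T_family: "braid_family PZ m (\<lambda>i. perm_T (int i))"
proof
  show "perm_T (int i) \<in> carrier PZ" for i by (rule perm_T_closed)
  show "perm_T (int i) \<odot> (perm_T (int (Suc i)) \<odot> perm_T (int i)) =
      perm_T (int (Suc i)) \<odot> (perm_T (int i) \<odot> perm_T (int (Suc i)))" for i
    unfolding perm_T_def using per_aut_braid[OF N3, of "int i"]
    by (intro as_perm_mult3 free_aut_per N3) (simp add: add.commute)
  show "perm_T (int i) \<odot> perm_T (int j) = perm_T (int j) \<odot> perm_T (int i)"
    if "Suc i < j" "j < m" for i j
    unfolding perm_T_def using that by (intro as_perm_mult2 free_aut_per N3 per_aut_commute) simp_all
qed

interpretation T: braid_family PZ m "\<lambda>i. perm_T (int i)" by (rule perm_T_family)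

lemma perm_shift_T: "perm_shift \<odot> perm_T k = perm_T (k + 1) \<odot> perm_shift"
  unfolding perm_T_def perm_shift_def
  by (intro as_perm_mult2 free_aut_per free_aut_shift N3 shift_per_aut)

lemma perm_T_period: "perm_T (int m + 1) = perm_T 0"
  unfolding perm_T_def by (rule arg_cong[OF per_aut_cong]) simp

text \<open>The last generator is recovered from the rotation as in the annular description, so that the type \<open>B\<close> relations
  follow from the periodicity of the crossings.\<close>

definition perm_B :: "nat \<Rightarrow> int gword set \<Rightarrow> int gword set"
  where "perm_B i = (if i < m then perm_T (int i)
    else inv\<^bsub>PZ\<^esub> (run PZ (\<lambda>i. perm_T (int i)) 0 m) \<odot> perm_shift)"

lemma perm_B_family: "typeB_family PZ m perm_B"
  unfolding perm_B_def
proof (rule T.typeB_of_annular[OF perm_shift_closed])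
  show "perm_shift \<odot> perm_T (int i) = perm_T (int (Suc i)) \<odot> perm_shift" for i
    using perm_shift_T[of "int i"] by (simp add: add.commute)
  show "perm_shift \<odot> (perm_shift \<odot> perm_T (int k)) =
      perm_T (int 0) \<odot> (perm_shift \<odot> perm_shift)" if k: "m = Suc k" for k
  proof -
    have "perm_shift \<odot> (perm_shift \<odot> perm_T (int k)) =
        perm_shift \<odot> (perm_T (int k + 1) \<odot> perm_shift)" by (simp only: perm_shift_T)
    also have "\<dots> = perm_T (int k + 1 + 1) \<odot> (perm_shift \<odot> perm_shift)"
      by (rule P.slide[OF perm_shift_T]) (simp_all add: perm_shift_closed perm_T_closed)
    also have "int k + 1 + 1 = int m + 1" using k by simp
    finally show ?thesis by (simp add: perm_T_period)
  qed
qed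

interpretation PB: typeB_family PZ m perm_B by (rule perm_B_family)

lemma perm_B_tau: "PB.tau = perm_shift"
proof -
  have r: "run PZ perm_B 0 m = run PZ (\<lambda>i. perm_T (int i)) 0 m" by (rule run_cong) (simp add: perm_B_def)
  have "run PZ (\<lambda>i. perm_T (int i)) 0 m \<in> carrier PZ" using T.run_closed'[of 0 m] by simp
  then show ?thesis unfolding PB.tau_eq r by (simp add: perm_B_def P.inv_cancel perm_shift_closed)
qed

abbreviation "Lz j \<equiv> left_mult FZ (gz j)"

lemma Lz_closed: "Lz j \<in> carrier PZ"
  by (rule F.left_mult_Bij[OF gz_closed])

lemma perm_shift_L: "perm_shift \<odot> Lz j = Lz (j + 1) \<odot> perm_shift"
  using as_perm_left_mult[OF free_aut_shift gz_closed] by (simp add: perm_shift_def shift_aut_gz)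

lemma perm_T_L: "perm_T k \<odot> left_mult FZ u = left_mult FZ (per_aut (int m + 1) k u) \<odot> perm_T k"
  if "u \<in> carrier FZ"
  unfolding perm_T_def by (rule as_perm_left_mult[OF free_aut_per[OF N3] that])

lemma perm_T_L_fix:
  assumes "2 \<le> i" "i < m"
  shows "perm_T (int i) \<odot> Lz 0 = Lz 0 \<odot> perm_T (int i)"
proof -
  have "int i mod (int m + 1) = int i" using assms by simp
  then show ?thesis using perm_T_L[OF gz_closed, of "int i" 0] per_aut_fix[OF N3, of "int i" 0] assms by simp
qed

lemma perm_T_L_0: "perm_T 0 \<odot> Lz 0 = Lz 0 \<odot> perm_T 0"
  using perm_T_L[OF gz_closed, of 0 0] per_aut_fix[OF N3, of 0 0] m by simp

lemma perm_T_L_1: "perm_T 1 \<odot> Lz 0 = left_mult FZ (gz 0 \<otimes>\<^bsub>FZ\<^esub> gz 1) \<odot> perm_T 1"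
  using perm_T_L[OF gz_closed, of 1 0] per_aut_down[OF N3, of 1 0] m by simp

lemma perm_T_L_01: "perm_T 0 \<odot> left_mult FZ (gz 0 \<otimes>\<^bsub>FZ\<^esub> gz 1) = Lz 1 \<odot> perm_T 0"
proof -
  have "per_aut (int m + 1) 0 (gz 0) = gz 0" using per_aut_fix[OF N3, of 0 0] m by simp
  moreover have "per_aut (int m + 1) 0 (gz 1) = inv\<^bsub>FZ\<^esub> gz 0 \<otimes>\<^bsub>FZ\<^esub> gz 1"
    using per_aut_up[OF N3, of 0 1] m by (simp add: zmod_minus1)
  ultimately have "per_aut (int m + 1) 0 (gz 0 \<otimes>\<^bsub>FZ\<^esub> gz 1) = gz 1"
    by (simp add: FZ_hom[OF per_aut_hom] gz_closed F.inv_cancel)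
  then show ?thesis using perm_T_L[of "gz 0 \<otimes>\<^bsub>FZ\<^esub> gz 1" 0] gz_closed by simp
qed

text \<open>The last generator is the rotation followed by inverses of crossings, which take the basis element 1 back to
  the basis element 0, so it fixes the latter.\<close>

lemma perm_last_L: "perm_B m \<odot> Lz 0 = Lz 0 \<odot> perm_B m"
proof -
  let ?P = "run PZ (\<lambda>i. perm_T (int i)) 0 m"
  let ?W = "run PZ (\<lambda>i. perm_T (int i)) 2 (m - 2)"
  let ?L = "left_mult FZ (gz 0 \<otimes>\<^bsub>FZ\<^esub> gz 1)"
  have Pc: "?P \<in> carrier PZ" using T.run_closed'[of 0 m] by simp
  have Wc: "?W \<in> carrier PZ" using T.run_closed'[of 2 "m - 2"] m by simp
  have Lc: "?L \<in> carrier PZ" by (intro F.left_mult_Bij F.m_closed gz_closed)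
  have mm: "m = Suc (Suc (m - 2))" using m by simp
  have P: "?P = perm_T 0 \<odot> (perm_T 1 \<odot> ?W)"
    by (subst mm) (simp add: numeral_2_eq_2)
  have W: "Lz 0 \<odot> ?W = ?W \<odot> Lz 0"
    using perm_T_L_fix m Lz_closed perm_T_closed by (intro P.run_commute) auto
  have "?P \<odot> Lz 0 = perm_T 0 \<odot> (perm_T 1 \<odot> (?W \<odot> Lz 0))"
    unfolding P using perm_T_closed Wc Lz_closed by (simp add: P.m_assoc)
  also have "\<dots> = perm_T 0 \<odot> (perm_T 1 \<odot> (Lz 0 \<odot> ?W))" by (simp only: W)
  also have "\<dots> = perm_T 0 \<odot> (?L \<odot> (perm_T 1 \<odot> ?W))"
    using P.slide[OF perm_T_L_1] perm_T_closed Wc Lz_closed Lc by simp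
  also have "\<dots> = Lz 1 \<odot> (perm_T 0 \<odot> (perm_T 1 \<odot> ?W))"
    using P.slide[OF perm_T_L_01] perm_T_closed Wc Lz_closed Lc by simp
  finally have PL: "?P \<odot> Lz 0 = Lz 1 \<odot> ?P" by (simp only: P)
  have "inv\<^bsub>PZ\<^esub> ?P \<odot> (perm_shift \<odot> Lz 0) = (inv\<^bsub>PZ\<^esub> ?P \<odot> Lz 1 \<odot> ?P) \<odot> (inv\<^bsub>PZ\<^esub> ?P \<odot> perm_shift)"
    using perm_shift_L[of 0] Pc perm_shift_closed Lz_closed by (simp add: P.m_assoc P.inv_cancel)
  also have "inv\<^bsub>PZ\<^esub> ?P \<odot> Lz 1 \<odot> ?P = Lz 0" by (rule P.conj_eqI(2)[OF Pc Lz_closed Lz_closed PL])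
  finally show ?thesis using Pc perm_shift_closed Lz_closed by (simp add: perm_B_def P.m_assoc)
qed

text \<open>The twin of the first crossing acts as that crossing followed by left translation with the basis
  element 0. Apart from the braid relation, its relations hold because all generators except \<open>s 1\<close> fix this basis
  element.\<close>

lemma perm_affine_family: "affineB_family PZ m perm_B (Lz 0 \<odot> perm_T 0)"
proof
  let ?z = "Lz 0 \<odot> perm_T 0"
  have B0: "perm_B 0 = perm_T 0" and B1: "perm_B (Suc 0) = perm_T 1" using m by (simp_all add: perm_B_def)
  interpret D: affineB_family PZ m perm_B "perm_B 0" by (rule PB.double_first_family[OF perm_B_family m])
  show "2 \<le> m" by (rule m)
  show "?z \<in> carrier PZ" using Lz_closed perm_T_closed by simp
  show "?z \<odot> perm_B i = perm_B i \<odot> ?z" if i: "i \<le> m" "i \<noteq> Suc 0" for i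
  proof -
    have c: "perm_B i \<in> carrier PZ" by (rule PB.gen_closed[OF i(1)])
    have L: "perm_B i \<odot> Lz 0 = Lz 0 \<odot> perm_B i"
    proof -
      consider "i = 0" | "2 \<le> i" "i < m" | "i = m" using i by linarith
      then show ?thesis
      proof cases
        case 1
        then show ?thesis using perm_T_L_0 B0 by simp
      next
        case 2
        then show ?thesis using perm_T_L_fix by (simp add: perm_B_def)
      next
        case 3
        then show ?thesis using perm_last_L by simp
      qed
    qed
    have T: "perm_T 0 \<odot> perm_B i = perm_B i \<odot> perm_T 0" using D.z_commute[OF i] by (simp add: B0)
    have "perm_B i \<odot> ?z = Lz 0 \<odot> (perm_B i \<odot> perm_T 0)"
      using P.slide[OF L] c Lz_closed perm_T_closed by simp
    also have "\<dots> = Lz 0 \<odot> (perm_T 0 \<odot> perm_B i)" by (simp only: T)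
    also have "\<dots> = ?z \<odot> perm_B i" using c Lz_closed perm_T_closed by (simp add: P.m_assoc)
    finally show ?thesis by simp
  qed
  let ?L = "left_mult FZ (gz 0 \<otimes>\<^bsub>FZ\<^esub> gz 1)"
  have Lc: "?L \<in> carrier PZ" by (intro F.left_mult_Bij F.m_closed gz_closed)
  have LL: "Lz 0 \<odot> Lz 1 = ?L" using hom_mult[OF F.left_mult_hom gz_closed gz_closed, of 0 1] by simp
  have br: "perm_T 0 \<odot> (perm_T 1 \<odot> perm_T 0) = perm_T 1 \<odot> (perm_T 0 \<odot> perm_T 1)"
    using T.braid[of 0] m by simp
  have "?z \<odot> (perm_T 1 \<odot> ?z) = Lz 0 \<odot> (perm_T 0 \<odot> (perm_T 1 \<odot> (Lz 0 \<odot> perm_T 0)))"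
    using Lz_closed perm_T_closed by (simp add: P.m_assoc)
  also have "\<dots> = Lz 0 \<odot> (perm_T 0 \<odot> (?L \<odot> (perm_T 1 \<odot> perm_T 0)))"
    using P.slide[OF perm_T_L_1] Lz_closed perm_T_closed Lc by simp
  also have "\<dots> = Lz 0 \<odot> (Lz 1 \<odot> (perm_T 0 \<odot> (perm_T 1 \<odot> perm_T 0)))"
    using P.slide[OF perm_T_L_01] Lz_closed perm_T_closed Lc by simp
  also have "\<dots> = ?L \<odot> (perm_T 1 \<odot> (perm_T 0 \<odot> perm_T 1))"
    unfolding br LL[symmetric] using Lz_closed perm_T_closed by (simp add: P.m_assoc)
  also have "\<dots> = perm_T 1 \<odot> (Lz 0 \<odot> (perm_T 0 \<odot> perm_T 1))"
    using P.slide[OF perm_T_L_1] Lz_closed perm_T_closed Lc by simp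
  finally show "?z \<odot> (perm_B (Suc 0) \<odot> ?z) = perm_B (Suc 0) \<odot> (?z \<odot> perm_B (Suc 0))"
    unfolding B1 using Lz_closed perm_T_closed by (simp add: P.m_assoc)
qed

text \<open>The criterion for free kernels, applied to the map that identifies the twins. The elements \<open>kgen j\<close>
  act by left translation with the basis element \<open>j\<close>: this holds for \<open>kgen 0\<close> by construction and spreads
  to the others by the rotation.\<close>

theorem virtually_poly_free_affine_B: "virtually_poly_free (affine_B_artin_group (Suc m))"
proof -
  let ?G = "affine_B_artin_group (Suc m)" and ?Q = "typeB_group m"
  define s where "s i = affine_gen m (Suc i)" for i
  define z where "z = affine_gen m 0"
  interpret A: affineB_family ?G m s z
    unfolding s_def z_def by (rule affineB_family_gen[OF m])
  interpret B: typeB_family ?Q m "typeB_gen m" by (rule typeB_family_gen)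
  have "affineB_family ?Q m (typeB_gen m) (typeB_gen m 0)"
    by (rule B.double_first_family[OF typeB_family_gen m])
  then obtain f where f: "group_hom ?G ?Q f" and f_z: "f z = typeB_gen m 0"
    and f_s: "\<And>i. i \<le> m \<Longrightarrow> f (s i) = typeB_gen m i"
    using affineB_group_hom[of ?Q m "typeB_gen m" "typeB_gen m 0"] unfolding s_def z_def by blast
  interpret f: group_hom ?G ?Q f by (rule f)
  obtain \<sigma> where \<sigma>: "group_hom ?Q ?G \<sigma>" and \<sigma>_gen: "\<And>i. i \<le> m \<Longrightarrow> \<sigma> (typeB_gen m i) = s i"
    using typeB_group_hom[OF A.typeB_family_axioms] by blast
  interpret \<sigma>: group_hom ?Q ?G \<sigma> by (rule \<sigma>)
  obtain \<alpha> where \<alpha>: "group_hom ?G PZ \<alpha>" and \<alpha>_z: "\<alpha> z = Lz 0 \<odot> perm_T 0"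
    and \<alpha>_s: "\<And>i. i \<le> m \<Longrightarrow> \<alpha> (s i) = perm_B i"
    using affineB_group_hom[OF perm_affine_family] unfolding s_def z_def by blast
  interpret \<alpha>: group_hom ?G PZ \<alpha> by (rule \<alpha>)
  have Bgen: "typeB_gen m ` {..m} \<subseteq> carrier ?Q" by (auto intro: typeB_gen_closed)
  have f\<sigma>: "f (\<sigma> q) = q" if "q \<in> carrier ?Q" for q
  proof -
    have "(f \<circ> \<sigma>) q = q"
    proof (rule hom_fixing_generators[OF B.is_group hom_compose[OF \<sigma>.homh f.homh] Bgen generate_typeB_gen _ that])
      show "(f \<circ> \<sigma>) a = a" if "a \<in> typeB_gen m ` {..m}" for a using that by (auto simp: \<sigma>_gen f_s)
    qed
    then show ?thesis by simp
  qed
  have onto: "f ` carrier ?G = carrier ?Q" by (rule f.surj_of_section[OF \<sigma> f\<sigma>])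
  have s0: "s 0 \<in> carrier ?G" by (rule A.c01)
  have fb0: "f (A.kgen 0) = \<one>\<^bsub>?Q\<^esub>"
    using A.z_closed s0 f_s[of 0] typeB_gen_closed[of 0 m] by (simp add: A.kgen_zero f_z)
  have kgen_conj: "A.kgen j = conj_by ?G (A.tau [^]\<^bsub>?G\<^esub> j) (A.kgen 0)" for j
    using A.kgen_add[of j 0] by simp
  have fb: "f (A.kgen j) = \<one>\<^bsub>?Q\<^esub>" for j
    unfolding kgen_conj[of j] using A.tau_closed A.kgen_closed
    by (simp add: f.hom_conj_by fb0) (simp add: conj_by_def)
  have \<alpha>_tau: "\<alpha> A.tau = perm_shift"
  proof -
    have "\<alpha> A.tau = run PZ (\<lambda>i. \<alpha> (s i)) 0 (Suc m)"
      unfolding A.tau_def using A.gen_closed by (intro \<alpha>.hom_run) auto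
    also have "\<dots> = run PZ perm_B 0 (Suc m)" using \<alpha>_s by (intro run_cong) auto
    finally show ?thesis using perm_B_tau by (simp add: PB.tau_def)
  qed
  have \<alpha>b0: "\<alpha> (A.kgen 0) = Lz 0"
  proof -
    have "\<alpha> (s 0) = perm_T 0" using \<alpha>_s[of 0] m by (simp add: perm_B_def)
    then show ?thesis using A.z_closed s0 Lz_closed perm_T_closed by (simp add: A.kgen_zero \<alpha>_z P.m_assoc)
  qed
  have \<alpha>b_step: "\<alpha> (A.kgen (j + 1)) = perm_shift \<odot> \<alpha> (A.kgen j) \<odot> inv\<^bsub>PZ\<^esub> perm_shift" for j
    unfolding A.kgen_conj_tau(1)[symmetric] using A.tau_closed A.kgen_closed by (simp add: \<alpha>_tau)
  have \<alpha>b_step': "\<alpha> (A.kgen (j - 1)) = inv\<^bsub>PZ\<^esub> perm_shift \<odot> \<alpha> (A.kgen j) \<odot> perm_shift" for j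
    unfolding A.kgen_conj_tau(2)[symmetric] using A.tau_closed A.kgen_closed by (simp add: \<alpha>_tau)
  have \<alpha>b: "\<alpha> (A.kgen j) = Lz j" for j
  proof (induction j rule: int_induct[where k = 0])
    case base
    show ?case by (rule \<alpha>b0)
  next
    case (step1 i)
    then show ?case using P.conj_eqI(1)[OF perm_shift_closed Lz_closed Lz_closed perm_shift_L[of i]]
      by (simp add: \<alpha>b_step)
  next
    case (step2 i)
    then show ?case
      using P.conj_eqI(2)[OF perm_shift_closed Lz_closed Lz_closed perm_shift_L[of "i - 1"]]
      by (simp add: \<alpha>b_step')
  qed
  let ?K = "generate ?G (range A.kgen)"
  have bbr: "range A.kgen \<subseteq> carrier ?G" using A.kgen_closed by auto
  interpret K: subgroup ?K ?G by (rule A.generate_is_subgroup[OF bbr])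
  have bK: "A.kgen j \<in> ?K" for j by (rule generate.incl) simp

  \<comment> \<open>The rotation takes the place of the last generator of type \<open>B\<close>, since its action on the
    elements \<open>kgen j\<close> is the simpler one.\<close>
  let ?T = "insert B.tau (typeB_gen m ` {..<m})"
  have Tc: "?T \<subseteq> carrier ?Q" using B.tau_closed B.s_closed by auto
  have genT: "generate ?Q ?T = carrier ?Q"
  proof
    show "generate ?Q ?T \<subseteq> carrier ?Q" by (rule B.generate_incl[OF Tc])
    interpret S: subgroup "generate ?Q ?T" ?Q by (rule B.generate_is_subgroup[OF Tc])
    have gi: "typeB_gen m i \<in> generate ?Q ?T" if "i < m" for i using that by (intro generate.incl) simp
    have gt: "B.tau \<in> generate ?Q ?T" by (intro generate.incl) simp
    have "run ?Q (typeB_gen m) j k \<in> generate ?Q ?T" if "j + k \<le> m" for j k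
      using that
    proof (induction k arbitrary: j)
      case (Suc k)
      then show ?case using gi[of j] by simp
    qed simp
    then have R: "run ?Q (typeB_gen m) 0 m \<in> generate ?Q ?T" by simp
    have "typeB_gen m m = inv\<^bsub>?Q\<^esub> run ?Q (typeB_gen m) 0 m \<otimes>\<^bsub>?Q\<^esub> B.tau"
      unfolding B.tau_eq using B.run_closed'[of 0 m] B.last_closed by (simp add: B.inv_cancel)
    then have "typeB_gen m m \<in> generate ?Q ?T" using R gt by simp
    then have "typeB_gen m i \<in> generate ?Q ?T" if "i \<le> m" for i using that gi by (cases "i = m") auto
    then have "typeB_gen m ` {..m} \<subseteq> generate ?Q ?T" by blast
    then show "carrier ?Q \<subseteq> generate ?Q ?T"
      using B.generate_subgroup_incl[OF _ S.subgroup_axioms, of "typeB_gen m ` {..m}"]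
      unfolding generate_typeB_gen by blast
  qed
  have \<sigma>_tau: "\<sigma> B.tau = A.tau"
  proof -
    have "\<sigma> B.tau = run ?G (\<lambda>i. \<sigma> (typeB_gen m i)) 0 (Suc m)"
      unfolding B.tau_def using B.gen_closed by (intro \<sigma>.hom_run) auto
    also have "\<dots> = run ?G s 0 (Suc m)" using \<sigma>_gen by (intro run_cong) auto
    finally show ?thesis by (simp add: A.tau_def)
  qed
  have "is_free_group (?G\<lparr>carrier := kernel ?G ?Q f\<rparr>)"
  proof (rule free_kernel_criterion[OF f \<sigma> f\<sigma>, where b = A.kgen and I = UNIV and \<alpha> = \<alpha> and
        A = "affine_gen m ` {0..Suc m}" and B = ?T])
    show "A.kgen i \<in> carrier ?G" for i by (rule A.kgen_closed)
    show "f (A.kgen i) = \<one>\<^bsub>?Q\<^esub>" for i by (rule fb)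
    show "affine_gen m ` {0..Suc m} \<subseteq> carrier ?G" by (auto intro: affine_gen_closed)
    show "generate ?G (affine_gen m ` {0..Suc m}) = carrier ?G" by (rule generate_affine_gen)
    show "?T \<subseteq> carrier ?Q" by (rule Tc)
    show "generate ?Q ?T = carrier ?Q" by (rule genT)
    show "\<alpha> \<in> hom ?G PZ" by (rule \<alpha>.homh)
    show "\<alpha> (A.kgen i) = left_mult FZ (gz i)" for i by (rule \<alpha>b)
    show "\<exists>k\<in>?K. \<exists>q\<in>carrier ?Q. a = k \<otimes>\<^bsub>?G\<^esub> \<sigma> q" if a: "a \<in> affine_gen m ` {0..Suc m}" for a
    proof -
      obtain i where i: "i \<le> Suc m" "a = affine_gen m i" using a by auto
      show ?thesis
      proof (cases i)
        case 0
        have "z = A.kgen 0 \<otimes>\<^bsub>?G\<^esub> \<sigma> (typeB_gen m 0)"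
          using s0 A.z_closed by (simp add: \<sigma>_gen A.kgen_zero A.m_assoc)
        then have "a = A.kgen 0 \<otimes>\<^bsub>?G\<^esub> \<sigma> (typeB_gen m 0)" using 0 i by (simp add: z_def)
        then show ?thesis using bK typeB_gen_closed[of 0 m] by blast
      next
        case (Suc j)
        then have "a = \<one>\<^bsub>?G\<^esub> \<otimes>\<^bsub>?G\<^esub> \<sigma> (typeB_gen m j)" using i A.gen_closed[of j] by (simp add: \<sigma>_gen s_def)
        then show ?thesis using K.one_closed typeB_gen_closed[of j m] Suc i by (metis Suc_le_mono)
      qed
    qed
    fix q j assume q: "q \<in> ?T"
    have "\<sigma> q \<otimes>\<^bsub>?G\<^esub> A.kgen j \<otimes>\<^bsub>?G\<^esub> inv\<^bsub>?G\<^esub> \<sigma> q \<in> ?K \<and> inv\<^bsub>?G\<^esub> \<sigma> q \<otimes>\<^bsub>?G\<^esub> A.kgen j \<otimes>\<^bsub>?G\<^esub> \<sigma> q \<in> ?K"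
    proof (cases "q = B.tau")
      case True
      then show ?thesis using bK by (simp add: \<sigma>_tau A.kgen_conj_tau)
    next
      case False
      then obtain i where "i < m" "q = typeB_gen m i" using q by auto
      then show ?thesis using A.kgen_conj_in_generate[of i j] by (simp add: \<sigma>_gen)
    qed
    then show "\<sigma> q \<otimes>\<^bsub>?G\<^esub> A.kgen j \<otimes>\<^bsub>?G\<^esub> inv\<^bsub>?G\<^esub> \<sigma> q \<in> ?K"
      "inv\<^bsub>?G\<^esub> \<sigma> q \<otimes>\<^bsub>?G\<^esub> A.kgen j \<otimes>\<^bsub>?G\<^esub> \<sigma> q \<in> ?K" by simp_all
  qed
  then show ?thesis
    by (rule virtually_poly_free_extension[OF f onto _ virtually_poly_free_typeB[OF virtually_poly_free_braid_group]])
qed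

end

theorem theorem1p1:
  fixes n :: nat
  assumes "n \<ge> 3"
  shows "virtually_poly_free (affine_B_artin_group n)"
proof -
  have "n = Suc (n - 1)" "2 \<le> n - 1" using assms by simp_all
  then show ?thesis using virtually_poly_free_affine_B[of "n - 1"] by simp
qed

end
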